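(* Let $X$ be an infinite-dimensional Banach space (real or complex) and $1\le\xi<\omega_1$. (i) If $\#\bigl(\mathrm{SP}_{1,w}(X)/\!\approx_\xi\bigr)$ is finite, then every operator $S\in\mathcal{SS}_\xi(X)\setminus\{0\}$ has a non-trivial hyperinvariant subspace. (ii) If $\#\bigl(\mathrm{SP}_{1,w}(X)/\!\approx\bigr)$ is finite, then every operator $S\in\mathcal{SS}(X)\setminus\{0\}$ has a non-trivial hyperinvariant subspace.
   Context: $\mathbb{N}=\{1,2,\dots\}$; $\mathcal{L}(X)$ is the space of bounded linear operators on $X$; $\#$ denotes cardinality; $[x_i]_{i\in F}$ is the closed linear span of $\{x_i\}_{i\in F}$. For finite sets $A,B\subseteq\mathbb{N}$, $A<B$ means $\max A<\min B$, and $n\le A$ means $n\le\min A$ (the empty set satisfies all such relations). A non-trivial hyperinvariant subspace of $S\in\mathcal{L}(X)$ is a closed subspace different from $\{0\}$ and $X$ that is invariant under every operator in $\mathcal{L}(X)$ commuting with $S$. Schreier families. For families $\mathcal{F},\mathcal{G}$ of finite subsets of $\mathbb{N}$ put $\mathcal{F}[\mathcal{G}]=\{\bigcup_{i=1}^n G_i : n\in\mathbb{N},\ G_1<\dots<G_n,\ G_i\in\mathcal{G}\text{ for } i\le n,\ \{\min G_i\}_{i=1}^n\in\mathcal{F}\}$. Let $\mathcal{S}_0=\{\{n\}:n\in\mathbb{N}\}\cup\{\varnothing\}$, $\mathcal{S}_1=\{F\subseteq\mathbb{N}\text{ finite}: \#F\le\min F\}$ (including $\varnothing$), $\mathcal{S}_{\xi+1}=\mathcal{S}_1[\mathcal{S}_\xi]$,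 and for a countable limit ordinal $\xi$ fix a sequence of ordinals $\xi_n\nearrow\xi$ and let $\mathcal{S}_\xi=\{F: n\le F\text{ and }F\in\mathcal{S}_{\xi_n}\text{ for some }n\in\mathbb{N}\}$. Operators. $\mathcal{SS}(X)$ is the set of strictly singular operators $T\in\mathcal{L}(X)$, i.e. those whose restriction to any infinite-dimensional subspace is not an isomorphism onto its image. $T\in\mathcal{L}(X)$ is $\mathcal{S}_\xi$-strictly singular, $T\in\mathcal{SS}_\xi(X)$, if for every $\varepsilon>0$ and every basic sequence $(x_n)$ in $X$ there exist $F\in\mathcal{S}_\xi$ and $z\in[x_i]_{i\in F}\setminus\{0\}$ with $\|Tz\|\le\varepsilon\|z\|$. Sequences. Write $a\overset{C}{\approx}b$ if $\frac1C a\le b\le Ca$. A sequence is seminormalized if its norms are bounded above and bounded away from $0$. A seminormalized basic sequence $(x_n)$ in $X$ is Schreier spreading if there is $1\le C<\infty$ such that for all $F=\{f_1<\dots<f_n\}$, $G=\{g_1<\dots<g_n\}$ in $\mathcal{S}_1$ and scalars $(a_i)_{i=1}^n$, $\|\sum_{i=1}^n a_ix_{f_i}\|\overset{C}{\approx}\|\sum_{i=1}^n a_ix_{g_i}\|$. $\mathrm{SP}_{1,w}(X)$ is the set of seminormalized weakly null basic sequences in $X$ that are Schreier spreading. On it, two equivalence relations are considered: $(x_n)\approx_\xi(y_n)$ if there is $1\le K<\infty$ with $\|\sum_{i\in F}a_ix_i\|\overset{K}{\approx}\|\sum_{i\in F}a_iy_i\|$ for all $F\in\mathcal{S}_\xi$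 and scalars $(a_i)_{i\in F}$; and $(x_n)\approx(y_n)$ if there is $1\le K<\infty$ with $\|\sum a_nx_n\|\overset{K}{\approx}\|\sum a_ny_n\|$ for all finitely supported scalar sequences $(a_n)$. *)

theory Defs
  imports "HOL-Analysis.Analysis"
begin

section \<open>Banach spaces over the real or the complex numbers\<close>

class real_or_complex = real_normed_field +
  assumes real_or_complex:
    "(\<forall>z. \<exists>r. z = r *\<^sub>R 1) \<or> (\<exists>j. j * j = - 1 \<and> (\<forall>z. \<exists>r t. z = r *\<^sub>R 1 + t *\<^sub>R j))"

instance real :: real_or_complex
  by standard auto

instance complex :: real_or_complex
proof
  have "\<exists>j::complex. j * j = - 1 \<and> (\<forall>z. \<exists>r t. z = r *\<^sub>R 1 + t *\<^sub>R j)"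
  proof (intro exI[of _ \<i>] conjI allI)
    fix z
    show "\<exists>r t. z = r *\<^sub>R 1 + t *\<^sub>R \<i>"
      by (intro exI[of _ "Re z"] exI[of _ "Im z"]) (simp add: complex_eq_iff)
  qed simp
  then show "(\<forall>z::complex. \<exists>r. z = r *\<^sub>R 1) \<or>
    (\<exists>j::complex. j * j = - 1 \<and> (\<forall>z. \<exists>r t. z = r *\<^sub>R 1 + t *\<^sub>R j))" ..
qed

text \<open>The library class of Banach spaces only provides real scalars. A \<^typ>\<open>'k\<close>-Banach space is a
  type of that class with a \<^typ>\<open>'k\<close>-scalar multiplication extending the real one, for which the
  norm is homogeneous.\<close>

locale banach_space_over = vector_space smul
  for smul :: "'k::real_or_complex \<Rightarrow> 'a::banach \<Rightarrow> 'a" +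
  assumes norm_scale: "norm (smul c x) = norm c * norm x"
    and scale_of_real: "smul (of_real r) x = r *\<^sub>R x"

lemma banach_space_over_real: "banach_space_over (scaleR :: real \<Rightarrow> 'a::banach \<Rightarrow> 'a)"
  by unfold_locales (auto simp: algebra_simps)

definition infinite_dimensional :: "('k::field \<Rightarrow> 'a::ab_group_add \<Rightarrow> 'a) \<Rightarrow> 'a set \<Rightarrow> bool" where
  "infinite_dimensional smul Y \<longleftrightarrow> \<not> (\<exists>B. finite B \<and> Y \<subseteq> module.span smul B)"

definition bounded_operators ::
    "('k::real_or_complex \<Rightarrow> 'a::banach \<Rightarrow> 'a) \<Rightarrow> ('a \<Rightarrow> 'a) set" where
  "bounded_operators smul = {T. bounded_linear T \<and> (\<forall>c x. T (smul c x) = smul c (T x))}"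

definition dual_space :: "('k::real_or_complex \<Rightarrow> 'a::banach \<Rightarrow> 'a) \<Rightarrow> ('a \<Rightarrow> 'k) set" where
  "dual_space smul = {\<phi>. bounded_linear \<phi> \<and> (\<forall>c x. \<phi> (smul c x) = c * \<phi> x)}"

definition nontrivial_hyperinvariant ::
    "('k::real_or_complex \<Rightarrow> 'a::banach \<Rightarrow> 'a) \<Rightarrow> ('a \<Rightarrow> 'a) \<Rightarrow> 'a set \<Rightarrow> bool" where
  "nontrivial_hyperinvariant smul S M \<longleftrightarrow>
     module.subspace smul M \<and> closed M \<and> M \<noteq> {0} \<and> M \<noteq> UNIV \<and>
     (\<forall>T \<in> bounded_operators smul. T \<circ> S = S \<circ> T \<longrightarrow> T ` M \<subseteq> M)"


section \<open>Schreier families\<close>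

text \<open>Members of the families are subsets of \<^term>\<open>{1..} :: nat set\<close>.\<close>

definition set_less :: "nat set \<Rightarrow> nat set \<Rightarrow> bool" where
  "set_less A B \<longleftrightarrow> (\<forall>a\<in>A. \<forall>b\<in>B. a < b)"

text \<open>Blocks \<^term>\<open>G i\<close> may be empty. As nothing is comparable through an empty block, the blocks
  are required to be pairwise (not just consecutively) successive, and an empty block contributes
  no minimum.\<close>

definition family_comp :: "nat set set \<Rightarrow> nat set set \<Rightarrow> nat set set" where
  "family_comp \<F> \<G> = {\<Union>i\<in>{1..n}. G i | (n::nat) G.
     1 \<le> n \<and> (\<forall>i\<in>{1..n}. G i \<in> \<G>) \<and>
     (\<forall>i\<in>{1..n}. \<forall>j\<in>{1..n}. i < j \<longrightarrow> set_less (G i) (G j)) \<and>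
     {Min (G i) | i. i \<in> {1..n} \<and> G i \<noteq> {}} \<in> \<F>}"

definition schreier0 :: "nat set set" where
  "schreier0 = {{n} | n. 1 \<le> n} \<union> {{}}"

definition schreier1 :: "nat set set" where
  "schreier1 = {F. finite F \<and> F \<subseteq> {1..} \<and> (F \<noteq> {} \<longrightarrow> card F \<le> Min F)}"

text \<open>An ordinal is represented by an element \<^term>\<open>\<eta>\<close> of an arbitrary well-ordered type, namely as
  the order type of \<^term>\<open>{..<\<eta>}\<close>; it is countable iff this set is.\<close>

definition ord_zero :: "'o::wellorder \<Rightarrow> bool" where
  "ord_zero \<eta> \<longleftrightarrow> {..<\<eta>} = {}"

definition ord_succ :: "'o::wellorder \<Rightarrow> 'o \<Rightarrow> bool" where
  "ord_succ \<zeta> \<eta> \<longleftrightarrow> {..<\<eta>} = {..\<zeta>}"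

definition ord_limit :: "'o::wellorder \<Rightarrow> bool" where
  "ord_limit \<eta> \<longleftrightarrow> \<not> ord_zero \<eta> \<and> \<not> (\<exists>\<zeta>. ord_succ \<zeta> \<eta>)"

text \<open>The choice of a sequence increasing strictly to each countable limit ordinal
  (indexed by \<^term>\<open>{1..} :: nat set\<close>).\<close>

definition ladder_system :: "('o::wellorder \<Rightarrow> nat \<Rightarrow> 'o) \<Rightarrow> bool" where
  "ladder_system L \<longleftrightarrow> (\<forall>\<eta>. ord_limit \<eta> \<and> countable {..<\<eta>} \<longrightarrow>
     strict_mono_on {1..} (L \<eta>) \<and> (\<forall>n\<ge>1. L \<eta> n < \<eta>) \<and> (\<forall>\<zeta><\<eta>. \<exists>n\<ge>1. \<zeta> < L \<eta> n))"

lemma ord_succ_unique: "ord_succ \<zeta> \<eta> \<Longrightarrow> ord_succ \<zeta>' \<eta> \<Longrightarrow> \<zeta> = \<zeta>'"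
  by (simp add: ord_succ_def)

lemma ord_succ_less: "ord_succ \<zeta> \<eta> \<Longrightarrow> \<zeta> < \<eta>"
  unfolding ord_succ_def by blast

lemma the_ord_succ: "ord_succ \<zeta> \<eta> \<Longrightarrow> (THE \<zeta>. ord_succ \<zeta> \<eta>) = \<zeta>"
  using ord_succ_unique by blast

text \<open>The conjunct \<^term>\<open>L \<eta> n < \<eta>\<close> only serves the termination of the recursion; it holds
  for every ladder system, see \<open>schreier_limit\<close> below.\<close>

declare conj_cong [fundef_cong]

function schreier :: "('o::wellorder \<Rightarrow> nat \<Rightarrow> 'o) \<Rightarrow> 'o \<Rightarrow> nat set set" where
  "schreier L \<eta> =
    (if ord_zero \<eta> then schreier0
     else if \<exists>\<zeta>. ord_succ \<zeta> \<eta> then family_comp schreier1 (schreier L (THE \<zeta>. ord_succ \<zeta> \<eta>))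
     else {F. \<exists>n\<ge>1. L \<eta> n < \<eta> \<and> (\<forall>m\<in>F. n \<le> m) \<and> F \<in> schreier L (L \<eta> n)})"
  by auto
termination
  by (relation "inv_image {(\<zeta>, \<eta>). \<zeta> < \<eta>} snd")
    (auto simp: wf the_ord_succ ord_succ_less)

declare conj_cong [fundef_cong del] schreier.simps [simp del]

lemma schreier_zero: "ord_zero \<eta> \<Longrightarrow> schreier L \<eta> = schreier0"
  by (simp add: schreier.simps)

lemma schreier_succ:
  assumes "ord_succ \<zeta> \<eta>"
  shows "schreier L \<eta> = family_comp schreier1 (schreier L \<zeta>)"
proof -
  have "\<not> ord_zero \<eta>"
    using ord_succ_less[OF assms] by (auto simp: ord_zero_def)
  then show ?thesis
    using assms the_ord_succ[OF assms] by (subst schreier.simps) auto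
qed

lemma schreier_limit:
  assumes "ladder_system L" "ord_limit \<eta>" "countable {..<\<eta>}"
  shows "schreier L \<eta> = {F. \<exists>n\<ge>1. (\<forall>m\<in>F. n \<le> m) \<and> F \<in> schreier L (L \<eta> n)}"
proof -
  have "\<forall>n\<ge>1. L \<eta> n < \<eta>"
    using assms by (simp add: ladder_system_def)
  then show ?thesis
    using assms(2) by (subst schreier.simps) (auto simp: ord_limit_def)
qed

lemma family_comp_schreier1_schreier0: "family_comp schreier1 schreier0 = schreier1"
proof (intro equalityI subsetI)
  fix F assume "F \<in> family_comp schreier1 schreier0"
  then obtain n :: nat and G where F: "F = (\<Union>i\<in>{1..n}. G i)"
    and G: "\<forall>i\<in>{1..n}. G i \<in> schreier0"
    and M: "{Min (G i) | i. i \<in> {1..n} \<and> G i \<noteq> {}} \<in> schreier1"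
    unfolding family_comp_def by blast
  have single: "G i = {Min (G i)}" if "i \<in> {1..n}" "G i \<noteq> {}" for i
    using G that by (auto simp: schreier0_def)
  have "F = {Min (G i) | i. i \<in> {1..n} \<and> G i \<noteq> {}}" (is "F = ?M")
  proof (intro equalityI subsetI)
    fix x assume "x \<in> F"
    then obtain i where i: "i \<in> {1..n}" "x \<in> G i" using F by blast
    then have "G i \<noteq> {}" by blast
    with single[OF i(1)] i(2) have "x = Min (G i)" by blast
    with i(1) \<open>G i \<noteq> {}\<close> show "x \<in> ?M" by blast
  next
    fix x assume "x \<in> ?M"
    then obtain i where i: "i \<in> {1..n}" "G i \<noteq> {}" "x = Min (G i)" by blast
    with single[OF i(1,2)] have "x \<in> G i" by blast
    with i(1) F show "x \<in> F" by blast
  qed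
  with M show "F \<in> schreier1" by simp
next
  fix F assume F: "F \<in> schreier1"
  then have fin: "finite F" and pos: "F \<subseteq> {1..}" by (auto simp: schreier1_def)
  show "F \<in> family_comp schreier1 schreier0"
  proof (cases "F = {}")
    case True
    have "{} \<in> schreier1" by (simp add: schreier1_def)
    then show ?thesis unfolding family_comp_def True
      by (intro CollectI exI[of _ "1::nat"] exI[of _ "\<lambda>_. {}"])
        (auto simp: schreier0_def set_less_def)
  next
    case False
    define n where "n = card F"
    define f where "f = (\<lambda>i. sorted_list_of_set F ! (i - 1))"
    have len: "length (sorted_list_of_set F) = n" by (simp add: n_def)
    have n: "1 \<le> n" using False fin by (simp add: n_def Suc_le_eq card_gt_0_iff)
    have img: "f ` {1..n} = F"
    proof -
      have "f ` {1..n} = (\<lambda>i. sorted_list_of_set F ! i) ` {0..<n}"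
        unfolding f_def by (force simp: image_iff Bex_def intro: exI[of _ "Suc _"])
      also have "\<dots> = set (sorted_list_of_set F)"
        using len by (auto simp: set_conv_nth)
      finally show ?thesis using fin by simp
    qed
    have mono: "f i < f j" if "i \<in> {1..n}" "j \<in> {1..n}" "i < j" for i j
      using that len strict_sorted_list_of_set[of F]
      by (auto simp: f_def sorted_wrt_iff_nth_less)
    have "{Min {f i} | i. i \<in> {1..n} \<and> {f i} \<noteq> {}} = F" using img by auto
    moreover have "(\<Union>i\<in>{1..n}. {f i}) = F" using img by auto
    moreover have "\<forall>i\<in>{1..n}. {f i} \<in> schreier0" using img pos by (auto simp: schreier0_def)
    ultimately show ?thesis unfolding family_comp_def using n mono F
      by (intro CollectI exI[of _ n] exI[of _ "\<lambda>i. {f i}"]) (auto simp: set_less_def)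
  qed
qed

lemma schreier_one: "ord_zero \<zeta> \<Longrightarrow> ord_succ \<zeta> \<eta> \<Longrightarrow> schreier L \<eta> = schreier1"
  by (simp add: schreier_succ schreier_zero family_comp_schreier1_schreier0)


section \<open>Sequences\<close>

text \<open>A sequence is a function on \<^typ>\<open>nat\<close> of which only the values at \<^term>\<open>{1..} :: nat set\<close> are
  relevant; no notion below depends on the value at \<^term>\<open>0 :: nat\<close>.\<close>

definition approx :: "real \<Rightarrow> real \<Rightarrow> real \<Rightarrow> bool" where
  "approx C a b \<longleftrightarrow> 1 / C * a \<le> b \<and> b \<le> C * a"

text \<open>A basic sequence is a Schauder basis of its closed linear span.\<close>

definition basic_sequence ::
    "('k::real_or_complex \<Rightarrow> 'a::banach \<Rightarrow> 'a) \<Rightarrow> (nat \<Rightarrow> 'a) \<Rightarrow> bool" where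
  "basic_sequence smul x \<longleftrightarrow>
     (\<forall>y \<in> closure (module.span smul (x ` {1..})).
        \<exists>!a::nat \<Rightarrow> 'k. (\<lambda>n. smul (a n) (x (Suc n))) sums y)"

definition seminormalized :: "(nat \<Rightarrow> 'a::real_normed_vector) \<Rightarrow> bool" where
  "seminormalized x \<longleftrightarrow> (\<exists>m>0. \<exists>M. \<forall>n\<ge>1. m \<le> norm (x n) \<and> norm (x n) \<le> M)"

definition weakly_null ::
    "('k::real_or_complex \<Rightarrow> 'a::banach \<Rightarrow> 'a) \<Rightarrow> (nat \<Rightarrow> 'a) \<Rightarrow> bool" where
  "weakly_null smul x \<longleftrightarrow> (\<forall>\<phi> \<in> dual_space smul. (\<lambda>n. \<phi> (x n)) \<longlonglongrightarrow> 0)"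

text \<open>The sets \<open>F = {f\<^sub>1 < \<dots> < f\<^sub>n}\<close> and \<open>G = {g\<^sub>1 < \<dots> < g\<^sub>n}\<close> are given by their increasing
  enumerations.\<close>

definition schreier_spreading ::
    "('k::real_or_complex \<Rightarrow> 'a::banach \<Rightarrow> 'a) \<Rightarrow> (nat \<Rightarrow> 'a) \<Rightarrow> bool" where
  "schreier_spreading smul x \<longleftrightarrow> (\<exists>C\<ge>1. \<forall>(n::nat) f g.
     strict_mono_on {1..n} f \<and> f ` {1..n} \<in> schreier1 \<and>
     strict_mono_on {1..n} g \<and> g ` {1..n} \<in> schreier1 \<longrightarrow>
     (\<forall>a. approx C (norm (\<Sum>i\<in>{1..n}. smul (a i) (x (f i))))
                   (norm (\<Sum>i\<in>{1..n}. smul (a i) (x (g i))))))"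

definition SP1w :: "('k::real_or_complex \<Rightarrow> 'a::banach \<Rightarrow> 'a) \<Rightarrow> (nat \<Rightarrow> 'a) set" where
  "SP1w smul = {x. seminormalized x \<and> weakly_null smul x \<and> basic_sequence smul x \<and>
     schreier_spreading smul x}"

text \<open>The relation \<open>\<approx>\<^sub>\<xi>\<close> on \<^const>\<open>SP1w\<close> is obtained with \<^term>\<open>\<F> = schreier L \<xi>\<close>.\<close>

definition equivalent_along ::
    "('k::real_or_complex \<Rightarrow> 'a::banach \<Rightarrow> 'a) \<Rightarrow> nat set set \<Rightarrow> ((nat \<Rightarrow> 'a) \<times> (nat \<Rightarrow> 'a)) set" where
  "equivalent_along smul \<F> = {(x, y). x \<in> SP1w smul \<and> y \<in> SP1w smul \<and>
     (\<exists>K\<ge>1. \<forall>F\<in>\<F>. \<forall>a. approx K (norm (\<Sum>i\<in>F. smul (a i) (x i)))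
                               (norm (\<Sum>i\<in>F. smul (a i) (y i))))}"

definition equivalent_seq ::
    "('k::real_or_complex \<Rightarrow> 'a::banach \<Rightarrow> 'a) \<Rightarrow> ((nat \<Rightarrow> 'a) \<times> (nat \<Rightarrow> 'a)) set" where
  "equivalent_seq smul = {(x, y). x \<in> SP1w smul \<and> y \<in> SP1w smul \<and>
     (\<exists>K\<ge>1. \<forall>a. finite {n. a n \<noteq> 0} \<longrightarrow>
        approx K (norm (\<Sum>n\<in>{n. 1 \<le> n \<and> a n \<noteq> 0}. smul (a n) (x n)))
                 (norm (\<Sum>n\<in>{n. 1 \<le> n \<and> a n \<noteq> 0}. smul (a n) (y n))))}"

lemma approx_refl: "0 \<le> a \<Longrightarrow> approx 1 a a"
  by (simp add: approx_def)

lemma approx_sym: "1 \<le> K \<Longrightarrow> approx K a b \<Longrightarrow> approx K b a"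
  by (auto simp: approx_def field_simps)

lemma approx_trans:
  assumes "1 \<le> K" "1 \<le> K'" "approx K a b" "approx K' b c"
  shows "approx (K * K') a c"
proof -
  have "a \<le> K * b" "b \<le> K * a" "b \<le> K' * c" "c \<le> K' * b"
    using assms by (auto simp: approx_def field_simps)
  then have "a \<le> K * (K' * c)" "c \<le> K' * (K * a)"
    using assms(1,2) by (meson mult_left_mono order_trans zero_le_one)+
  then show ?thesis
    using assms(1,2) by (simp add: approx_def field_simps)
qed

lemma one_le_mult_real: "1 \<le> (K::real) \<Longrightarrow> 1 \<le> K' \<Longrightarrow> 1 \<le> K * K'"
  using mult_mono[of 1 K 1 K'] by simp

lemma equiv_equivalent_along: "equiv (SP1w smul) (equivalent_along smul \<F>)"
proof (rule equivI)
  show "equivalent_along smul \<F> \<subseteq> SP1w smul \<times> SP1w smul"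
    by (auto simp: equivalent_along_def)
  show "refl_on (SP1w smul) (equivalent_along smul \<F>)"
    by (auto simp: equivalent_along_def refl_on_def intro!: exI[of _ "1::real"] approx_refl)
  show "sym (equivalent_along smul \<F>)"
    unfolding equivalent_along_def sym_def by (auto, meson approx_sym)
  show "trans (equivalent_along smul \<F>)"
    unfolding equivalent_along_def trans_def by (auto, meson approx_trans one_le_mult_real)
qed

lemma equiv_equivalent_seq: "equiv (SP1w smul) (equivalent_seq smul)"
proof (rule equivI)
  show "equivalent_seq smul \<subseteq> SP1w smul \<times> SP1w smul"
    by (auto simp: equivalent_seq_def)
  show "refl_on (SP1w smul) (equivalent_seq smul)"
    by (auto simp: equivalent_seq_def refl_on_def intro!: exI[of _ "1::real"] approx_refl)
  show "sym (equivalent_seq smul)"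
    unfolding equivalent_seq_def sym_def by (auto, meson approx_sym)
  show "trans (equivalent_seq smul)"
    unfolding equivalent_seq_def trans_def by (auto, meson approx_trans one_le_mult_real)
qed


section \<open>Strictly singular operators\<close>

text \<open>As \<^term>\<open>T\<close> is linear, its restriction to \<^term>\<open>Y\<close> is an isomorphism onto its image iff it is a
  homeomorphism onto its image.\<close>

definition strictly_singular ::
    "('k::real_or_complex \<Rightarrow> 'a::banach \<Rightarrow> 'a) \<Rightarrow> ('a \<Rightarrow> 'a) set" where
  "strictly_singular smul = {T \<in> bounded_operators smul.
     \<forall>Y. module.subspace smul Y \<and> infinite_dimensional smul Y \<longrightarrow>
       \<not> (\<exists>g. homeomorphism Y (T ` Y) T g)}"

definition family_strictly_singular ::
    "('k::real_or_complex \<Rightarrow> 'a::banach \<Rightarrow> 'a) \<Rightarrow> nat set set \<Rightarrow> ('a \<Rightarrow> 'a) set" where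
  "family_strictly_singular smul \<F> = {T \<in> bounded_operators smul.
     \<forall>\<epsilon>>0. \<forall>x. basic_sequence smul x \<longrightarrow>
       (\<exists>F\<in>\<F>. \<exists>z \<in> closure (module.span smul (x ` F)) - {0}. norm (T z) \<le> \<epsilon> * norm z)}"

end

theory Submission
  imports Defs "HOL-Library.Ramsey" "HOL-Library.Diagonal_Subsequence"
begin

text \<open>
  The key point is that some power of \<open>S\<close> is compact. If \<open>S\<^sup>n\<^sup>+\<^sup>1\<close> is not compact, Rosenthal's
  \<open>\<ell>\<^sub>1\<close>-theorem, applied to the image under \<open>S\<close> of a bounded sequence with separated
  \<open>S\<^sup>n\<^sup>+\<^sup>1\<close>-images, yields a weakly null sequence \<open>(z\<^sub>k)\<close> whose images under
  \<open>S\<^sup>0, \<dots>, S\<^sup>n\<close> are all seminormalized: an \<open>\<ell>\<^sub>1\<close>-subsequence would make \<open>S\<close> bounded below on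
  a basic sequence. Passing to a common subsequence, all \<open>(S\<^sup>i z\<^sub>k)\<^sub>k\<close> lie in \<open>SP\<^sub>1\<^sub>,\<^sub>w\<close>. With
  only \<open>n\<close> classes, two of them are equivalent, so a power of \<open>S\<close>, and hence \<open>S\<close> itself, is bounded
  below along one of them, a contradiction.

  Given a compact power \<open>K\<close> and no hyperinvariant subspace, Lomonosov's argument provides \<open>T\<close> commuting
  with \<open>S\<close> and \<open>x \<noteq> 0\<close> with \<open>T K x = x\<close>. This works over the reals as well: the fixed space of
  \<open>T K\<close> is finite-dimensional and \<open>S\<close>-invariant, and \<open>S\<close> is injective on it, so \<open>p(S) x = 0\<close> for
  some real polynomial \<open>p\<close> with \<open>p(0) \<noteq> 0\<close>. The kernel of \<open>p(S)\<close> is hyperinvariant, hence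
  \<open>p(S) = 0\<close>, so \<open>S\<close> has a bounded left inverse, and compactness of \<open>K\<close> makes the space
  finite-dimensional.
\<close>

section \<open>Galvin's lemma\<close>

text \<open>Both parts are one theorem about an arbitrary family of finite index sets: part (i)
  takes the Schreier family, part (ii) all finite subsets of \<open>{1..}\<close>. Strict
  singularity is therefore always contradicted by one estimate for all combinations supported in
  members of the family. Rosenthal's theorem is applied to \<open>S x_k\<close> rather than
  \<open>x_k\<close>, because an l1-subsequence of \<open>(x_k)\<close> alone contradicts nothing;
  this is what costs one power of \<open>S\<close>. Lomonosov's argument usually rests on Schauder's
  fixed point theorem. Here Brouwer's theorem in the space of coefficients gives approximate fixed
  points for combinations of finitely many operators that do not depend on the accuracy. Only
  scalars and the points \<open>K x\<close> vary with it, and compactness of both yields the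
  operator \<open>T\<close> in the limit. Galvin's lemma is the combinatorics behind Rosenthal's
  theorem, Ramsey's theorem that behind Schreier spreading.\<close>

lemma infinite_tail: "infinite M \<Longrightarrow> infinite (M \<inter> {k<..})" for M :: "nat set"
proof -
  assume "infinite M"
  moreover have "M \<subseteq> (M \<inter> {k<..}) \<union> {..k}" by auto
  ultimately show ?thesis by (meson finite_Un finite_atMost finite_subset)
qed

text \<open>Diagonal intersection. A decreasing chain of reservoirs is built, and each new one
  settles \<open>Q\<close> for the finitely many \<open>s\<close> below the element just chosen. The
  resulting set lies only eventually inside each reservoir; \<open>tail\<close> makes this
  sufficient, since it lets \<open>Q\<close> ignore elements that do not exceed all of
  \<open>s\<close>.\<close>

lemma fusion:
  fixes Q :: "nat set \<Rightarrow> nat set \<Rightarrow> bool"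
  assumes ex: "\<And>s M. finite s \<Longrightarrow> infinite M \<Longrightarrow> \<exists>N\<subseteq>M. infinite N \<and> Q s N"
    and her: "\<And>s M N. Q s M \<Longrightarrow> N \<subseteq> M \<Longrightarrow> infinite N \<Longrightarrow> Q s N"
    and tail: "\<And>s M. Q s {m\<in>M. \<forall>a\<in>s. a < m} \<Longrightarrow> Q s M"
    and M0: "infinite M0"
  obtains M where "M \<subseteq> M0" "infinite M" "\<And>s. finite s \<Longrightarrow> s \<subseteq> M \<Longrightarrow> Q s M"
proof -
  obtain M1 where M1: "M1 \<subseteq> M0" "infinite M1" "Q {} M1"
    using ex[OF _ M0, of "{}"] by auto
  have ex_fam: "\<exists>N\<subseteq>M. infinite N \<and> (\<forall>s\<in>A. Q s N)"
    if "finite A" "\<forall>s\<in>A. finite s" "infinite M" for A M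
    using that
  proof (induction A arbitrary: M)
    case (insert s A)
    then obtain N where N: "N \<subseteq> M" "infinite N" "\<forall>s\<in>A. Q s N" by (metis insertI2)
    obtain N' where "N' \<subseteq> N" "infinite N'" "Q s N'" using ex[of s N] insert.prems N by auto
    with N her[of _ N N'] show ?case by (intro exI[of _ N']) auto
  next
    case empty
    then show ?case by (intro exI[of _ M]) simp
  qed
  \<comment> \<open>A state is the element \<open>m\<close> just chosen together with the reservoir
    \<open>N\<close> from which all later elements come.\<close>
  define ok where "ok n p \<longleftrightarrow> (case p of (m, N) \<Rightarrow> infinite N \<and> N \<subseteq> M1 \<and> (\<forall>x\<in>N. m < x) \<and> m \<in> M1 \<and>
      (\<forall>s\<in>Pow {..m}. Q s N))" for n :: nat and p :: "nat \<times> nat set"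
  obtain f where f: "\<And>n. ok n (f n)" "\<And>n. fst (f (Suc n)) \<in> snd (f n) \<and> snd (f (Suc n)) \<subseteq> snd (f n)"
  proof -
    have step: "\<exists>m N'. m \<in> N \<and> N' \<subseteq> N \<and> ok n (m, N')" if N: "infinite N" "N \<subseteq> M1" for N n
    proof -
      obtain m where m: "m \<in> N" using infinite_imp_nonempty[OF N(1)] by auto
      have fin: "finite (Pow {..m})" "\<forall>s\<in>Pow {..m}. finite s"
        by (auto intro: finite_subset[OF _ finite_atMost[of m]])
      obtain N' where N': "N' \<subseteq> N \<inter> {m<..}" "infinite N'" "\<forall>s\<in>Pow {..m}. Q s N'"
        using ex_fam[OF fin infinite_tail[OF N(1), of m]] by blast
      have "ok n (m, N')" using m N' N(2) unfolding ok_def prod.case by blast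
      then show ?thesis using m N' by blast
    qed
    have "\<exists>p. ok 0 p" using step[OF M1(2) subset_refl] by blast
    moreover have "\<exists>q. ok (Suc n) q \<and> (fst q \<in> snd p \<and> snd q \<subseteq> snd p)" if "ok n p" for n p
    proof -
      have "infinite (snd p)" "snd p \<subseteq> M1" using that unfolding ok_def by auto
      from step[OF this, of "Suc n"] obtain m N' where "m \<in> snd p" "N' \<subseteq> snd p" "ok (Suc n) (m, N')" by blast
      then show ?thesis by (intro exI[of _ "(m, N')"]) simp
    qed
    ultimately show ?thesis using that dependent_nat_choice[of ok "\<lambda>n p q. fst q \<in> snd p \<and> snd q \<subseteq> snd p"]
      by blast
  qed
  define m where "m n = fst (f n)" for n
  have snd_anti: "snd (f k) \<subseteq> snd (f n)" if "n \<le> k" for n k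
    using that by (induction rule: dec_induct) (use f(2) in blast)+
  have m_in: "m k \<in> snd (f n)" if nk: "n < k" for n k
  proof -
    obtain j where "k = Suc j" using nk by (cases k) auto
    then show ?thesis using nk f(2)[of j] snd_anti[of n j] unfolding m_def by auto
  qed
  have m_less: "m n < m k" if "n < k" for n k
    using m_in[OF that] f(1)[of n] unfolding ok_def m_def by (auto simp: case_prod_unfold)
  have inj: "inj m" by (metis (mono_tags) injI m_less less_irrefl nat_neq_iff)
  have "range m \<subseteq> M1" using f(1) unfolding ok_def m_def by (auto simp: case_prod_unfold)
  moreover have "infinite (range m)" using inj range_inj_infinite by blast
  moreover have "Q s (range m)" if s: "finite s" "s \<subseteq> range m" for s
  proof (cases "s = {}")
    case True
    with M1(3) her \<open>range m \<subseteq> M1\<close> \<open>infinite (range m)\<close> show ?thesis by blast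
  next
    case False
    then obtain n where "Max s = m n" using Max_in[OF s(1)] s(2) by blast
    then have n: "s \<subseteq> {..m n}" "m n \<in> s" using s(1) Max_ge Max_in[OF s(1) False] by fastforce+
    have n': "k > n" if "\<forall>a\<in>s. a < m k" for k
    proof -
      have "m n < m k" using that \<open>m n \<in> s\<close> by blast
      then show ?thesis using m_less by (metis not_less_iff_gr_or_eq)
    qed
    have Q: "Q s (snd (f n))" using f(1)[of n] n(1) unfolding ok_def m_def by (auto simp: case_prod_unfold)
    have "infinite {x\<in>range m. \<forall>a\<in>s. a < x}"
    proof
      assume "finite {x\<in>range m. \<forall>a\<in>s. a < x}"
      moreover have "range m \<inter> {m n<..} \<subseteq> {x\<in>range m. \<forall>a\<in>s. a < x}" using n(1) by fastforce
      ultimately show False using infinite_tail[OF \<open>infinite (range m)\<close>] finite_subset by blast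
    qed
    moreover have "{x\<in>range m. \<forall>a\<in>s. a < x} \<subseteq> snd (f n)"
      using n' m_in by auto
    ultimately show ?thesis using her[OF Q] tail by blast
  qed
  ultimately show ?thesis using that M1(1) by blast
qed

text \<open>Accept-reject method: \<open>M\<close> accepts \<open>s\<close> if every continuation of
  \<open>s\<close> inside \<open>M\<close> has an initial segment in \<open>P\<close>, and rejects
  \<open>s\<close> if no infinite subset of \<open>M\<close> accepts it. A first fusion yields a set
  \<open>M1\<close> deciding all its finite subsets. If \<open>M1\<close> rejects the empty set, a
  second fusion keeps rejection under adding a larger element. No finite subset of the result
  satisfies \<open>P\<close>, since sets satisfying \<open>P\<close> are accepted.\<close>

lemma galvin:
  fixes P :: "nat set \<Rightarrow> bool"
  obtains M where "infinite M" "\<And>s. finite s \<Longrightarrow> s \<subseteq> M \<Longrightarrow> \<not> P s"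
  | M where "infinite M" "\<And>N. N \<subseteq> M \<Longrightarrow> infinite N \<Longrightarrow> \<exists>k. P (N \<inter> {..<k})"
proof -
  define acc where "acc M s \<longleftrightarrow>
    (\<forall>N\<subseteq>M. infinite N \<longrightarrow> (\<forall>a\<in>s. \<forall>b\<in>N. a < b) \<longrightarrow> (\<exists>k. P ((s \<union> N) \<inter> {..<k})))" for M s
  define rej where "rej M s \<longleftrightarrow> (\<forall>N\<subseteq>M. infinite N \<longrightarrow> \<not> acc N s)" for M s
  have acc_mono: "acc N s" if "acc M s" "N \<subseteq> M" for M N s
    using that unfolding acc_def by blast
  have rej_mono: "rej N s" if "rej M s" "N \<subseteq> M" for M N s
    using that unfolding rej_def by blast
  have acc_tail: "acc M s" if "acc {m\<in>M. \<forall>a\<in>s. a < m} s" for M s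
    unfolding acc_def
  proof (intro allI impI)
    fix N assume N: "N \<subseteq> M" "infinite N" "\<forall>a\<in>s. \<forall>b\<in>N. a < b"
    then have "N \<subseteq> {m\<in>M. \<forall>a\<in>s. a < m}" by blast
    then show "\<exists>k. P ((s \<union> N) \<inter> {..<k})" using that N unfolding acc_def by metis
  qed
  have tail_inf: "infinite {m\<in>N. \<forall>a\<in>s. a < m}" if "finite s" "infinite N" for s N :: "nat set"
  proof -
    have "N \<inter> {Max (insert 0 s)<..} \<subseteq> {m\<in>N. \<forall>a\<in>s. a < m}"
      using that(1) by auto
    then show ?thesis using infinite_tail[OF that(2)] finite_subset by blast
  qed
  have rej_tail: "rej M s" if "rej {m\<in>M. \<forall>a\<in>s. a < m} s" "finite s" for M s
    unfolding rej_def
  proof (intro allI impI notI)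
    fix N assume N: "N \<subseteq> M" "infinite N" "acc N s"
    let ?N = "{m\<in>N. \<forall>a\<in>s. a < m}"
    have "acc ?N s" by (rule acc_mono[OF N(3)]) auto
    moreover have "?N \<subseteq> {m\<in>M. \<forall>a\<in>s. a < m}" using N(1) by auto
    ultimately show False
      using that(1)[unfolded rej_def, rule_format, of ?N] tail_inf[OF that(2) N(2)] by simp
  qed
  obtain M1 where M1: "infinite M1" "\<And>s. finite s \<Longrightarrow> s \<subseteq> M1 \<Longrightarrow> acc M1 s \<or> rej M1 s"
  proof (rule fusion[of "\<lambda>s M. finite s \<longrightarrow> acc M s \<or> rej M s" UNIV])
    fix s M :: "nat set" assume "finite s" "infinite M"
    then show "\<exists>N\<subseteq>M. infinite N \<and> (finite s \<longrightarrow> acc N s \<or> rej N s)"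
      unfolding rej_def by blast
  next
    fix s M N :: "nat set" assume "finite s \<longrightarrow> acc M s \<or> rej M s" "N \<subseteq> M"
    then show "finite s \<longrightarrow> acc N s \<or> rej N s" using acc_mono rej_mono by blast
  next
    fix s M :: "nat set"
    assume "finite s \<longrightarrow> acc {m\<in>M. \<forall>a\<in>s. a < m} s \<or> rej {m\<in>M. \<forall>a\<in>s. a < m} s"
    then show "finite s \<longrightarrow> acc M s \<or> rej M s" using acc_tail rej_tail by blast
  qed (use that in auto)
  show ?thesis
  proof (cases "acc M1 {}")
    case True
    then show ?thesis using that(2)[OF M1(1)] unfolding acc_def by auto
  next
    case False
    then have rej0: "rej M1 {}" using M1(2)[of "{}"] by blast
    have step: "\<exists>N\<subseteq>M. infinite N \<and> (\<forall>n\<in>N. (\<forall>a\<in>s. a < n) \<longrightarrow> rej M1 (insert n s))"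
      if s: "finite s" "rej M1 s" "s \<subseteq> M1" and M: "infinite M" "M \<subseteq> M1" for s M
    proof -
      \<comment> \<open>Infinitely many accepted one-point extensions would make \<open>B\<close>
        accept \<open>s\<close> itself: a continuation of \<open>s\<close> inside \<open>B\<close>
        continues \<open>s\<close> extended by its least element.\<close>
      define B where "B = {n\<in>M. (\<forall>a\<in>s. a < n) \<and> acc M1 (insert n s)}"
      have "finite B"
      proof (rule ccontr)
        assume inf: "infinite B"
        have "acc B s"
          unfolding acc_def
        proof (intro allI impI)
          fix N assume N: "N \<subseteq> B" "infinite N" "\<forall>a\<in>s. \<forall>b\<in>N. a < b"
          obtain n where n: "n \<in> N" "\<And>k. k \<in> N \<Longrightarrow> n \<le> k"
            using N(2) by (metis Inf_nat_def1 finite.emptyI wellorder_Inf_le1)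
          have "acc M1 (insert n s)" using n(1) N(1) unfolding B_def by blast
          moreover have "N - {n} \<subseteq> M1" "infinite (N - {n})" using N M unfolding B_def by auto
          moreover have "\<forall>a\<in>insert n s. \<forall>b\<in>N - {n}. a < b"
            using N(3) n(2) by (auto simp: order.strict_iff_order)
          ultimately obtain k where "P ((insert n s \<union> (N - {n})) \<inter> {..<k})"
            unfolding acc_def by blast
          moreover have "insert n s \<union> (N - {n}) = s \<union> N" using n(1) by blast
          ultimately show "\<exists>k. P ((s \<union> N) \<inter> {..<k})" by auto
        qed
        moreover have "B \<subseteq> M1" using M(2) unfolding B_def by blast
        ultimately show False using s(2) inf unfolding rej_def by blast
      qed
      then have "infinite (M - B)" using M(1) by auto
      moreover have "\<forall>n\<in>M - B. (\<forall>a\<in>s. a < n) \<longrightarrow> rej M1 (insert n s)"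
      proof (intro ballI impI)
        fix n assume n: "n \<in> M - B" "\<forall>a\<in>s. a < n"
        then have "\<not> acc M1 (insert n s)" unfolding B_def by simp
        moreover have "insert n s \<subseteq> M1" using n(1) M(2) s(3) by auto
        ultimately show "rej M1 (insert n s)" using M1(2)[of "insert n s"] s(1) by simp
      qed
      ultimately show ?thesis by blast
    qed
    \<comment> \<open>The quantifier runs over \<open>M \<inter> M1\<close> because
      \<open>fusion\<close> asks for a solution inside every infinite \<open>M\<close>. If
      \<open>M\<close> meets \<open>M1\<close> in a finite set, \<open>M - M1\<close> is a vacuous
      solution.\<close>
    let ?Q = "\<lambda>s M. s \<subseteq> M1 \<and> rej M1 s \<longrightarrow>
      (\<forall>n\<in>M \<inter> M1. (\<forall>a\<in>s. a < n) \<longrightarrow> rej M1 (insert n s))"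
    obtain M where M: "M \<subseteq> M1" "infinite M" "\<And>s. finite s \<Longrightarrow> s \<subseteq> M \<Longrightarrow> ?Q s M"
    proof (rule fusion[of ?Q M1])
      fix s M :: "nat set" assume *: "finite s" "infinite M"
      show "\<exists>N\<subseteq>M. infinite N \<and> ?Q s N"
      proof (cases "s \<subseteq> M1 \<and> rej M1 s \<and> infinite (M \<inter> M1)")
        case True
        then show ?thesis using step[OF *(1), of "M \<inter> M1"] by blast
      next
        case False
        show ?thesis
        proof (cases "infinite (M \<inter> M1)")
          case False
          then have "infinite (M - M1)" using *(2) by (metis finite_Un Int_Diff_Un)
          then show ?thesis by blast
        qed (use False *(2) in blast)
      qed
    qed (use M1(1) that in blast)+
    have rej: "rej M1 s" if "finite s" "s \<subseteq> M" for s
      using that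
    proof (induction s rule: finite_linorder_max_induct)
      case (insert b A)
      then show ?case using M(1) M(3)[of A] by blast
    qed (rule rej0)
    have "\<not> P s" if s: "finite s" "s \<subseteq> M" for s
    proof
      assume "P s"
      have "acc M1 s"
        unfolding acc_def
      proof (intro allI impI)
        fix N assume N: "N \<subseteq> M1" "infinite N" "\<forall>a\<in>s. \<forall>b\<in>N. a < b"
        obtain n where "n \<in> N" "\<And>k. k \<in> N \<Longrightarrow> n \<le> k"
          using N(2) by (metis Inf_nat_def1 finite.emptyI wellorder_Inf_le1)
        then have n: "n \<in> N" "\<And>k. k \<in> N \<Longrightarrow> \<not> k < n" by (auto simp: not_less)
        \<comment> \<open>Cutting a continuation at its first new element leaves exactly
          \<open>s\<close>, so \<open>P s\<close> makes every continuation succeed.\<close>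
        have "(s \<union> N) \<inter> {..<n} = s"
        proof (intro equalityI subsetI)
          show "x \<in> s" if "x \<in> (s \<union> N) \<inter> {..<n}" for x using that n(2)[of x] by auto
          show "x \<in> (s \<union> N) \<inter> {..<n}" if "x \<in> s" for x using that N(3) n(1) by auto
        qed
        then show "\<exists>k. P ((s \<union> N) \<inter> {..<k})" using \<open>P s\<close> by metis
      qed
      then show False using rej[OF s] M1(1) unfolding rej_def by blast
    qed
    then show ?thesis using that(1) M(2) by blast
  qed
qed

section \<open>Brouwer's theorem on cubes of arbitrary dimension\<close>

text \<open>The dimension arises inside a proof as a number and cannot be a type, so the cube is
  placed in the space of all sequences. Pinning the remaining coordinates to 0 makes it compact in
  the product topology.\<close>

definition cube :: "nat \<Rightarrow> (nat \<Rightarrow> real) set" where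
  "cube n = {l. (\<forall>i<n. 0 \<le> l i \<and> l i \<le> 1) \<and> (\<forall>i\<ge>n. l i = 0)}"

lemma compact_cube: "compact (cube n)"
proof -
  have "cube n = PiE UNIV (\<lambda>i. if i < n then {0..1} else {0})"
  proof -
    have "l \<in> cube n \<longleftrightarrow> (\<forall>i. l i \<in> (if i < n then {0..1} else {0}))" for l
    proof
      assume "l \<in> cube n"
      then show "\<forall>i. l i \<in> (if i < n then {0..1} else {0})" by (simp add: cube_def not_less)
    next
      assume l: "\<forall>i. l i \<in> (if i < n then {0..1} else {0})"
      show "l \<in> cube n" unfolding cube_def
      proof (intro CollectI conjI allI impI)
        fix i show "0 \<le> l i" "l i \<le> 1" if "i < n" using l[rule_format, of i] that by simp_all
        show "l i = 0" if "n \<le> i" using l[rule_format, of i] that by simp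
      qed
    qed
    then show ?thesis by (simp add: set_eq_iff PiE_UNIV_domain Pi_iff)
  qed
  moreover have "compactin (product_topology (\<lambda>_. euclideanreal) UNIV) (PiE UNIV (\<lambda>i. if i < n then {0..1} else {0::real}))"
    by (subst compactin_PiE) auto
  ultimately show ?thesis by (simp add: euclidean_product_topology)
qed

lemma tendsto_coordinate:
  fixes X :: "nat \<Rightarrow> nat \<Rightarrow> real"
  assumes "X \<longlonglongrightarrow> l" shows "(\<lambda>n. X n i) \<longlonglongrightarrow> l i"
  using continuous_on_tendsto_compose[of UNIV "\<lambda>x. x i" X l] assms by auto

lemma tendsto_coordinatewise:
  fixes X :: "nat \<Rightarrow> nat \<Rightarrow> real"
  assumes "\<And>i. (\<lambda>n. X n i) \<longlonglongrightarrow> l i" shows "X \<longlonglongrightarrow> l"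
proof -
  have "limitin (product_topology (\<lambda>_. euclideanreal) UNIV) X l sequentially"
    unfolding limitin_componentwise using assms by auto
  then show ?thesis by (simp add: euclidean_product_topology)
qed

text \<open>Kuhn's lemma on grids of mesh \<open>1 / (p + 1)\<close> finds a cell that has, for each
  direction \<open>i\<close>, one corner where \<open>g\<close> does not lower coordinate
  \<open>i\<close> and one where \<open>g\<close> does not raise it. Along a subsequence all corners
  converge to a single point, where both inequalities hold in the limit.\<close>

lemma brouwer_cube_nat:
  assumes cont: "continuous_on (cube n) g" and into: "g ` cube n \<subseteq> cube n"
  obtains l where "l \<in> cube n" "g l = l"
proof -
  define pt where "pt p q = (\<lambda>i. if i < n then real (q i) / real (Suc p) else 0)" for p :: nat and q :: "nat \<Rightarrow> nat"
  have pt_cube: "pt p q \<in> cube n" if "\<forall>i<n. q i \<le> Suc p" for p q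
    using that unfolding pt_def cube_def by (auto simp: divide_le_eq)
  have g01: "0 \<le> g l i \<and> g l i \<le> 1" if "l \<in> cube n" "i < n" for l i
    using into that unfolding cube_def by blast
  define good where "good p q i \<longleftrightarrow> (\<exists>r s. (\<forall>j<n. q j \<le> r j \<and> r j \<le> q j + 1) \<and>
      (\<forall>j<n. q j \<le> s j \<and> s j \<le> q j + 1) \<and> pt p r i \<le> g (pt p r) i \<and> g (pt p s) i \<le> pt p s i)" for p q i
  have "\<exists>q. (\<forall>i<n. q i < Suc p) \<and> (\<forall>i<n. \<exists>r s. (\<forall>j<n. q j \<le> r j \<and> r j \<le> q j + 1) \<and>
      (\<forall>j<n. q j \<le> s j \<and> s j \<le> q j + 1) \<and> pt p r i \<le> g (pt p r) i \<and> g (pt p s) i \<le> pt p s i)" for p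
  proof -
    \<comment> \<open>Label 0 records that \<open>g\<close> does not lower coordinate
      \<open>i\<close>. The upper face is forced to label 1, as Kuhn's lemma demands; there the
      coordinate is already 1, so label 1 still means that \<open>g\<close> does not raise
      it.\<close>
    define label :: "(nat \<Rightarrow> nat) \<Rightarrow> nat \<Rightarrow> nat" where
      "label x i = (if x i \<noteq> Suc p \<and> pt p x i \<le> g (pt p x) i then 0 else 1)" for x i
    have L0: "\<forall>x. (\<forall>i<n. x i \<le> Suc p) \<longrightarrow> (\<forall>i<n. x i = 0 \<longrightarrow> label x i = 0)"
      using g01 pt_cube unfolding label_def by (auto simp: pt_def)
    have L1: "\<forall>x. (\<forall>i<n. x i \<le> Suc p) \<longrightarrow> (\<forall>i<n. label x i = 0 \<or> label x i = 1)"
      "\<forall>x. (\<forall>i<n. x i \<le> Suc p) \<longrightarrow> (\<forall>i<n. x i = Suc p \<longrightarrow> label x i = 1)"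
      by (simp_all add: label_def)
    obtain q where q: "\<forall>i<n. q i < Suc p"
      "\<forall>i<n. \<exists>r s. (\<forall>j<n. q j \<le> r j \<and> r j \<le> q j + 1) \<and> (\<forall>j<n. q j \<le> s j \<and> s j \<le> q j + 1) \<and> label r i \<noteq> label s i"
      using kuhn_lemma[of "Suc p" n label] L0 L1 by blast
    have "\<exists>r s. (\<forall>j<n. q j \<le> r j \<and> r j \<le> q j + 1) \<and>
      (\<forall>j<n. q j \<le> s j \<and> s j \<le> q j + 1) \<and> pt p r i \<le> g (pt p r) i \<and> g (pt p s) i \<le> pt p s i" if i: "i < n" for i
    proof -
      obtain r s where rs: "\<forall>j<n. q j \<le> r j \<and> r j \<le> q j + 1" "\<forall>j<n. q j \<le> s j \<and> s j \<le> q j + 1" "label r i \<noteq> label s i"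
        using q(2) i by blast
      have lab1: "g (pt p x) i \<le> pt p x i" if x: "label x i \<noteq> 0" "\<forall>j<n. q j \<le> x j \<and> x j \<le> q j + 1" for x
      proof (cases "x i = Suc p")
        case True
        have "pt p x \<in> cube n" using x(2) q(1) by (intro pt_cube) fastforce
        then show ?thesis using True g01[of "pt p x" i] i by (simp add: pt_def)
      qed (use x in \<open>auto simp: label_def split: if_splits\<close>)
      show ?thesis
      proof (cases "label r i = 0")
        case True
        then have "pt p r i \<le> g (pt p r) i" by (auto simp: label_def split: if_splits)
        moreover have "g (pt p s) i \<le> pt p s i" using lab1 True rs by metis
        ultimately show ?thesis using rs by blast
      next
        case False
        then have "label s i = 0" using rs(3) by (auto simp: label_def split: if_splits)
        then have "pt p s i \<le> g (pt p s) i" by (auto simp: label_def split: if_splits)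
        moreover have "g (pt p r) i \<le> pt p r i" using lab1 False rs by metis
        ultimately show ?thesis using rs by blast
      qed
    qed
    then show ?thesis using q(1) by blast
  qed
  then have "\<forall>p. \<exists>q. (\<forall>i<n. q i < Suc p) \<and> (\<forall>i<n. good p q i)"
    unfolding good_def by blast
  from choice[OF this] obtain q where "\<forall>p. (\<forall>i<n. q p i < Suc p) \<and> (\<forall>i<n. good p (q p) i)" ..
  then have q: "\<And>p i. i < n \<Longrightarrow> q p i < Suc p" "\<And>p i. i < n \<Longrightarrow> good p (q p) i"
    by simp_all
  define R where "R p i r \<longleftrightarrow> (\<forall>j<n. q p j \<le> r j \<and> r j \<le> q p j + 1) \<and> pt p r i \<le> g (pt p r) i" for p i r
  define S where "S p i s \<longleftrightarrow> (\<forall>j<n. q p j \<le> s j \<and> s j \<le> q p j + 1) \<and> g (pt p s) i \<le> pt p s i" for p i s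
  define r where "r p i = (SOME r. R p i r)" for p i
  define s where "s p i = (SOME s. S p i s)" for p i
  have ex: "(\<exists>r. R p i r) \<and> (\<exists>s. S p i s)" if "i < n" for p i
    using q(2)[OF that, of p] unfolding good_def R_def S_def by blast
  have r: "(\<forall>j<n. q p j \<le> r p i j \<and> r p i j \<le> q p j + 1) \<and> pt p (r p i) i \<le> g (pt p (r p i)) i" if "i < n" for p i
  proof -
    have "R p i (r p i)" using ex[OF that, of p] unfolding r_def by (intro someI_ex[of "R p i"]) blast
    then show ?thesis unfolding R_def .
  qed
  have s: "(\<forall>j<n. q p j \<le> s p i j \<and> s p i j \<le> q p j + 1) \<and> g (pt p (s p i)) i \<le> pt p (s p i) i" if "i < n" for p i
  proof -
    have "S p i (s p i)" using ex[OF that, of p] unfolding s_def by (intro someI_ex[of "S p i"]) blast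
    then show ?thesis unfolding S_def .
  qed
  have "\<forall>p. pt p (q p) \<in> cube n" using q(1) by (intro allI pt_cube) (auto intro: less_imp_le)
  then have "\<exists>l\<in>cube n. \<exists>\<sigma>. strict_mono \<sigma> \<and> ((\<lambda>p. pt p (q p)) \<circ> \<sigma>) \<longlonglongrightarrow> l"
    using compact_cube[of n] unfolding compact_def by simp
  then obtain l \<sigma> where l: "l \<in> cube n" "strict_mono \<sigma>" "(\<lambda>k. pt (\<sigma> k) (q (\<sigma> k))) \<longlonglongrightarrow> l"
    unfolding comp_def by blast
  \<comment> \<open>A corner differs from the lower corner \<open>q\<close> by at most the mesh in
    each coordinate, so every choice of corners inherits the limit.\<close>
  have near: "(\<lambda>k. pt (\<sigma> k) (t (\<sigma> k))) \<longlonglongrightarrow> l"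
    if t: "\<And>p j. j < n \<Longrightarrow> q p j \<le> t p j \<and> t p j \<le> q p j + 1" for t
  proof (rule tendsto_coordinatewise)
    fix j
    have c: "(\<lambda>k. pt (\<sigma> k) (q (\<sigma> k)) j) \<longlonglongrightarrow> l j" using l(3) by (rule tendsto_coordinate)
    have "(\<lambda>k. 1 / real (Suc (\<sigma> k))) \<longlonglongrightarrow> 0"
      using LIMSEQ_subseq_LIMSEQ[OF LIMSEQ_Suc[OF lim_const_over_n[of "1::real"]] l(2)] by (simp add: o_def)
    from tendsto_add[OF c this]
    have c': "(\<lambda>k. pt (\<sigma> k) (q (\<sigma> k)) j + 1 / real (Suc (\<sigma> k))) \<longlonglongrightarrow> l j" by simp
    show "(\<lambda>k. pt (\<sigma> k) (t (\<sigma> k)) j) \<longlonglongrightarrow> l j"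
    proof (rule tendsto_sandwich[OF _ _ c c'])
      show "\<forall>\<^sub>F k in sequentially. pt (\<sigma> k) (q (\<sigma> k)) j \<le> pt (\<sigma> k) (t (\<sigma> k)) j"
        using t by (intro always_eventually allI) (auto simp: pt_def divide_right_mono)
      have "pt p (t p) j \<le> pt p (q p) j + 1 / real (Suc p)" for p
      proof (cases "j < n")
        case True
        then have "real (t p j) \<le> real (q p j) + 1" using t[of j p] by linarith
        then have "real (t p j) / real (Suc p) \<le> (real (q p j) + 1) / real (Suc p)" by (intro divide_right_mono) auto
        then show ?thesis using True by (simp add: pt_def add_divide_distrib)
      qed (simp add: pt_def)
      then show "\<forall>\<^sub>F k in sequentially. pt (\<sigma> k) (t (\<sigma> k)) j \<le> pt (\<sigma> k) (q (\<sigma> k)) j + 1 / real (Suc (\<sigma> k))"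
        by (intro always_eventually allI)
    qed
  qed
  have lim_g: "(\<lambda>k. g (pt (\<sigma> k) (t (\<sigma> k))) i) \<longlonglongrightarrow> g l i"
    if t: "\<And>p j. j < n \<Longrightarrow> q p j \<le> t p j \<and> t p j \<le> q p j + 1" for t i
  proof -
    have "pt p (t p) \<in> cube n" for p
    proof (intro pt_cube allI impI)
      fix j assume "j < n" then show "t p j \<le> Suc p" using t[of j p] q(1)[of j p] by linarith
    qed
    then have "(\<lambda>k. g (pt (\<sigma> k) (t (\<sigma> k)))) \<longlonglongrightarrow> g l"
      by (intro continuous_on_tendsto_compose[OF cont near[OF t] l(1)] always_eventually allI)
    then show ?thesis by (rule tendsto_coordinate)
  qed
  have "g l i = l i" for i
  proof (cases "i < n")
    case True
    have r': "\<And>p j. j < n \<Longrightarrow> q p j \<le> r p i j \<and> r p i j \<le> q p j + 1"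
      and s': "\<And>p j. j < n \<Longrightarrow> q p j \<le> s p i j \<and> s p i j \<le> q p j + 1" using r[OF True] s[OF True] by auto
    have "l i \<le> g l i"
      using tendsto_coordinate[OF near[OF r'], of i] lim_g[OF r', of i] r[OF True] by (intro LIMSEQ_le[of _ "l i" _ "g l i"]) auto
    moreover have "g l i \<le> l i"
      using tendsto_coordinate[OF near[OF s'], of i] lim_g[OF s', of i] s[OF True] by (intro LIMSEQ_le[of _ "g l i" _ "l i"]) auto
    ultimately show ?thesis by simp
  next
    case False
    have "g l \<in> cube n" using into l(1) by blast
    then show ?thesis using False l(1) by (simp add: cube_def)
  qed
  then show ?thesis using that l(1) by blast
qed

section \<open>Norming functionals and finite-dimensional subspaces\<close>

text \<open>Zorn's lemma is applied to the graphs of partially defined functionals: subspaces of the product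
  space lying below the graph of the norm. Such a subspace is automatically single-valued.\<close>

lemma norming_functional:
  fixes y :: "'a::real_normed_vector"
  obtains u :: "'a \<Rightarrow> real" where "bounded_linear u" "\<And>x. \<bar>u x\<bar> \<le> norm x" "u y = norm y"
proof -
  define \<A> where "\<A> = {G :: ('a \<times> real) set. subspace G \<and> (\<forall>(x, r)\<in>G. r \<le> norm x) \<and> (y, norm y) \<in> G}"
  have "span {(y, norm y)} \<in> \<A>"
  proof -
    have "r \<le> norm x" if "(x, r) \<in> span {(y, norm y)}" for x r
    proof -
      from that obtain k where "x = k *\<^sub>R y" "r = k * norm y" by (auto simp: span_singleton)
      then show ?thesis by (simp add: mult_right_mono)
    qed
    then show ?thesis unfolding \<A>_def by (auto intro: span_base subspace_span)
  qed
  then have "\<A> \<noteq> {}" by blast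
  moreover have "\<Union>\<C> \<in> \<A>" if C: "\<C> \<noteq> {}" "subset.chain \<A> \<C>" for \<C>
  proof -
    have mem: "G \<in> \<A>" if "G \<in> \<C>" for G using C(2) that unfolding subset.chain_def by blast
    have "subspace (\<Union>\<C>)"
    proof (rule subspaceI)
      show "0 \<in> \<Union>\<C>" using C(1) mem subspace_0 unfolding \<A>_def by blast
      show "c *\<^sub>R p \<in> \<Union>\<C>" if "p \<in> \<Union>\<C>" for c p
        using that mem subspace_scale unfolding \<A>_def by blast
      fix p q assume "p \<in> \<Union>\<C>" "q \<in> \<Union>\<C>"
      then obtain G H where GH: "G \<in> \<C>" "H \<in> \<C>" "p \<in> G" "q \<in> H" by blast
      then have "G \<subseteq> H \<or> H \<subseteq> G" using C(2) unfolding subset_chain_def by blast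
      then obtain I where "I \<in> \<C>" "p \<in> I" "q \<in> I" using GH by blast
      then show "p + q \<in> \<Union>\<C>" using mem subspace_add unfolding \<A>_def by blast
    qed
    then show ?thesis using C(1) mem unfolding \<A>_def by blast
  qed
  ultimately obtain G where G: "G \<in> \<A>" "\<And>H. H \<in> \<A> \<Longrightarrow> G \<subseteq> H \<Longrightarrow> H = G"
    using subset_Zorn_nonempty[of \<A>] by blast
  have sub: "subspace G" and dom: "\<And>x r. (x, r) \<in> G \<Longrightarrow> r \<le> norm x" and yG: "(y, norm y) \<in> G"
    using G(1) unfolding \<A>_def by auto
  have total: "\<exists>r. (x, r) \<in> G" for x
  proof (rule ccontr)
    assume no: "\<nexists>r. (x, r) \<in> G"
    \<comment> \<open>The Hahn-Banach value at \<open>x\<close>. By \<open>le\<close> below, each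
      \<open>r - norm (d - x)\<close> lies under each \<open>norm (d' + x) - r'\<close>, and the
      supremum of the former separates the two.\<close>
    define \<alpha> where "\<alpha> = Sup {r - norm (d - x) | d r. (d, r) \<in> G}"
    have le: "r - norm (d - x) \<le> norm (d' + x) - r'" if "(d, r) \<in> G" "(d', r') \<in> G" for d r d' r'
    proof -
      have "(d + d', r + r') \<in> G" using subspace_add[OF sub that] by simp
      then have "r + r' \<le> norm (d + d')" by (rule dom)
      also have "\<dots> \<le> norm (d - x) + norm (d' + x)"
        using norm_triangle_ineq[of "d - x" "d' + x"] by (simp add: algebra_simps)
      finally show ?thesis by simp
    qed
    have "bdd_above {r - norm (d - x) | d r. (d, r) \<in> G}"
      using le[OF _ yG] by (intro bdd_aboveI[of _ "norm (y + x) - norm y"]) auto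
    then have lower: "r - norm (d - x) \<le> \<alpha>" if "(d, r) \<in> G" for d r
      unfolding \<alpha>_def using that by (intro cSup_upper) auto
    have upper: "\<alpha> \<le> norm (d + x) - r" if "(d, r) \<in> G" for d r
      unfolding \<alpha>_def using yG le that by (intro cSup_least) auto
    define H where "H = {p + t *\<^sub>R (x, \<alpha>) | p t. p \<in> G}"
    have "subspace H"
    proof (rule subspaceI)
      show "0 \<in> H" unfolding H_def using subspace_0[OF sub]
        by (intro CollectI exI[of _ 0]) (auto simp: zero_prod_def)
      show "c *\<^sub>R p \<in> H" if "p \<in> H" for c p
      proof -
        from that obtain q t where "p = q + t *\<^sub>R (x, \<alpha>)" "q \<in> G" unfolding H_def by blast
        then have "c *\<^sub>R p = c *\<^sub>R q + (c * t) *\<^sub>R (x, \<alpha>)" "c *\<^sub>R q \<in> G"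
          using subspace_scale[OF sub] by (simp_all add: scaleR_add_right)
        then show ?thesis unfolding H_def by blast
      qed
      fix p p' assume "p \<in> H" "p' \<in> H"
      then obtain q t q' t' where "p = q + t *\<^sub>R (x, \<alpha>)" "q \<in> G" "p' = q' + t' *\<^sub>R (x, \<alpha>)" "q' \<in> G"
        unfolding H_def by blast
      then have "p + p' = (q + q') + (t + t') *\<^sub>R (x, \<alpha>)" "q + q' \<in> G"
        using subspace_add[OF sub] by (simp_all add: scaleR_add_left algebra_simps)
      then show "p + p' \<in> H" unfolding H_def by blast
    qed
    moreover have "r \<le> norm z" if zr: "(z, r) \<in> H" for z r
    proof -
      obtain d s t where ds: "(d, s) \<in> G" "z = d + t *\<^sub>R x" "r = s + t * \<alpha>"
        using zr unfolding H_def by auto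
      have G': "(inverse c *\<^sub>R d, inverse c * s) \<in> G" for c
        using subspace_scale[OF sub ds(1)] by simp
      consider "t = 0" | "t > 0" | "t < 0" by linarith
      then show ?thesis
      proof cases
        case 1
        then show ?thesis using dom ds by simp
      next
        case 2
        have "t * \<alpha> \<le> t * (norm (inverse t *\<^sub>R d + x) - inverse t * s)"
          using upper[OF G'] 2 by (intro mult_left_mono) auto
        also have "\<dots> = norm (t *\<^sub>R (inverse t *\<^sub>R d + x)) - s" using 2 by (simp add: right_diff_distrib del: scaleR_add_right)
        also have "t *\<^sub>R (inverse t *\<^sub>R d + x) = z" using 2 ds by (simp add: scaleR_add_right)
        finally show ?thesis using ds by simp
      next
        case 3
        have h1: "(-t) * (inverse (-t) * s - norm (inverse (-t) *\<^sub>R d - x)) \<le> (-t) * \<alpha>"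
          using lower[OF G'[of "-t"]] 3 by (intro mult_left_mono) auto
        have h2: "(-t) * (inverse (-t) * s - norm (inverse (-t) *\<^sub>R d - x)) =
            s - norm ((-t) *\<^sub>R (inverse (-t) *\<^sub>R d - x))" using 3 unfolding norm_scaleR by (simp add: right_diff_distrib)
        have h3: "(-t) *\<^sub>R (inverse (-t) *\<^sub>R d - x) = z" using 3 ds by (simp add: scaleR_diff_right)
        show ?thesis using h1[unfolded h2 h3] ds by simp
      qed
    qed
    moreover have GH: "G \<subseteq> H" unfolding H_def by (force intro: exI[of _ "0::real"])
    ultimately have "H \<in> \<A>" using yG unfolding \<A>_def by blast
    then have "H = G" using G(2) GH by blast
    moreover have "(0, 0) + 1 *\<^sub>R (x, \<alpha>) \<in> H"
      unfolding H_def using subspace_0[OF sub] by (intro CollectI exI[of _ "(0, 0)"] exI[of _ 1]) (simp add: zero_prod_def)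
    ultimately show False using no by auto
  qed
  \<comment> \<open>Two values over the same \<open>x\<close> give the points
    \<open>(0, r - s)\<close> and \<open>(0, s - r)\<close> of \<open>G\<close>, and domination by
    \<open>norm 0\<close> bounds both differences by 0.\<close>
  have single: "r = s" if "(x, r) \<in> G" "(x, s) \<in> G" for x r s
    using dom[of 0 "r - s"] dom[of 0 "s - r"] subspace_diff[OF sub that] subspace_diff[OF sub that(2,1)] by simp
  define u where "u x = (THE r. (x, r) \<in> G)" for x
  have u: "(x, u x) \<in> G" for x
    unfolding u_def using total[of x] single by (metis theI)
  have lin: "linear u"
  proof (rule linearI)
    show "u (a + b) = u a + u b" for a b
      using single[OF u, of "a + b" "u a + u b"] subspace_add[OF sub u u, of a b] by simp
    show "u (c *\<^sub>R a) = c *\<^sub>R u a" for c a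
      using single[OF u, of "c *\<^sub>R a" "c * u a"] subspace_scale[OF sub u, of c a] by simp
  qed
  have le: "\<bar>u x\<bar> \<le> norm x" for x
    using dom[OF u, of x] dom[OF u, of "-x"] linear_neg[OF lin, of x] by simp
  then have "bounded_linear u"
    using lin by (intro bounded_linear_intro[of _ 1]) (auto simp: linear_add linear_scale)
  then show ?thesis using that le single[OF u yG] by blast
qed

section \<open>Compact balls of finite-dimensional subspaces and Riesz's theorem\<close>

lemma closed_of_compact_balls:
  fixes E :: "'a::real_normed_vector set"
  assumes comp: "\<And>R. compact (E \<inter> cball 0 R)"
  shows "closed E"
proof (unfold closed_sequential_limits, intro allI impI)
  fix x l assume x: "(\<forall>n. x n \<in> E) \<and> x \<longlonglongrightarrow> l"
  then have "bounded (range x)" using convergent_imp_bounded by blast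
  then obtain R where "\<forall>n. norm (x n) \<le> R" unfolding bounded_iff by blast
  then have "\<forall>n. x n \<in> E \<inter> cball 0 R" using x by simp
  moreover have "closed (E \<inter> cball 0 R)" using comp compact_imp_closed by blast
  ultimately have "l \<in> E \<inter> cball 0 R" using x closed_sequentially by blast
  then show "l \<in> E" by blast
qed

text \<open>\<open>E\<close> is closed, so \<open>b\<close> has a positive distance \<open>d\<close>
  from it, and \<open>\<bar>c\<bar> * d\<close> is at most the norm of
  \<open>e + c *\<^sub>R b\<close>. On a ball both \<open>c\<close> and \<open>e\<close> are
  therefore bounded, and the ball is a closed part of the continuous image of a compact
  product.\<close>

lemma span_insert_compact_step:
  fixes E :: "'a::real_normed_vector set" and b :: 'a
  assumes sub: "subspace E" and comp: "\<And>R. compact (E \<inter> cball 0 R)" and b: "b \<notin> E"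
  shows "compact ({e + c *\<^sub>R b | e c. e \<in> E} \<inter> cball 0 R)"
proof -
  have cl: "closed E" using comp by (rule closed_of_compact_balls)
  obtain d where d: "d > 0" "\<And>e. e \<in> E \<Longrightarrow> d \<le> dist b e"
  proof -
    have "open (- E)" using cl by (simp add: open_Compl)
    then obtain d where "d > 0" "ball b d \<subseteq> - E" using b open_contains_ball by blast
    then have "\<And>e. e \<in> E \<Longrightarrow> d \<le> dist b e" by (meson Compl_iff mem_ball not_le_imp_less subset_iff)
    then show ?thesis using that \<open>d > 0\<close> by blast
  qed
  have low: "\<bar>c\<bar> * d \<le> norm (e + c *\<^sub>R b)" if "e \<in> E" for e c
  proof (cases "c = 0")
    case False
    have "- (inverse c *\<^sub>R e) \<in> E" using sub that by (simp add: subspace_neg subspace_scale)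
    then have "d \<le> norm (b + inverse c *\<^sub>R e)" using d(2) by (force simp: dist_norm)
    then have "\<bar>c\<bar> * d \<le> \<bar>c\<bar> * norm (b + inverse c *\<^sub>R e)" by (intro mult_left_mono) auto
    also have "\<dots> = norm (c *\<^sub>R (b + inverse c *\<^sub>R e))" by simp
    also have "c *\<^sub>R (b + inverse c *\<^sub>R e) = e + c *\<^sub>R b" using False by (simp add: scaleR_add_right)
    finally show ?thesis .
  qed simp
  let ?K = "(E \<inter> cball 0 (R + R / d * norm b)) \<times> {- R / d .. R / d}"
  have "compact ((\<lambda>p. fst p + snd p *\<^sub>R b) ` ?K)"
    by (intro compact_continuous_image compact_Times comp continuous_intros compact_Icc)
  then have "compact ((\<lambda>p. fst p + snd p *\<^sub>R b) ` ?K \<inter> cball 0 R)"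
    by (intro compact_Int_closed) auto
  moreover have "{e + c *\<^sub>R b | e c. e \<in> E} \<inter> cball 0 R = (\<lambda>p. fst p + snd p *\<^sub>R b) ` ?K \<inter> cball 0 R"
  proof (intro equalityI subsetI)
    fix z assume "z \<in> {e + c *\<^sub>R b | e c. e \<in> E} \<inter> cball 0 R"
    then obtain e c where z: "z = e + c *\<^sub>R b" "e \<in> E" "norm z \<le> R" by auto
    then have "\<bar>c\<bar> * d \<le> R" using low[of e c] by simp
    then have c: "\<bar>c\<bar> \<le> R / d" using d(1) by (simp add: field_simps)
    have "norm e \<le> norm z + norm (c *\<^sub>R b)" using z(1) norm_triangle_ineq4[of z "c *\<^sub>R b"] by simp
    also have "\<dots> \<le> R + R / d * norm b" unfolding norm_scaleR by (intro add_mono z(3) mult_right_mono c) auto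
    finally have "(e, c) \<in> ?K" using z(2) c by auto
    then show "z \<in> (\<lambda>p. fst p + snd p *\<^sub>R b) ` ?K \<inter> cball 0 R" using z by force
  qed auto
  ultimately show ?thesis by simp
qed

lemma compact_span_cball:
  fixes B :: "'a::real_normed_vector set"
  assumes "finite B" shows "compact (span B \<inter> cball 0 R)"
  using assms
proof (induction B arbitrary: R rule: finite_induct)
  case empty
  have "span {} \<inter> cball 0 R = {} \<or> span {} \<inter> cball 0 R = {0::'a}" by auto
  then show ?case by auto
next
  case (insert b B)
  show ?case
  proof (cases "b \<in> span B")
    case True
    then show ?thesis using insert.IH by (simp add: span_redundant)
  next
    case False
    have "span (insert b B) = {e + c *\<^sub>R b | e c. e \<in> span B}"
      by (auto simp: span_insert) (metis add_diff_cancel_right' diff_add_cancel)+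
    then show ?thesis using span_insert_compact_step[OF subspace_span insert.IH False] by simp
  qed
qed

lemma closed_span_finite:
  fixes B :: "'a::real_normed_vector set"
  assumes "finite B" shows "closed (span B)"
  by (intro closed_of_compact_balls compact_span_cball assms)

text \<open>A finite net for \<open>C\<close> gives a finite-dimensional \<open>span B\<close>
  within half the norm of every vector of \<open>Y\<close>. The remainder stays in \<open>Y\<close>,
  so repeating this halves the distance each time, and \<open>span B\<close> is closed.\<close>

lemma riesz_finite_dimensional:
  fixes Y :: "'a::real_normed_vector set"
  assumes Y: "subspace Y" and C: "compact C" "Y \<inter> cball 0 1 \<subseteq> C"
  obtains B where "finite B" "Y \<subseteq> span B"
proof -
  \<comment> \<open>The centres need not belong to \<open>Y\<close>; trading them for nearby points
    of \<open>Y\<close> costs another 1/4, for a total distance of 1/2.\<close>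
  obtain B0 where B0: "finite B0" "C \<subseteq> (\<Union>b\<in>B0. ball b (1/4))"
    by (rule compactE_image[OF C(1), of C "\<lambda>b. ball b (1/4)"]) auto
  have "\<forall>b. \<exists>y. (\<exists>y\<in>Y. dist b y < 1/4) \<longrightarrow> y \<in> Y \<and> dist b y < 1/4" by blast
  from choice[OF this] obtain pick
    where pick0: "\<forall>b. (\<exists>y\<in>Y. dist b y < 1/4) \<longrightarrow> pick b \<in> Y \<and> dist b (pick b) < 1/4" ..
  then have pick: "pick b \<in> Y \<and> dist b (pick b) < 1/4" if "\<exists>y\<in>Y. dist b y < 1/4" for b
    using that by simp
  define B where "B = pick ` {b\<in>B0. \<exists>y\<in>Y. dist b y < 1/4}"
  have fin: "finite B" using B0(1) unfolding B_def by simp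
  have "B \<subseteq> Y" using pick unfolding B_def by auto
  then have span_Y: "span B \<subseteq> Y" using Y by (simp add: span_minimal)
  have unit: "\<exists>e\<in>span B. norm (y - e) \<le> 1/2" if y: "y \<in> Y" "norm y \<le> 1" for y
  proof -
    have "y \<in> C" using y C(2) by auto
    then obtain b where b: "b \<in> B0" "dist b y < 1/4" using B0(2) by auto
    then have "pick b \<in> B" "dist b (pick b) < 1/4" using y(1) pick unfolding B_def by blast+
    moreover have "dist y (pick b) \<le> dist b y + dist b (pick b)" by (metis dist_commute dist_triangle)
    ultimately show ?thesis using b(2) by (intro bexI[of _ "pick b"]) (auto simp: dist_norm intro: span_base)
  qed
  have half: "\<exists>e\<in>span B. norm (y - e) \<le> norm y / 2" if y: "y \<in> Y" for y
  proof (cases "y = 0")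
    case True
    then show ?thesis by (intro bexI[of _ 0] span_zero) simp
  next
    case False
    have "inverse (norm y) *\<^sub>R y \<in> Y" using Y y by (simp add: subspace_scale)
    then obtain e where e: "e \<in> span B" "norm (inverse (norm y) *\<^sub>R y - e) \<le> 1/2"
      using unit[of "inverse (norm y) *\<^sub>R y"] False by auto
    have "y - norm y *\<^sub>R e = norm y *\<^sub>R (inverse (norm y) *\<^sub>R y - e)"
      using False by (simp add: scaleR_diff_right)
    then have "norm (y - norm y *\<^sub>R e) = norm y * norm (inverse (norm y) *\<^sub>R y - e)" by simp
    also have "\<dots> \<le> norm y * (1/2)" using e(2) by (intro mult_left_mono) auto
    finally show ?thesis using e(1) by (intro bexI[of _ "norm y *\<^sub>R e"] span_scale) auto
  qed
  have approx: "\<exists>e\<in>span B. norm (y - e) \<le> norm y / 2^n" if y: "y \<in> Y" for y n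
  proof (induction n)
    case 0
    show ?case by (intro bexI[of _ 0] span_zero) simp
  next
    case (Suc n)
    then obtain e where e: "e \<in> span B" "norm (y - e) \<le> norm y / 2^n" by blast
    then have "y - e \<in> Y" using span_Y Y y by (auto intro: subspace_diff)
    then obtain e' where e': "e' \<in> span B" "norm (y - e - e') \<le> norm (y - e) / 2" using half by blast
    then have "norm (y - (e + e')) \<le> norm y / 2 ^ Suc n" using e(2) by (simp add: algebra_simps)
    then show ?case using e(1) e'(1) span_add by blast
  qed
  have "Y \<subseteq> span B"
  proof
    fix y assume y: "y \<in> Y"
    have "\<forall>n. \<exists>e. e \<in> span B \<and> norm (y - e) \<le> norm y / 2^n" using approx[OF y] by blast
    from choice[OF this] obtain e where "\<forall>n. e n \<in> span B \<and> norm (y - e n) \<le> norm y / 2^n" ..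
    then have e: "\<And>n. e n \<in> span B" "\<And>n. norm (y - e n) \<le> norm y / 2^n" by simp_all
    have "(\<lambda>n. norm y * (1/2)^n) \<longlonglongrightarrow> norm y * 0" by (intro tendsto_mult tendsto_const LIMSEQ_realpow_zero) auto
    then have "(\<lambda>n. norm y / 2^n) \<longlonglongrightarrow> 0" by (simp add: power_divide)
    then have "(\<lambda>n. e n - y) \<longlonglongrightarrow> 0"
      by (rule Lim_null_comparison[rotated]) (use e(2) in \<open>simp add: norm_minus_commute[of _ y]\<close>)
    then have "e \<longlonglongrightarrow> y" by (rule LIM_zero_cancel)
    then show "y \<in> span B" using e(1) closed_span_finite[OF fin] closed_sequentially by blast
  qed
  then show ?thesis using that fin by blast
qed

section \<open>The scalar field\<close>

text \<open>Over the reals \<open>im\<close> vanishes and \<open>j\<close> is a dummy; this is the reason for the disjunctions.\<close>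

lemma real_or_complex_coordinates:
  obtains j :: "'k::real_or_complex" and re im :: "'k \<Rightarrow> real" where
    "norm j = 1" "linear re" "linear im" "\<And>z. z = of_real (re z) + of_real (im z) * j"
    "\<And>z. \<bar>re z\<bar> \<le> 2 * norm z" "\<And>z. \<bar>im z\<bar> \<le> 2 * norm z"
    "j * j = - 1 \<or> (\<forall>z. im z = 0)" "\<And>r t. re (of_real r + of_real t * j) = r \<or> (\<forall>z. im z = 0)"
proof (cases "\<forall>z::'k. \<exists>r. z = of_real r")
  case True
  from choice[OF this] obtain re :: "'k \<Rightarrow> real" where re: "\<forall>z. z = of_real (re z)" ..
  have eq: "re z = r" if "z = of_real r" for z r
    using re[rule_format, of z] that by (metis of_real_eq_iff)
  have "linear re"
  proof (rule linearI)
    fix a b :: 'k and r :: real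
    show "re (a + b) = re a + re b"
      using re[rule_format, of a] re[rule_format, of b] by (intro eq) (metis of_real_add)
    have "r *\<^sub>R a = of_real (r * re a)"
      using re[rule_format, of a] by (metis of_real_mult scaleR_conv_of_real)
    then show "re (r *\<^sub>R a) = r *\<^sub>R re a" by (intro eq) simp
  qed
  moreover have "\<bar>re z\<bar> = norm z" for z
    using re[rule_format, of z] by (metis norm_of_real)
  ultimately show ?thesis using re
    by (intro that[of 1 re "\<lambda>_. 0"]) (auto simp: linear_iff)
next
  case False
  then obtain j :: 'k where j: "j * j = - 1" "\<forall>z. \<exists>r t. z = r *\<^sub>R 1 + t *\<^sub>R j"
    using real_or_complex[where 'a = 'k] by (auto simp: of_real_def)
  \<comment> \<open>A nonzero \<open>t\<close> would make \<open>j\<close>, and with it every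
    scalar, real, which is the case already excluded.\<close>
  have indep: "r = 0 \<and> t = 0" if rt: "of_real r + of_real t * j = 0" for r t
  proof -
    have "t = 0"
    proof (rule ccontr)
      assume t: "t \<noteq> 0"
      then have j_eq: "j = of_real (- r / t)" using rt by (simp add: field_simps add_eq_0_iff)
      then have "\<exists>q. z = of_real q" for z :: 'k
      proof -
        obtain r' t' where "z = r' *\<^sub>R 1 + t' *\<^sub>R j" using j(2) by blast
        then have "z = of_real (r' + t' * (- r / t))"
          by (simp add: j_eq scaleR_conv_of_real)
        then show ?thesis ..
      qed
      then show False using False by blast
    qed
    then show ?thesis using rt by simp
  qed
  have "\<forall>z. \<exists>p. z = of_real (fst p) + of_real (snd p) * j"
    using j(2) by (simp add: scaleR_conv_of_real)
  from choice[OF this] obtain p where p: "\<And>z. z = of_real (fst (p z)) + of_real (snd (p z)) * j" by blast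
  have eq: "p z = (r, t)" if "z = of_real r + of_real t * j" for z r t
  proof -
    have "of_real (fst (p z) - r) + of_real (snd (p z) - t) * j = 0"
      using p[of z] that by (simp add: algebra_simps)
    from indep[OF this] show ?thesis by (simp add: prod_eq_iff)
  qed
  have lin: "p (a + b) = p a + p b" "p (c *\<^sub>R a) = c *\<^sub>R p a" for a b c
  proof -
    have "a + b = of_real (fst (p a) + fst (p b)) + of_real (snd (p a) + snd (p b)) * j"
      by (subst p[of a], subst p[of b]) (simp add: algebra_simps)
    from eq[OF this] show "p (a + b) = p a + p b" by (simp add: prod_eq_iff)
    have "c *\<^sub>R a = of_real (c * fst (p a)) + of_real (c * snd (p a)) * j"
      by (subst p[of a]) (simp add: algebra_simps scaleR_conv_of_real)
    from eq[OF this] show "p (c *\<^sub>R a) = c *\<^sub>R p a" by (simp add: prod_eq_iff)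
  qed
  have "norm j * norm j = 1" using j(1) by (metis norm_minus_cancel norm_mult norm_one)
  then have nj: "norm j = 1" by (metis abs_1 abs_norm_cancel power2_eq_square real_sqrt_abs real_sqrt_one)
  have bound: "\<bar>fst (p z)\<bar> + \<bar>snd (p z)\<bar> \<le> 2 * norm z" for z
  proof -
    define r t where "r = fst (p z)" and "t = snd (p z)"
    have z: "z = of_real r + of_real t * j" using p unfolding r_def t_def .
    \<comment> \<open>Multiplication by the conjugate together with multiplicativity of the norm.
      The factor 2 of the bound stems from the square of
      \<open>\<bar>r\<bar> + \<bar>t\<bar>\<close> being at most
      \<open>2 * (r * r + t * t)\<close>.\<close>
    have "z * (of_real r - of_real t * j) = of_real r * of_real r - of_real t * of_real t * (j * j)"
      unfolding z by (simp add: algebra_simps)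
    also have "\<dots> = of_real (r * r + t * t)" by (simp add: j(1))
    finally have "norm z * norm (of_real r - of_real t * j) = norm (of_real (r * r + t * t) :: 'k)"
      by (metis norm_mult)
    also have "\<dots> = r * r + t * t" unfolding norm_of_real by simp
    finally have 1: "norm z * norm (of_real r - of_real t * j) = r * r + t * t" .
    have "norm (of_real r - of_real t * j) \<le> \<bar>r\<bar> + \<bar>t\<bar>"
      using norm_triangle_ineq4[of "of_real r" "of_real t * j"] nj by (simp add: norm_mult)
    then have 2: "r * r + t * t \<le> norm z * (\<bar>r\<bar> + \<bar>t\<bar>)"
      unfolding 1[symmetric] by (intro mult_left_mono) auto
    have h: "(\<bar>r\<bar> + \<bar>t\<bar>) * (\<bar>r\<bar> + \<bar>t\<bar>) \<le> 2 * (r * r + t * t)"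
      using zero_le_square[of "\<bar>r\<bar> - \<bar>t\<bar>"] by (simp add: algebra_simps abs_mult_self_eq)
    then have 3: "(\<bar>r\<bar> + \<bar>t\<bar>) * (\<bar>r\<bar> + \<bar>t\<bar>) \<le> 2 * norm z * (\<bar>r\<bar> + \<bar>t\<bar>)"
      using order_trans[OF h mult_left_mono[OF 2, of 2]] by (simp add: mult.assoc)
    show ?thesis
    proof (cases "\<bar>r\<bar> + \<bar>t\<bar> = 0")
      case True
      then show ?thesis using norm_ge_zero[of z] unfolding r_def t_def by linarith
    next
      case False
      then have "\<bar>r\<bar> + \<bar>t\<bar> > 0" by linarith
      then show ?thesis using 3 mult_le_cancel_right_pos r_def t_def by blast
    qed
  qed
  show ?thesis
  proof (rule that[of j "\<lambda>z. fst (p z)" "\<lambda>z. snd (p z)"])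
    show "linear (\<lambda>z. fst (p z))" "linear (\<lambda>z. snd (p z))" using lin by (auto intro!: linearI)
    show "\<bar>fst (p z)\<bar> \<le> 2 * norm z" "\<bar>snd (p z)\<bar> \<le> 2 * norm z" for z
      using bound[of z] by linarith+
    show "fst (p (of_real r + of_real t * j)) = r \<or> (\<forall>z. snd (p z) = 0)" for r t
      using eq[OF refl, of r t] by simp
    show "z = of_real (fst (p z)) + of_real (snd (p z)) * j" for z by (rule p)
  qed (use j nj in auto)
qed

lemma compact_cball_scalars: "compact (cball (0::'k::real_or_complex) R)"
proof -
  obtain j :: 'k and re im where k: "norm j = 1" "\<And>z. z = of_real (re z) + of_real (im z) * j"
    "\<And>z. \<bar>re z\<bar> \<le> 2 * norm z" "\<And>z. \<bar>im z\<bar> \<le> 2 * norm z"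
    by (rule real_or_complex_coordinates) blast
  let ?f = "\<lambda>p. of_real (fst p) + of_real (snd p) * j"
  have "compact (?f ` ({-2*R..2*R} \<times> {-2*R..2*R}))"
    by (intro compact_continuous_image compact_Times compact_Icc continuous_intros)
  then have "compact (?f ` ({-2*R..2*R} \<times> {-2*R..2*R}) \<inter> cball 0 R)" by (intro compact_Int_closed) auto
  moreover have "cball 0 R \<subseteq> ?f ` ({-2*R..2*R} \<times> {-2*R..2*R})"
  proof
    fix z :: 'k assume "z \<in> cball 0 R"
    then have "(re z, im z) \<in> {-2*R..2*R} \<times> {-2*R..2*R}" using k(3)[of z] k(4)[of z] by (auto simp: abs_le_iff)
    moreover have "z = ?f (re z, im z)" using k(2)[of z] by simp
    ultimately show "z \<in> ?f ` ({-2*R..2*R} \<times> {-2*R..2*R})" by blast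
  qed
  ultimately show ?thesis by (simp add: Int_absorb1)
qed

lemma bounded_scalars_convergent_subseq:
  fixes c :: "nat \<Rightarrow> 'k::real_or_complex"
  assumes "\<And>n. norm (c n) \<le> R"
  obtains l r where "strict_mono (r :: nat \<Rightarrow> nat)" "(\<lambda>n. c (r n)) \<longlonglongrightarrow> l" "norm l \<le> R"
proof -
  have "\<forall>n. c n \<in> cball 0 R" using assms by simp
  then have "\<exists>l\<in>cball 0 R. \<exists>r. strict_mono r \<and> (c \<circ> r) \<longlonglongrightarrow> l"
    using compact_cball_scalars[of R] unfolding compact_def by blast
  then show ?thesis using that unfolding comp_def by auto
qed

lemma Cauchy_scalars_convergent:
  fixes c :: "nat \<Rightarrow> 'k::real_or_complex"
  assumes "Cauchy c" shows "convergent c"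
proof -
  obtain R where "\<And>n. norm (c n) \<le> R" using Cauchy_Bseq[OF assms] by (auto simp: Bseq_def)
  then obtain l r where "strict_mono (r :: nat \<Rightarrow> nat)" "(\<lambda>n. c (r n)) \<longlonglongrightarrow> l"
    by (rule bounded_scalars_convergent_subseq)
  then have "c \<longlonglongrightarrow> l" using Cauchy_converges_subseq[OF assms] by (simp add: comp_def)
  then show ?thesis by (rule convergentI)
qed

lemma countable_dense_scalars:
  obtains D :: "'k::real_or_complex set" where "countable D" "\<And>z e. e > 0 \<Longrightarrow> \<exists>d\<in>D. norm (z - d) < e"
proof -
  obtain j :: 'k and re im where k: "norm j = 1" "\<And>z. z = of_real (re z) + of_real (im z) * j"
    by (rule real_or_complex_coordinates) blast
  let ?f = "\<lambda>p. of_real (fst p) + of_real (snd p) * j"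
  have "\<exists>d\<in>?f ` (\<rat> \<times> \<rat>). norm (z - d) < e" if e: "e > 0" for z e
  proof -
    obtain r where r: "r \<in> \<rat>" "re z - e/2 < r" "r < re z"
      using Rats_dense_in_real[of "re z - e/2" "re z"] e by auto
    obtain t where t: "t \<in> \<rat>" "im z - e/2 < t" "t < im z"
      using Rats_dense_in_real[of "im z - e/2" "im z"] e by auto
    have "z - ?f (r, t) = of_real (re z - r) + of_real (im z - t) * j"
      by (subst k(2)[of z]) (simp add: algebra_simps)
    then have "norm (z - ?f (r, t)) \<le> norm (of_real (re z - r) :: 'k) + norm (of_real (im z - t) * j)"
      by (metis norm_triangle_ineq)
    also have "\<dots> = \<bar>re z - r\<bar> + \<bar>im z - t\<bar>" unfolding norm_mult norm_of_real k(1) by simp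
    also have "\<dots> < e" using r t by linarith
    finally have "norm (z - ?f (r, t)) < e" .
    moreover have "?f (r, t) \<in> ?f ` (\<rat> \<times> \<rat>)" by (rule imageI) (use r(1) t(1) in simp)
    ultimately show ?thesis by blast
  qed
  moreover have "countable (?f ` (\<rat> \<times> \<rat>))" by (intro countable_image countable_SIGMA countable_rat)
  ultimately show ?thesis using that by blast
qed

text \<open>The signs follow the real parts or the imaginary parts of the \<open>c i\<close>,
  whichever choice gives the larger sum in norm. Of the constant 4, one factor 2 bounds a coordinate
  by the norm and the other pays for having two coordinates. Signs, rather than general scalars of
  modulus 1, are what a two-valued pattern can encode later.\<close>

lemma exists_signs:
  fixes c :: "'i \<Rightarrow> 'k::real_or_complex"
  assumes "finite F"
  shows "\<exists>\<epsilon>. (\<forall>i. \<epsilon> i = 1 \<or> \<epsilon> i = - 1) \<and> (\<Sum>i\<in>F. norm (c i)) \<le> 4 * norm (\<Sum>i\<in>F. \<epsilon> i * c i)"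
proof -
  obtain j :: 'k and re im where k: "norm j = 1" "linear re" "linear im" "\<And>z. z = of_real (re z) + of_real (im z) * j"
    "\<And>z. \<bar>re z\<bar> \<le> 2 * norm z" "\<And>z. \<bar>im z\<bar> \<le> 2 * norm z"
    by (rule real_or_complex_coordinates) blast
  have "norm z \<le> \<bar>re z\<bar> + \<bar>im z\<bar>" for z
  proof -
    have "norm z \<le> norm (of_real (re z) :: 'k) + norm (of_real (im z) * j)" by (metis k(4) norm_triangle_ineq)
    then show ?thesis unfolding norm_mult norm_of_real k(1) by simp
  qed
  then have tot: "(\<Sum>i\<in>F. norm (c i)) \<le> (\<Sum>i\<in>F. \<bar>re (c i)\<bar>) + (\<Sum>i\<in>F. \<bar>im (c i)\<bar>)"
    by (simp add: sum.distrib[symmetric] sum_mono)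
  have *: "\<exists>\<epsilon>::'i \<Rightarrow> 'k. (\<forall>i. \<epsilon> i = 1 \<or> \<epsilon> i = - 1) \<and> (\<Sum>i\<in>F. \<bar>f (c i)\<bar>) \<le> 2 * norm (\<Sum>i\<in>F. \<epsilon> i * c i)"
    if f: "linear f" "\<And>z. \<bar>f z\<bar> \<le> 2 * norm z" for f
  proof -
    define \<epsilon> :: "'i \<Rightarrow> 'k" where "\<epsilon> i = (if f (c i) \<ge> 0 then 1 else - 1)" for i
    have "f (\<epsilon> i * c i) = \<bar>f (c i)\<bar>" for i unfolding \<epsilon>_def using linear_neg[OF f(1)] by auto
    then have "(\<Sum>i\<in>F. \<bar>f (c i)\<bar>) = f (\<Sum>i\<in>F. \<epsilon> i * c i)" by (simp add: linear_sum[OF f(1)])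
    also have "\<dots> \<le> 2 * norm (\<Sum>i\<in>F. \<epsilon> i * c i)" using f(2) by (meson abs_le_D1)
    finally show ?thesis by (intro exI[of _ \<epsilon>]) (auto simp: \<epsilon>_def)
  qed
  from *[OF k(2,5)] obtain \<epsilon> :: "'i \<Rightarrow> 'k" where e: "\<forall>i. \<epsilon> i = 1 \<or> \<epsilon> i = - 1"
    "(\<Sum>i\<in>F. \<bar>re (c i)\<bar>) \<le> 2 * norm (\<Sum>i\<in>F. \<epsilon> i * c i)" by blast
  from *[OF k(3,6)] obtain \<delta> :: "'i \<Rightarrow> 'k" where d: "\<forall>i. \<delta> i = 1 \<or> \<delta> i = - 1"
    "(\<Sum>i\<in>F. \<bar>im (c i)\<bar>) \<le> 2 * norm (\<Sum>i\<in>F. \<delta> i * c i)" by blast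
  show ?thesis
  proof (cases "norm (\<Sum>i\<in>F. \<epsilon> i * c i) \<le> norm (\<Sum>i\<in>F. \<delta> i * c i)")
    case True
    then show ?thesis using tot e d by (intro exI[of _ \<delta>]) auto
  next
    case False
    then show ?thesis using tot e d by (intro exI[of _ \<epsilon>]) auto
  qed
qed

section \<open>Basic sequences\<close>

context banach_space_over
begin

section \<open>Scalar multiplication and functionals seen through the real structure\<close>

lemma smul_real: "smul (of_real r * c) x = r *\<^sub>R smul c x"
  by (simp add: scale_of_real flip: scale_scale)

lemma smul_scaleR: "smul c (r *\<^sub>R x) = r *\<^sub>R smul c x"
  by (metis mult.commute scale_of_real scale_scale)

lemma bilinear_smul: "bounded_bilinear smul"
proof (rule bounded_bilinear.intro)
  show "smul (r *\<^sub>R c) x = r *\<^sub>R smul c x" for r c x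
    by (simp add: scaleR_conv_of_real smul_real)
  show "\<exists>K. \<forall>a b. norm (smul a b) \<le> norm a * norm b * K"
    by (intro exI[of _ 1]) (simp add: norm_scale)
qed (simp_all add: scale_left_distrib scale_right_distrib smul_scaleR)

lemma smul_coordinates:
  assumes "\<And>z. z = of_real (re z) + of_real (im z) * j"
  shows "smul c x = re c *\<^sub>R x + im c *\<^sub>R smul j x"
proof -
  have "smul c x = smul (of_real (re c) + of_real (im c) * j) x" using assms by metis
  then show ?thesis by (simp add: scale_left_distrib smul_real scale_of_real)
qed

text \<open>Norming functionals are constructed over the reals, while weak nullity is tested by
  functionals linear over \<open>'k\<close>. In the complex case \<open>u x - u (j x) * j\<close> is
  such a functional and has \<open>u\<close> as its real part.\<close>

lemma weakly_null_real:
  assumes x: "weakly_null smul x" and u: "bounded_linear (u :: 'a \<Rightarrow> real)"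
  shows "(\<lambda>n. u (x n)) \<longlonglongrightarrow> 0"
proof -
  obtain j :: 'k and re im where k: "norm j = 1" "linear re" "\<And>z. z = of_real (re z) + of_real (im z) * j"
    "\<And>z. \<bar>re z\<bar> \<le> 2 * norm z" "j * j = - 1 \<or> (\<forall>z. im z = 0)"
    "\<And>r t. re (of_real r + of_real t * j) = r \<or> (\<forall>z. im z = 0)"
    by (rule real_or_complex_coordinates) blast
  interpret u: bounded_linear u by (rule u)
  show ?thesis
  proof (cases "\<forall>z. im z = 0")
    case True
    then have real: "of_real (re c) = c" for c using k(3)[of c] by simp
    have "(\<lambda>x. of_real (u x) :: 'k) \<in> dual_space smul"
    proof -
      have "bounded_linear (\<lambda>x. of_real (u x) :: 'k)" by (intro bounded_linear_of_real bounded_linear_compose[OF _ u])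
      moreover have "of_real (u (smul c x)) = c * of_real (u x)" for c x
      proof -
        have "smul c x = re c *\<^sub>R x" using scale_of_real[of "re c" x] real by simp
        then show ?thesis by (simp add: u.scaleR real)
      qed
      ultimately show ?thesis by (simp add: dual_space_def)
    qed
    from bspec[OF x[unfolded weakly_null_def] this]
    have "(\<lambda>n. of_real (u (x n)) :: 'k) \<longlonglongrightarrow> of_real 0" by simp
    then show ?thesis by (simp only: tendsto_of_real_iff)
  next
    case False
    then have jj: "j * j = - 1" and re: "\<And>r t. re (of_real r + of_real t * j) = r" using k(5,6) by blast+
    define \<phi> where "\<phi> x = of_real (u x) + of_real (- u (smul j x)) * j" for x
    have bl: "bounded_linear \<phi>" unfolding \<phi>_def
      by (intro bounded_linear_add bounded_linear_of_real bounded_linear_minus u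
          bounded_linear_compose[OF bounded_linear_mult_left]
          bounded_linear_compose[OF bounded_linear_of_real]
          bounded_linear_compose[OF u] bounded_bilinear.bounded_linear_right[OF bilinear_smul])
    have "\<phi> (smul c x) = c * \<phi> x" for c x
    proof -
      have 1: "\<phi> (r *\<^sub>R x) = of_real r * \<phi> x" for r x
        using linear_scale[OF bounded_linear.linear[OF bl]] by (simp add: scaleR_conv_of_real)
      have "smul j (smul j x) = - x" by (simp add: jj)
      then have 2: "\<phi> (smul j x) = j * \<phi> x"
        unfolding \<phi>_def by (simp add: linear_neg[OF u.linear_axioms] algebra_simps jj flip: mult.assoc)
      have "\<phi> (smul c x) = of_real (re c) * \<phi> x + of_real (im c) * (j * \<phi> x)"
        by (simp add: smul_coordinates[OF k(3), of c x] 1 2 linear_add[OF bounded_linear.linear[OF bl]])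
      also have "\<dots> = (of_real (re c) + of_real (im c) * j) * \<phi> x" by (simp add: algebra_simps)
      finally show ?thesis using k(3)[of c] by simp
    qed
    then have "\<phi> \<in> dual_space smul" using bl by (simp add: dual_space_def)
    then have "(\<lambda>n. 2 * norm (\<phi> (x n))) \<longlonglongrightarrow> 2 * norm (0::'k)"
      using x by (intro tendsto_mult tendsto_norm tendsto_const) (simp add: weakly_null_def)
    then have lim: "(\<lambda>n. 2 * norm (\<phi> (x n))) \<longlonglongrightarrow> 0" by simp
    have le: "norm (u (x n)) \<le> 2 * norm (\<phi> (x n))" for n
    proof -
      have "re (\<phi> (x n)) = u (x n)" unfolding \<phi>_def by (rule re)
      then show ?thesis using k(4)[of "\<phi> (x n)"] by simp
    qed
    show ?thesis by (rule Lim_null_comparison[OF _ lim]) (simp only: le eventually_True)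
  qed
qed

section \<open>Mazur's selection of basic subsequences\<close>

lemma combinations_in_real_span:
  assumes "finite F"
  obtains B where "finite B" "\<And>a. (\<Sum>i\<in>F. smul (a i) (x i)) \<in> Real_Vector_Spaces.span B"
proof -
  obtain j :: 'k and re im where k: "\<And>z. z = of_real (re z) + of_real (im z) * j"
    by (rule real_or_complex_coordinates) blast
  let ?B = "x ` F \<union> (\<lambda>i. smul j (x i)) ` F"
  have sp: "(\<Sum>i\<in>F. smul (a i) (x i)) \<in> Real_Vector_Spaces.span ?B" for a
    by (intro real_vector.span_sum, subst smul_coordinates[OF k])
      (auto intro!: real_vector.span_add real_vector.span_scale intro: real_vector.span_base)
  show ?thesis by (rule that[OF _ sp]) (simp add: assms)
qed

text \<open>If the inequality failed infinitely often, the normalized counterexamples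
  \<open>e n\<close> would have a limit \<open>l\<close> of norm 1 along a subsequence, by
  compactness. A functional norming \<open>l\<close> tends to 0 on the terms
  \<open>smul (c n) (x (r n))\<close>, because the scalars stay bounded, so its value 1 at
  \<open>l\<close> would be at most \<open>1 / t\<close>.\<close>

lemma mazur_step:
  assumes wn: "weakly_null smul x" and low: "m > 0" "\<And>n. m \<le> norm (x n)"
    and B: "finite B" and t: "t > 1"
  shows "\<forall>\<^sub>F n in sequentially. \<forall>e\<in>Real_Vector_Spaces.span B. \<forall>c. norm e \<le> t * norm (e + smul c (x n))"
proof (rule ccontr)
  assume "\<not> ?thesis"
  then obtain r :: "nat \<Rightarrow> nat" where r0: "strict_mono r"
    "\<forall>n. \<not> (\<forall>e\<in>Real_Vector_Spaces.span B. \<forall>c. norm e \<le> t * norm (e + smul c (x (r n))))"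
    using not_eventually_sequentiallyD[of "\<lambda>n. \<forall>e\<in>Real_Vector_Spaces.span B. \<forall>c. norm e \<le> t * norm (e + smul c (x n))"]
    by auto
  have r: "strict_mono r"
    "\<forall>n. \<exists>p. fst p \<in> Real_Vector_Spaces.span B \<and> norm (fst p) > t * norm (fst p + smul (snd p) (x (r n)))"
  proof (rule r0(1), rule allI)
    fix n
    obtain e c where "e \<in> Real_Vector_Spaces.span B" "norm e > t * norm (e + smul c (x (r n)))"
      using r0(2) by (meson not_le)
    then show "\<exists>p. fst p \<in> Real_Vector_Spaces.span B \<and> norm (fst p) > t * norm (fst p + smul (snd p) (x (r n)))"
      by (intro exI[of _ "(e, c)"]) simp
  qed
  from choice[OF r(2)] obtain p where p: "\<forall>n. fst (p n) \<in> Real_Vector_Spaces.span B \<and>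
      norm (fst (p n)) > t * norm (fst (p n) + smul (snd (p n)) (x (r n)))" ..
  define d where "d n = inverse (norm (fst (p n)))" for n
  define e where "e n = d n *\<^sub>R fst (p n)" for n
  define c where "c n = of_real (d n) * snd (p n)" for n
  have pos: "norm (fst (p n)) > 0" for n
  proof -
    have "0 \<le> t * norm (fst (p n) + smul (snd (p n)) (x (r n)))" using t by simp
    then show ?thesis using p by (metis order_le_less_trans)
  qed
  have e1: "norm (e n) = 1" for n unfolding e_def d_def using pos[of n] by simp
  have eB: "e n \<in> Real_Vector_Spaces.span B" for n unfolding e_def using p by (simp add: real_vector.span_scale)
  have lt: "t * norm (e n + smul (c n) (x (r n))) < 1" for n
  proof -
    have "e n + smul (c n) (x (r n)) = d n *\<^sub>R (fst (p n) + smul (snd (p n)) (x (r n)))"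
      unfolding e_def c_def by (simp add: smul_real scaleR_add_right)
    then have "t * norm (e n + smul (c n) (x (r n))) = d n * (t * norm (fst (p n) + smul (snd (p n)) (x (r n))))"
      using pos[of n] by (simp add: d_def)
    also have "\<dots> < d n * norm (fst (p n))" using p pos[of n] by (intro mult_strict_left_mono) (auto simp: d_def)
    also have "\<dots> = 1" using pos[of n] by (simp add: d_def)
    finally show ?thesis .
  qed
  have lt1: "norm (e n + smul (c n) (x (r n))) \<le> 1 / t" for n
    using lt[of n] t by (simp add: field_simps)
  have cb: "norm (c n) \<le> 2 / m" for n
  proof -
    have "norm (c n) * m \<le> norm (smul (c n) (x (r n)))" using low(2) by (simp add: norm_scale mult_left_mono)
    also have "\<dots> \<le> norm (e n + smul (c n) (x (r n))) + norm (e n)"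
      using norm_triangle_ineq4[of "e n + smul (c n) (x (r n))" "e n"] by simp
    also have "\<dots> \<le> 2" using lt1[of n] e1[of n] t by (smt (verit) divide_le_eq_1)
    finally show ?thesis using low(1) by (simp add: field_simps)
  qed
  have "\<forall>n. e n \<in> Real_Vector_Spaces.span B \<inter> cball 0 1" using eB e1 by simp
  then have "\<exists>l\<in>Real_Vector_Spaces.span B \<inter> cball 0 1. \<exists>s. strict_mono s \<and> (e \<circ> s) \<longlonglongrightarrow> l"
    using compact_span_cball[OF B, of 1] unfolding compact_def by blast
  then obtain l s where s: "strict_mono s" "(\<lambda>n. e (s n)) \<longlonglongrightarrow> l" unfolding comp_def by blast
  have "(\<lambda>n. norm (e (s n))) \<longlonglongrightarrow> norm l" using s(2) by (rule tendsto_norm)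
  then have l1: "norm l = 1" using e1 LIMSEQ_unique by (simp add: LIMSEQ_const_iff)
  obtain u :: "'a \<Rightarrow> real" where u: "bounded_linear u" "\<And>x. \<bar>u x\<bar> \<le> norm x" "u l = norm l"
    using norming_functional[of l] by blast
  obtain j :: 'k and re im where k: "norm j = 1" "\<And>z. z = of_real (re z) + of_real (im z) * j"
    "\<And>z. \<bar>re z\<bar> \<le> 2 * norm z" "\<And>z. \<bar>im z\<bar> \<le> 2 * norm z"
    by (rule real_or_complex_coordinates) blast
  interpret u: bounded_linear u by (rule u)
  \<comment> \<open>\<open>q (r n)\<close> majorizes the modulus of \<open>u\<close> at
    \<open>smul (c n) (x (r n))\<close>: the two real coordinates of \<open>c n\<close> are at most
    twice the norm bound \<open>2 / m\<close>.\<close>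
  define q where "q n = 4 / m * \<bar>u (x n)\<bar> + 4 / m * \<bar>u (smul j (x n))\<bar>" for n
  have q0: "q \<longlonglongrightarrow> 0"
  proof -
    have "(\<lambda>n. u (x n)) \<longlonglongrightarrow> 0" using wn u(1) by (rule weakly_null_real)
    moreover have "(\<lambda>n. u (smul j (x n))) \<longlonglongrightarrow> 0"
      by (rule weakly_null_real[OF wn bounded_linear_compose[OF u(1)
            bounded_bilinear.bounded_linear_right[OF bilinear_smul]]])
    ultimately have "(\<lambda>n. 4 / m * \<bar>u (x n)\<bar> + 4 / m * \<bar>u (smul j (x n))\<bar>) \<longlonglongrightarrow> 4 / m * \<bar>0\<bar> + 4 / m * \<bar>0\<bar>"
      by (intro tendsto_intros)
    then show ?thesis unfolding q_def by simp
  qed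
  have uq: "u (e n) - q (r n) \<le> 1 / t" for n
  proof -
    have "\<bar>re (c n)\<bar> \<le> 4 / m" "\<bar>im (c n)\<bar> \<le> 4 / m" using k(3,4)[of "c n"] cb[of n] by simp_all
    then have "\<bar>re (c n)\<bar> * \<bar>u (x (r n))\<bar> + \<bar>im (c n)\<bar> * \<bar>u (smul j (x (r n)))\<bar> \<le> q (r n)"
      unfolding q_def by (intro add_mono mult_right_mono) auto
    moreover have "u (smul (c n) (x (r n))) = re (c n) * u (x (r n)) + im (c n) * u (smul j (x (r n)))"
      by (subst smul_coordinates[OF k(2)]) (simp add: u.add u.scaleR)
    moreover have "\<bar>re (c n) * u (x (r n)) + im (c n) * u (smul j (x (r n)))\<bar> \<le>
        \<bar>re (c n)\<bar> * \<bar>u (x (r n))\<bar> + \<bar>im (c n)\<bar> * \<bar>u (smul j (x (r n)))\<bar>"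
      by (metis abs_mult abs_triangle_ineq)
    moreover have "u (e n) + u (smul (c n) (x (r n))) \<le> 1 / t"
      using u(2)[of "e n + smul (c n) (x (r n))"] lt1[of n] by (simp add: u.add)
    ultimately show ?thesis by linarith
  qed
  have "(\<lambda>n. u (e (s n)) - q (r (s n))) \<longlonglongrightarrow> u l - 0"
    using LIMSEQ_subseq_LIMSEQ[OF q0 strict_mono_o[OF r(1) s(1)]]
    by (intro tendsto_diff u.tendsto s(2)) (simp add: comp_def)
  then have "u l - 0 \<le> 1 / t" using uq by (intro LIMSEQ_le_const2) auto
  then show False using u(3) l1 t by simp
qed

text \<open>Grunblum's condition: the partial-sum projections are bounded by \<open>K\<close>. It
  involves finite sums only and is inherited by subsequences; \<open>basic_sequence\<close>, which
  speaks of expansions in the closed span and counts from 1, is derived from it when needed.\<close>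

definition basis_bound :: "real \<Rightarrow> (nat \<Rightarrow> 'a) \<Rightarrow> bool" where
  "basis_bound K x \<longleftrightarrow> (\<forall>m n a. m \<le> n \<longrightarrow>
     norm (\<Sum>i<m. smul (a i) (x i)) \<le> K * norm (\<Sum>i<n. smul (a i) (x i)))"

lemma subseq_combination:
  fixes s :: "nat \<Rightarrow> nat" and a :: "nat \<Rightarrow> 'k"
  assumes s: "strict_mono s" and J: "finite J" "s ` I \<subseteq> J" "J \<inter> range s \<subseteq> s ` I"
  shows "(\<Sum>l\<in>J. smul (if l \<in> range s then a (inv s l) else 0) (x l)) = (\<Sum>i\<in>I. smul (a i) (x (s i)))"
proof -
  have inj: "inj s" using s strict_mono_imp_inj_on by blast
  have "(\<Sum>l\<in>J. smul (if l \<in> range s then a (inv s l) else 0) (x l)) =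
      (\<Sum>l\<in>s ` I. smul (a (inv s l)) (x l))"
    using J by (intro sum.mono_neutral_cong_right) auto
  also have "\<dots> = (\<Sum>i\<in>I. smul (a i) (x (s i)))"
    using inj by (subst sum.reindex) (auto simp: inj_on_def)
  finally show ?thesis .
qed

lemma basis_bound_subseq:
  assumes x: "basis_bound K x" and s: "strict_mono s"
  shows "basis_bound K (x \<circ> s)"
  unfolding basis_bound_def
proof (intro allI impI)
  fix m n :: nat and a :: "nat \<Rightarrow> 'k" assume mn: "m \<le> n"
  define b where "b l = (if l \<in> range s then a (inv s l) else 0)" for l
  have *: "(\<Sum>i<k. smul (a i) ((x \<circ> s) i)) = (\<Sum>l<s k. smul (b l) (x l))" for k
    unfolding b_def comp_def
    by (rule subseq_combination[OF s, symmetric]) (auto simp: strict_mono_less[OF s])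
  have "s m \<le> s n" using s mn by (simp add: strict_mono_less_eq)
  then show "norm (\<Sum>i<m. smul (a i) ((x \<circ> s) i)) \<le> K * norm (\<Sum>i<n. smul (a i) ((x \<circ> s) i))"
    unfolding * using x by (simp add: basis_bound_def)
qed

lemma mazur_basic_subsequence:
  assumes wn: "weakly_null smul x" and low: "m > 0" "\<And>n. m \<le> norm (x n)"
  obtains s where "strict_mono s" "basis_bound 2 (x \<circ> s)"
proof -
  define C where "C k = 2 - (1/2 :: real)^k" for k :: nat
    \<comment> \<open>the \<open>k\<close>-th step loses the factor \<open>C (k + 1) / C k\<close>, so the losses telescope to at most 2\<close>
  have C1: "1 \<le> C k" "C k \<le> 2" for k unfolding C_def by (simp_all add: power_le_one)
  have Cmono: "C k < C (Suc k)" for k unfolding C_def by simp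
  \<comment> \<open>The span of all \<open>x i\<close> with \<open>i \<le> N\<close> contains the
    combinations of the vectors selected so far. Working with it makes the next index depend only on
    \<open>N\<close> and the step number \<open>k\<close>.\<close>
  have "\<exists>n>N. \<forall>a c. norm (\<Sum>i\<le>N. smul (a i) (x i)) \<le> C (Suc k) / C k * norm ((\<Sum>i\<le>N. smul (a i) (x i)) + smul c (x n))" for N k
  proof -
    obtain B where B: "finite B" "\<And>a. (\<Sum>i\<in>{..N}. smul (a i) (x i)) \<in> Real_Vector_Spaces.span B"
      using combinations_in_real_span[of "{..N}" x] by auto
    have "C (Suc k) / C k > 1" using C1(1)[of k] Cmono[of k] by simp
    then have "\<forall>\<^sub>F n in sequentially. n > N \<and> (\<forall>e\<in>Real_Vector_Spaces.span B. \<forall>c.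
        norm e \<le> C (Suc k) / C k * norm (e + smul c (x n)))"
      by (intro eventually_conj eventually_gt_at_top mazur_step[OF wn low B(1)])
    then obtain n where "n > N \<and> (\<forall>e\<in>Real_Vector_Spaces.span B. \<forall>c.
        norm e \<le> C (Suc k) / C k * norm (e + smul c (x n)))"
      using eventually_happens' sequentially_bot by blast
    then show ?thesis using B(2) by (intro exI[of _ n]) auto
  qed
  then have "\<forall>p. \<exists>n. n > fst p \<and> (\<forall>a c. norm (\<Sum>i\<le>fst p. smul (a i) (x i)) \<le>
      C (Suc (snd p)) / C (snd p) * norm ((\<Sum>i\<le>fst p. smul (a i) (x i)) + smul c (x n)))" by auto
  from choice[OF this] obtain nxt where nxt: "\<forall>p. nxt p > fst p \<and> (\<forall>a c. norm (\<Sum>i\<le>fst p. smul (a i) (x i)) \<le>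
      C (Suc (snd p)) / C (snd p) * norm ((\<Sum>i\<le>fst p. smul (a i) (x i)) + smul c (x (nxt p))))" ..
  define s where "s = rec_nat 0 (\<lambda>k N. nxt (N, k))"
  have s_Suc: "s (Suc k) = nxt (s k, k)" for k by (simp add: s_def)
  have mono: "strict_mono s" unfolding strict_mono_Suc_iff s_Suc using nxt by (metis fst_conv)
  have step: "C k * norm (\<Sum>i<Suc k. smul (a i) (x (s i))) \<le> C (Suc k) * norm (\<Sum>i<Suc (Suc k). smul (a i) (x (s i)))" for a k
  proof -
    define b where "b l = (if l \<in> range s then a (inv s l) else 0)" for l
    have eq: "(\<Sum>l\<le>s k. smul (b l) (x l)) = (\<Sum>i<Suc k. smul (a i) (x (s i)))"
      unfolding b_def lessThan_Suc_atMost
      by (rule subseq_combination[OF mono]) (auto simp: strict_mono_less_eq[OF mono])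
    have "norm (\<Sum>l\<le>s k. smul (b l) (x l)) \<le> C (Suc k) / C k * norm ((\<Sum>l\<le>s k. smul (b l) (x l)) + smul (a (Suc k)) (x (nxt (s k, k))))"
      using nxt[rule_format, of "(s k, k)"] by simp
    then show ?thesis unfolding eq s_Suc[symmetric] using C1(1)[of k] by (simp add: field_simps)
  qed
  have "norm (\<Sum>i<m. smul (a i) (x (s i))) \<le> 2 * norm (\<Sum>i<n. smul (a i) (x (s i)))" if mn: "m \<le> n" for m n a
  proof (cases m)
    case (Suc m')
    then obtain n' where n': "n = Suc n'" "m' \<le> n'" using mn by (cases n) auto
    have "norm (\<Sum>i<Suc m'. smul (a i) (x (s i))) \<le> C m' * norm (\<Sum>i<Suc m'. smul (a i) (x (s i)))"
      using mult_right_mono[OF C1(1)[of m'] norm_ge_zero] by simp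
    also have "\<dots> \<le> C n' * norm (\<Sum>i<Suc n'. smul (a i) (x (s i)))"
      by (rule lift_Suc_mono_le[OF _ n'(2)]) (rule step)
    also have "\<dots> \<le> 2 * norm (\<Sum>i<Suc n'. smul (a i) (x (s i)))" by (intro mult_right_mono C1) simp
    finally show ?thesis using Suc n' by simp
  qed simp
  then have "basis_bound 2 (x \<circ> s)" by (simp add: basis_bound_def)
  then show ?thesis using that mono by blast
qed

text \<open>A single term is the difference of two consecutive partial sums, each at most
  \<open>K\<close> times the whole sum in norm, hence the factor 2.\<close>

lemma basis_bound_coefficient:
  assumes x: "basis_bound K x" and K: "K \<ge> 0" and low: "m > 0" "\<And>n. m \<le> norm (x n)" and i: "i < n"
  shows "norm (a i) \<le> 2 * K / m * norm (\<Sum>i<n. smul (a i) (x i))"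
proof -
  let ?P = "\<lambda>k. \<Sum>i<k. smul (a i) (x i)"
  have "norm (a i) * m \<le> norm (smul (a i) (x i))" using low by (simp add: norm_scale mult_left_mono)
  also have "smul (a i) (x i) = ?P (Suc i) - ?P i" by simp
  also have "norm (?P (Suc i) - ?P i) \<le> norm (?P (Suc i)) + norm (?P i)" by (rule norm_triangle_ineq4)
  also have "\<dots> \<le> K * norm (?P n) + K * norm (?P n)"
    using x i unfolding basis_bound_def by (intro add_mono) (auto simp del: sum.lessThan_Suc)
  finally show ?thesis using low(1) by (simp add: field_simps)
qed

lemma basis_bound_coefficient_finite:
  assumes x: "basis_bound K x" and K: "K \<ge> 0" and low: "m > 0" "\<And>n. m \<le> norm (x n)"
    and F: "finite F" "i \<in> F"
  shows "norm (a i) \<le> 2 * K / m * norm (\<Sum>i\<in>F. smul (a i) (x i))"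
proof -
  define b where "b l = (if l \<in> F then a l else 0)" for l
  obtain n where n: "F \<subseteq> {..<n}" using F(1) finite_nat_bounded by blast
  have "(\<Sum>i<n. smul (b i) (x i)) = (\<Sum>i\<in>F. smul (b i) (x i))"
    using n by (intro sum.mono_neutral_right) (auto simp: b_def)
  also have "\<dots> = (\<Sum>i\<in>F. smul (a i) (x i))" by (intro sum.cong) (auto simp: b_def)
  finally show ?thesis using basis_bound_coefficient[OF x K low, of i n b] F n by (auto simp: b_def)
qed

end

text \<open>It serves over both fields: over \<open>'k\<close> for basic sequences, over the reals
  for the orbit of a vector under \<open>S\<close>. Dependence is a notion for sets, so a repeated
  value is treated separately, as a relation between two terms.\<close>

lemma (in vector_space) linear_dependence_of_sequence:
  fixes v :: "nat \<Rightarrow> 'b"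
  assumes B: "finite B" and v: "\<And>i. v i \<in> span B"
  shows "\<exists>r n. (\<Sum>i\<le>n. scale (r i) (v i)) = 0 \<and> (\<exists>i\<le>n. r i \<noteq> 0)"
proof (cases "inj v")
  case False
  then obtain i k where ik: "v i = v k" "i \<noteq> k" by (auto simp: inj_def)
  let ?r = "\<lambda>l. if l = i then 1 else if l = k then - 1 else 0"
  have "(\<Sum>l\<le>max i k. scale (?r l) (v l)) = (\<Sum>l\<in>{i, k}. scale (?r l) (v l))"
    by (rule sum.mono_neutral_right) auto
  also have "\<dots> = 0" using ik by simp
  finally show ?thesis by (intro exI[of _ ?r] exI[of _ "max i k"] conjI exI[of _ i]) simp_all
next
  case True
  have "dependent (range v)"
    using independent_span_bound[OF B, of "range v"] v range_inj_infinite[OF True] by blast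
  then obtain U u where U: "finite U" "U \<subseteq> range v" "\<exists>w\<in>U. u w \<noteq> 0" "(\<Sum>w\<in>U. scale (u w) w) = 0"
    unfolding dependent_explicit by blast
  define F where "F = v -` U"
  have F: "finite F" "v ` F = U" unfolding F_def using finite_vimageI[OF U(1) True] U(2) by auto
  define r where "r i = (if i \<in> F then u (v i) else 0)" for i
  obtain n where n: "F \<subseteq> {..<n}" using F(1) finite_nat_bounded by blast
  have "(\<Sum>i\<le>n. scale (r i) (v i)) = (\<Sum>i\<in>F. scale (u (v i)) (v i))"
    using n by (intro sum.mono_neutral_cong_right) (auto simp: r_def)
  also have "\<dots> = (\<Sum>w\<in>U. scale (u w) w)"
    unfolding F(2)[symmetric] using True by (subst sum.reindex) (auto simp: inj_on_def)
  finally have "(\<Sum>i\<le>n. scale (r i) (v i)) = 0" using U(4) by simp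
  moreover obtain i where "i \<in> F" "u (v i) \<noteq> 0" using U(3) F(2) by blast
  then have "\<exists>i\<le>n. r i \<noteq> 0" using n by (intro exI[of _ i]) (auto simp: r_def)
  ultimately show ?thesis by blast
qed

lemma image_from_one: "x ` {1..} = range (\<lambda>n. x (Suc n))"
proof -
  have "{1..} = range Suc" by (auto simp: image_iff dest: Suc_le_D)
  then show ?thesis by (simp add: image_image)
qed

context banach_space_over
begin

section \<open>From the partial-sum inequality to Schauder expansions\<close>

lemma span_range_partial_sums:
  assumes "w \<in> span (range y)"
  obtains a :: "nat \<Rightarrow> 'k" and N where "\<And>i. i \<ge> N \<Longrightarrow> a i = 0" "w = (\<Sum>i<N. smul (a i) (y i))"
proof -
  define W where "W = {w. \<exists>(a :: nat \<Rightarrow> 'k) N. (\<forall>i\<ge>N. a i = 0) \<and> w = (\<Sum>i<N. smul (a i) (y i))}"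
  have ext: "(\<Sum>i<M. smul (a i) (y i)) = (\<Sum>i<N. smul (a i) (y i))"
    if "\<forall>i\<ge>N. a i = 0" "N \<le> M" for a :: "nat \<Rightarrow> 'k" and N M
    using that by (intro sum.mono_neutral_right) auto
  have "subspace W"
    unfolding subspace_def
  proof (intro conjI ballI allI)
    show "0 \<in> W" unfolding W_def by (intro CollectI exI[of _ "\<lambda>_. 0"] exI[of _ 0]) simp
  next
    fix v w assume "v \<in> W" "w \<in> W"
    then obtain a N b M where v: "\<forall>i\<ge>N. a i = (0::'k)" "v = (\<Sum>i<N. smul (a i) (y i))"
      and w: "\<forall>i\<ge>M. b i = (0::'k)" "w = (\<Sum>i<M. smul (b i) (y i))" unfolding W_def by blast
    have "v + w = (\<Sum>i<max N M. smul (a i + b i) (y i))"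
      unfolding v(2) w(2) using ext[OF v(1), of "max N M"] ext[OF w(1), of "max N M"]
      by (simp add: scale_left_distrib sum.distrib)
    then show "v + w \<in> W" unfolding W_def using v(1) w(1)
      by (intro CollectI exI[of _ "\<lambda>i. a i + b i"] exI[of _ "max N M"]) auto
  next
    fix c v assume "v \<in> W"
    then obtain a N where v: "\<forall>i\<ge>N. a i = (0::'k)" "v = (\<Sum>i<N. smul (a i) (y i))" unfolding W_def by blast
    then show "smul c v \<in> W" unfolding W_def
      by (intro CollectI exI[of _ "\<lambda>i. c * a i"] exI[of _ N]) (auto simp: scale_sum_right)
  qed
  moreover have "range y \<subseteq> W"
  proof
    fix v assume "v \<in> range y"
    then obtain k where k: "v = y k" by blast
    have "(\<Sum>i<Suc k. smul (if i = k then 1 else 0) (y i)) = y k" by simp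
    then show "v \<in> W" unfolding W_def k
      by (intro CollectI exI[of _ "\<lambda>i. if i = k then 1 else 0"] exI[of _ "Suc k"]) auto
  qed
  ultimately have "span (range y) \<subseteq> W" by (rule span_minimal[rotated])
  then have "w \<in> W" using assms by blast
  then show ?thesis using that unfolding W_def by blast
qed

text \<open>Finite combinations \<open>w k\<close> approximate \<open>z\<close>. Their coefficients
  converge in \<open>k\<close>, and their partial sums depend on \<open>w k\<close> in a Lipschitz
  way, with the constant \<open>K\<close> for all lengths \<open>n\<close> at once. This uniformity
  lets the limits in \<open>k\<close> and \<open>n\<close> be interchanged. Uniqueness follows from
  the coefficient bound applied to a difference of two expansions.\<close>

lemma basis_bound_expansion:
  assumes y: "basis_bound K y" and K: "K \<ge> 0" and low: "m > 0" "\<And>n. m \<le> norm (y n)"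
    and z: "z \<in> closure (span (range y))"
  shows "\<exists>!a. (\<lambda>n. smul (a n) (y n)) sums z"
proof -
  interpret smul: bounded_bilinear smul by (rule bilinear_smul)
  obtain w where w: "\<And>k. w k \<in> span (range y)" "w \<longlonglongrightarrow> z"
    using z unfolding closure_sequential by blast
  have "\<exists>p. (\<forall>i\<ge>snd p. fst p i = 0) \<and> w k = (\<Sum>i<snd p. smul (fst p i) (y i))" for k
  proof -
    obtain a N where "\<And>i. i \<ge> N \<Longrightarrow> a i = (0::'k)" "w k = (\<Sum>i<N. smul (a i) (y i))"
      by (rule span_range_partial_sums[OF w(1)[of k]]) blast
    then show ?thesis by (intro exI[of _ "(a, N)"]) simp
  qed
  then have "\<forall>k. \<exists>p. (\<forall>i\<ge>snd p. fst p i = 0) \<and> w k = (\<Sum>i<snd p. smul (fst p i) (y i))" ..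
  from choice[OF this] obtain p where
    p: "\<forall>k. (\<forall>i\<ge>snd (p k). fst (p k) i = 0) \<and> w k = (\<Sum>i<snd (p k). smul (fst (p k) i) (y i))" ..
  define b where "b k = fst (p k)" for k
  define N where "N k = snd (p k)" for k
  have b0: "b k i = 0" if "i \<ge> N k" for k i using p that by (simp add: b_def N_def)
  have wk: "w k = (\<Sum>i<n. smul (b k i) (y i))" if "n \<ge> N k" for k n
  proof -
    have "w k = (\<Sum>i<N k. smul (b k i) (y i))" using p by (simp add: b_def N_def)
    also have "\<dots> = (\<Sum>i<n. smul (b k i) (y i))" using that b0 by (intro sum.mono_neutral_left) auto
    finally show ?thesis .
  qed
  have diff: "w k - w l = (\<Sum>i<n. smul (b k i - b l i) (y i))" if "n \<ge> N k" "n \<ge> N l" for k l n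
    using wk that by (simp add: scale_left_diff_distrib sum_subtractf)
  define P where "P n k = (\<Sum>i<n. smul (b k i) (y i))" for n k
  have PP: "norm (P n k - P n l) \<le> K * norm (w k - w l)" for n k l
  proof -
    let ?M = "max n (max (N k) (N l))"
    have "P n k - P n l = (\<Sum>i<n. smul (b k i - b l i) (y i))"
      unfolding P_def by (simp add: scale_left_diff_distrib sum_subtractf)
    also have "norm \<dots> \<le> K * norm (\<Sum>i<?M. smul (b k i - b l i) (y i))"
      using y unfolding basis_bound_def by (meson max.cobounded1)
    also have "(\<Sum>i<?M. smul (b k i - b l i) (y i)) = w k - w l" by (subst diff[of k ?M l]) auto
    finally show ?thesis .
  qed
  have cc: "norm (b k i - b l i) \<le> 2 * K / m * norm (w k - w l)" for k l i
  proof -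
    let ?M = "max (Suc i) (max (N k) (N l))"
    have "norm (b k i - b l i) \<le> 2 * K / m * norm (\<Sum>i<?M. smul (b k i - b l i) (y i))"
      by (rule basis_bound_coefficient[OF y K low]) simp
    also have "(\<Sum>i<?M. smul (b k i - b l i) (y i)) = w k - w l" by (subst diff[of k ?M l]) auto
    finally show ?thesis .
  qed
  have "\<exists>a. (\<lambda>k. b k i) \<longlonglongrightarrow> a" for i
  proof -
    have "Cauchy (\<lambda>k. b k i)"
    proof (rule CauchyI)
      fix e :: real assume e: "e > 0"
      \<comment> \<open>The summand 1 keeps \<open>D\<close> positive when \<open>K = 0\<close>, so
        that \<open>e / D\<close> is a legitimate accuracy.\<close>
      define D where "D = 2 * K / m + 1"
      have D: "D > 0" "2 * K / m \<le> D" unfolding D_def using K low(1) by (simp_all add: add_nonneg_pos)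
      have "Cauchy w" using w(2) LIMSEQ_imp_Cauchy by blast
      then obtain M where M: "\<forall>k\<ge>M. \<forall>l\<ge>M. norm (w k - w l) < e / D"
        using CauchyD[of w "e / D"] e D(1) by auto
      have "norm (b k i - b l i) < e" if "k \<ge> M" "l \<ge> M" for k l
      proof -
        have "norm (b k i - b l i) \<le> D * norm (w k - w l)"
          using cc[of k i l] mult_right_mono[OF D(2) norm_ge_zero[of "w k - w l"]] by linarith
        also have "\<dots> < D * (e / D)" using M that D(1) by (intro mult_strict_left_mono) auto
        finally show ?thesis using D(1) by simp
      qed
      then show "\<exists>M. \<forall>k\<ge>M. \<forall>l\<ge>M. norm (b k i - b l i) < e" by blast
    qed
    then show ?thesis using Cauchy_scalars_convergent unfolding convergent_def by blast
  qed
  then have "\<forall>i. \<exists>a. (\<lambda>k. b k i) \<longlonglongrightarrow> a" ..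
  from choice[OF this] obtain a where a: "\<forall>i. (\<lambda>k. b k i) \<longlonglongrightarrow> a i" ..
  define Q where "Q n = (\<Sum>i<n. smul (a i) (y i))" for n
  have PQ: "norm (P n k - Q n) \<le> K * norm (w k - z)" for n k
  proof (rule LIMSEQ_le)
    show "(\<lambda>l. norm (P n k - P n l)) \<longlonglongrightarrow> norm (P n k - Q n)"
      unfolding P_def Q_def using a by (intro tendsto_norm tendsto_diff tendsto_const tendsto_sum smul.tendsto) auto
    show "(\<lambda>l. K * norm (w k - w l)) \<longlonglongrightarrow> K * norm (w k - z)"
      by (intro tendsto_intros w(2))
  qed (use PP in auto)
  have "Q \<longlonglongrightarrow> z"
  proof (rule LIMSEQ_I)
    fix e :: real assume e: "e > 0"
    have "(\<lambda>k. (K + 1) * norm (w k - z)) \<longlonglongrightarrow> (K + 1) * norm (z - z)" by (intro tendsto_intros w(2))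
    then have "\<forall>\<^sub>F k in sequentially. (K + 1) * norm (w k - z) < e"
      using e by (intro order_tendstoD(2)[of _ "(K + 1) * norm (z - z)"]) auto
    then obtain k where k: "(K + 1) * norm (w k - z) < e" using eventually_happens' sequentially_bot by blast
    have "norm (Q n - z) < e" if n: "n \<ge> N k" for n
    proof -
      have "P n k = w k" using wk[OF n] by (simp add: P_def)
      then have "norm (Q n - w k) \<le> K * norm (w k - z)" using PQ[of n k] by (simp add: norm_minus_commute)
      moreover have "norm (Q n - z) \<le> norm (Q n - w k) + norm (w k - z)"
        using norm_triangle_ineq[of "Q n - w k" "w k - z"] by simp
      ultimately show ?thesis using k by (simp add: algebra_simps)
    qed
    then show "\<exists>no. \<forall>n\<ge>no. norm (Q n - z) < e" by blast
  qed
  then have "(\<lambda>n. smul (a n) (y n)) sums z" by (simp add: sums_def Q_def[abs_def])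
  moreover have "c = d" if cd: "(\<lambda>n. smul (c n) (y n)) sums z" "(\<lambda>n. smul (d n) (y n)) sums z" for c d
  proof
    fix i
    have "(\<lambda>n. smul (c n - d n) (y n)) sums (z - z)"
      using sums_diff[OF cd] by (simp add: scale_left_diff_distrib)
    then have "(\<lambda>n. \<Sum>i<n. smul (c i - d i) (y i)) \<longlonglongrightarrow> 0" by (simp add: sums_def)
    then have "(\<lambda>n. 2 * K / m * norm (\<Sum>i<n. smul (c i - d i) (y i))) \<longlonglongrightarrow> 2 * K / m * norm (0 :: 'a)"
      by (intro tendsto_mult tendsto_const tendsto_norm)
    then have lim: "(\<lambda>n. 2 * K / m * norm (\<Sum>i<n. smul (c i - d i) (y i))) \<longlonglongrightarrow> 0" by simp
    have "norm (c i - d i) \<le> 0"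
    proof (rule LIMSEQ_le_const[OF lim], intro exI[of _ "Suc i"] allI impI)
      fix n assume "Suc i \<le> n"
      then show "norm (c i - d i) \<le> 2 * K / m * norm (\<Sum>i<n. smul (c i - d i) (y i))"
        by (intro basis_bound_coefficient[OF y K low]) simp
    qed
    then show "c i = d i" by simp
  qed
  ultimately show ?thesis by blast
qed

lemma basis_bound_basic_sequence:
  assumes x: "basis_bound K x" and K: "K \<ge> 0" and low: "m > 0" "\<And>n. m \<le> norm (x n)"
  shows "basic_sequence smul x"
proof -
  have "basis_bound K (x \<circ> Suc)" using basis_bound_subseq[OF x] by (simp add: strict_mono_def)
  moreover have "x ` {1..} = range (x \<circ> Suc)"
    by (simp only: image_from_one comp_def)
  ultimately show ?thesis unfolding basic_sequence_def
    using basis_bound_expansion[of K "x \<circ> Suc" m] K low by (auto simp: comp_def)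
qed

text \<open>A nontrivial finite relation would be a second expansion of 0.\<close>

lemma basic_sequence_independent:
  assumes x: "basic_sequence smul x"
  shows "infinite_dimensional smul (span (x ` {1..}))"
proof -
  define y where "y n = x (Suc n)" for n
  have ran: "x ` {1..} = range y" unfolding y_def by (rule image_from_one)
  have "0 \<in> closure (span (x ` {1..}))" using span_zero closure_subset by blast
  then have "\<exists>!a. (\<lambda>n. smul (a n) (y n)) sums 0" using x unfolding basic_sequence_def y_def by blast
  then have uniq: "a = b" if "(\<lambda>n. smul (a n) (y n)) sums 0" "(\<lambda>n. smul (b n) (y n)) sums 0" for a b
    using that by blast
  have zero: "a i = 0" if fin: "finite F" and a: "\<And>i. i \<notin> F \<Longrightarrow> a i = 0" "(\<Sum>i\<in>F. smul (a i) (y i)) = 0" for a F i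
  proof -
    have "(\<lambda>n. smul (a n) (y n)) sums (\<Sum>i\<in>F. smul (a i) (y i))" by (rule sums_finite[OF fin]) (simp add: a)
    then have "(\<lambda>n. smul (a n) (y n)) sums 0" by (simp only: a(2))
    moreover have "(\<lambda>n. smul ((\<lambda>_. 0) n) (y n)) sums 0" by simp
    ultimately have "a = (\<lambda>_. 0)" by (rule uniq)
    then show ?thesis by simp
  qed
  have False if B: "finite B" "range y \<subseteq> span B" for B
  proof -
    have "y i \<in> span B" for i using B(2) by blast
    then obtain r n where "(\<Sum>i\<le>n. smul (r i) (y i)) = 0" "\<exists>i\<le>n. r i \<noteq> 0"
      using linear_dependence_of_sequence[OF B(1)] by meson
    moreover have "(\<Sum>i\<le>n. smul (if i \<le> n then r i else 0) (y i)) = (\<Sum>i\<le>n. smul (r i) (y i))"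
      by (rule sum.cong) simp_all
    ultimately show False using zero[of "{..n}" "\<lambda>i. if i \<le> n then r i else 0"] by (metis atMost_iff finite_atMost)
  qed
  then show ?thesis unfolding infinite_dimensional_def ran using span_superset by blast
qed

text \<open>A partial sum is at most \<open>M\<close> times the sum of the moduli of its
  coefficients, which only grows with the length and is controlled by the lower estimate.\<close>

lemma l1_basis_bound:
  assumes M: "\<And>n. norm (x n) \<le> M" and d: "\<delta> > 0"
    and low: "\<And>n a. \<delta> * (\<Sum>i<n. norm (a i)) \<le> norm (\<Sum>i<n. smul (a i) (x i))"
  shows "basis_bound (M / \<delta>) x"
  unfolding basis_bound_def
proof (intro allI impI)
  fix k n :: nat and a :: "nat \<Rightarrow> 'k" assume kn: "k \<le> n"
  have M0: "M \<ge> 0" using M[of 0] norm_ge_zero[of "x 0"] by linarith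
  have "norm (\<Sum>i<k. smul (a i) (x i)) \<le> (\<Sum>i<k. norm (a i) * M)"
    by (rule sum_norm_le) (simp add: norm_scale M mult_left_mono)
  also have "\<dots> \<le> (\<Sum>i<n. norm (a i) * M)" using kn M0 by (intro sum_mono2) auto
  also have "\<dots> = (\<Sum>i<n. norm (a i)) * M" by (rule sum_distrib_right[symmetric])
  also have "\<dots> = M / \<delta> * (\<delta> * (\<Sum>i<n. norm (a i)))" using d by simp
  also have "\<dots> \<le> M / \<delta> * norm (\<Sum>i<n. smul (a i) (x i))" using M0 d low by (intro mult_left_mono) auto
  finally show "norm (\<Sum>i<k. smul (a i) (x i)) \<le> M / \<delta> * norm (\<Sum>i<n. smul (a i) (x i))" .
qed

end

section \<open>Rosenthal's theorem\<close>

text \<open>Compactness gives one cluster point. Since the sequence does not converge to it, some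
  subsequence stays away from it and clusters elsewhere.\<close>

lemma two_cluster_points:
  fixes c :: "nat \<Rightarrow> 'k::real_or_complex"
  assumes b: "\<And>n. norm (c n) \<le> M" and nc: "\<not> convergent c"
  obtains l l' where "l \<noteq> l'" "\<And>e N. e > 0 \<Longrightarrow> \<exists>n\<ge>N. norm (c n - l) < e"
    "\<And>e N. e > 0 \<Longrightarrow> \<exists>n\<ge>N. norm (c n - l') < e"
proof -
  have cluster: "\<exists>n\<ge>N. norm (c n - l) < e" if r: "strict_mono (r :: nat \<Rightarrow> nat)" "(\<lambda>n. c (r n)) \<longlonglongrightarrow> l" and e: "e > 0" for r l e N
  proof -
    obtain n0 where "\<forall>n\<ge>n0. norm (c (r n) - l) < e" using LIMSEQ_D[OF r(2) e] by blast
    then have "norm (c (r (max N n0)) - l) < e" by simp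
    moreover have "N \<le> r (max N n0)" using seq_suble[OF r(1), of "max N n0"] by simp
    ultimately show ?thesis by blast
  qed
  obtain l r where r: "strict_mono (r :: nat \<Rightarrow> nat)" "(\<lambda>n. c (r n)) \<longlonglongrightarrow> l"
    by (rule bounded_scalars_convergent_subseq[OF b])
  have "\<not> c \<longlonglongrightarrow> l" using nc convergentI by blast
  then obtain e where e: "e > 0" "\<not> (\<exists>no. \<forall>n\<ge>no. norm (c n - l) < e)" unfolding LIMSEQ_iff by blast
  then have "\<not> eventually (\<lambda>n. norm (c n - l) < e) sequentially" by (simp add: eventually_sequentially)
  from not_eventually_sequentiallyD[OF this] obtain s :: "nat \<Rightarrow> nat"
    where s: "strict_mono s" "\<forall>n. \<not> norm (c (s n) - l) < e" by blast
  obtain l' t where t: "strict_mono (t :: nat \<Rightarrow> nat)" "(\<lambda>n. c (s (t n))) \<longlonglongrightarrow> l'"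
    by (rule bounded_scalars_convergent_subseq[OF b])
  have "(\<lambda>n. norm (c (s (t n)) - l)) \<longlonglongrightarrow> norm (l' - l)" by (intro tendsto_norm tendsto_diff t tendsto_const)
  then have "e \<le> norm (l' - l)" using s(2) by (intro LIMSEQ_le_const) (auto simp: not_less)
  then have "l \<noteq> l'" using e(1) by auto
  moreover have "strict_mono (\<lambda>n. s (t n))" using strict_mono_o[OF s(1) t(1)] by (simp add: comp_def)
  ultimately show ?thesis using that[OF _ cluster[OF r] cluster[of "\<lambda>n. s (t n)" l', OF _ t(2)]] by simp
qed

text \<open>Galvin's lemma produces alternating patterns only. Inserting points \<open>e (2 i)\<close> where needed turns
  an arbitrary pattern on the points \<open>e (2 i + 1)\<close> into a part of an alternating one.\<close>

lemma adjust_parities: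
  assumes e: "strict_mono (e :: nat \<Rightarrow> nat)"
  shows "\<exists>F. finite F \<and> F \<subseteq> range e \<and> F \<subseteq> {..<e (2 * n)} \<and>
    (\<forall>i<n. e (2 * i + 1) \<in> F \<and> (even (card (F \<inter> {..<e (2 * i + 1)})) \<longleftrightarrow> \<sigma> i))"
proof (induction n)
  case 0
  show ?case by (intro exI[of _ "{}"]) simp
next
  case (Suc n)
  then obtain F where F: "finite F" "F \<subseteq> range e" "F \<subseteq> {..<e (2 * n)}"
    "\<forall>i<n. e (2 * i + 1) \<in> F \<and> (even (card (F \<inter> {..<e (2 * i + 1)})) \<longleftrightarrow> \<sigma> i)" by blast
  \<comment> \<open>All points of \<open>F\<close> precede \<open>e (2 * n)\<close>, so adding that
    point flips the parity of the number of points before \<open>e (2 * n + 1)\<close>.\<close>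
  define E where "E = (if even (card F) \<longleftrightarrow> \<sigma> n then {} else {e (2 * n)})"
  define F' where "F' = insert (e (2 * n + 1)) (E \<union> F)"
  have less: "e i < e k \<longleftrightarrow> i < k" for i k using strict_mono_less[OF e] .
  have nF: "e (2 * n) \<notin> F" using F(3) by blast
  have "F' \<inter> {..<e (2 * i + 1)} = F \<inter> {..<e (2 * i + 1)}" if "i < n" for i
    unfolding F'_def E_def using that by (auto simp: less)
  then have old: "\<forall>i<n. e (2 * i + 1) \<in> F' \<and> (even (card (F' \<inter> {..<e (2 * i + 1)})) \<longleftrightarrow> \<sigma> i)"
    using F(4) unfolding F'_def by simp
  have sub: "F \<subseteq> {..<e (2 * n + 1)}"
    using F(3) less[of "2 * n" "2 * n + 1"] by (auto dest: subsetD intro: less_trans)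
  have "F' \<inter> {..<e (2 * n + 1)} = E \<union> F"
    unfolding F'_def E_def using sub less[of "2 * n" "2 * n + 1"] by auto
  moreover have "even (card (E \<union> F)) \<longleftrightarrow> \<sigma> n"
    unfolding E_def using nF F(1) by simp
  ultimately have new: "e (2 * n + 1) \<in> F' \<and> (even (card (F' \<inter> {..<e (2 * n + 1)})) \<longleftrightarrow> \<sigma> n)"
    by (simp add: F'_def)
  have "finite F'" "F' \<subseteq> range e" unfolding F'_def E_def using F(1,2) by auto
  moreover have "F' \<subseteq> {..<e (2 * Suc n)}"
    unfolding F'_def E_def using sub less[of "2 * n" "2 * Suc n"] less[of "2 * n + 1" "2 * Suc n"]
    by (auto dest: subsetD intro: less_trans)
  moreover have "\<forall>i<Suc n. e (2 * i + 1) \<in> F' \<and> (even (card (F' \<inter> {..<e (2 * i + 1)})) \<longleftrightarrow> \<sigma> i)"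
    using old new by (auto simp: less_Suc_eq)
  ultimately show ?case by blast
qed

text \<open>Galvin's lemma is applied to the finite sets on which no member of \<open>B\<close>
  alternates between \<open>f\<close> and \<open>g\<close>. If an infinite \<open>M\<close> contains
  no such set, parity adjustment turns alternation into arbitrary patterns on every other point of
  \<open>M\<close>. The other alternative is impossible: a member of \<open>B\<close> oscillating
  along \<open>M\<close> alternates on some infinite subset, hence on all initial segments of
  it.\<close>

lemma independent_subsequence:
  fixes f :: "'f \<Rightarrow> nat \<Rightarrow> bool" and g :: "'f \<Rightarrow> nat \<Rightarrow> bool"
  assumes osc: "\<And>r :: nat \<Rightarrow> nat. strict_mono r \<Longrightarrow>
    \<exists>\<phi>\<in>B. \<forall>N. (\<exists>n\<ge>N. f \<phi> (r n)) \<and> (\<exists>n\<ge>N. g \<phi> (r n))"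
  obtains m :: "nat \<Rightarrow> nat" where "strict_mono m"
    "\<And>n \<sigma>. \<exists>\<phi>\<in>B. \<forall>i<n. if \<sigma> i then f \<phi> (m i) else g \<phi> (m i)"
proof -
  define alt where "alt F \<longleftrightarrow> (\<exists>\<phi>\<in>B. \<forall>n\<in>F. if even (card (F \<inter> {..<n})) then f \<phi> n else g \<phi> n)" for F
  show ?thesis
  proof (rule galvin[of "\<lambda>F. \<not> alt F"])
    fix M assume M: "infinite M" "\<And>s. finite s \<Longrightarrow> s \<subseteq> M \<Longrightarrow> \<not> \<not> alt s"
    define e where "e = enumerate M"
    have e: "strict_mono e" "range e = M" unfolding e_def using M(1) by (auto simp: strict_mono_enumerate range_enumerate)
    have "strict_mono (\<lambda>i. e (2 * i + 1))" using e(1) by (simp add: strict_mono_def)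
    moreover have "\<exists>\<phi>\<in>B. \<forall>i<n. if \<sigma> i then f \<phi> (e (2 * i + 1)) else g \<phi> (e (2 * i + 1))" for n \<sigma>
    proof -
      obtain F where F: "finite F" "F \<subseteq> range e"
        "\<forall>i<n. e (2 * i + 1) \<in> F \<and> (even (card (F \<inter> {..<e (2 * i + 1)})) \<longleftrightarrow> \<sigma> i)"
        using adjust_parities[OF e(1), of n \<sigma>] by blast
      then obtain \<phi> where "\<phi> \<in> B" "\<forall>n\<in>F. if even (card (F \<inter> {..<n})) then f \<phi> n else g \<phi> n"
        using M(2)[of F] e(2) unfolding alt_def by blast
      then show ?thesis using F(3) by (intro bexI[of _ \<phi>]) auto
    qed
    ultimately show thesis by (rule that)
  next
    fix M assume M: "infinite M" "\<And>N. N \<subseteq> M \<Longrightarrow> infinite N \<Longrightarrow> \<exists>k. \<not> alt (N \<inter> {..<k})"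
    define e where "e = enumerate M"
    have e: "strict_mono e" "range e = M" unfolding e_def using M(1) by (auto simp: strict_mono_enumerate range_enumerate)
    obtain \<phi> where \<phi>: "\<phi> \<in> B" "\<forall>N. (\<exists>n\<ge>N. f \<phi> (e n)) \<and> (\<exists>n\<ge>N. g \<phi> (e n))" using osc[OF e(1)] by blast
    have "\<exists>m. m \<in> M \<and> snd p \<le> m \<and> (if fst p then f \<phi> m else g \<phi> m)" for p :: "bool \<times> nat"
    proof -
      have "\<exists>n\<ge>snd p. if fst p then f \<phi> (e n) else g \<phi> (e n)"
        using \<phi>(2)[rule_format, of "snd p"] by (cases "fst p") simp_all
      then obtain n where n: "n \<ge> snd p" "if fst p then f \<phi> (e n) else g \<phi> (e n)" by blast
      moreover have "snd p \<le> e n" using seq_suble[OF e(1), of n] n(1) by simp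
      ultimately show ?thesis using e(2) by (intro exI[of _ "e n"]) auto
    qed
    then have "\<forall>p::bool \<times> nat. \<exists>m. m \<in> M \<and> snd p \<le> m \<and> (if fst p then f \<phi> m else g \<phi> m)" ..
    from choice[OF this] obtain pk where
      pk: "\<forall>p::bool \<times> nat. pk p \<in> M \<and> snd p \<le> pk p \<and> (if fst p then f \<phi> (pk p) else g \<phi> (pk p))" ..
    define n where "n = rec_nat (pk (True, 0)) (\<lambda>i k. pk (even (Suc i), Suc k))"
    have n0: "n 0 = pk (True, 0)" and nS: "n (Suc i) = pk (even (Suc i), Suc (n i))" for i by (simp_all add: n_def)
    have mono: "strict_mono n"
      unfolding strict_mono_Suc_iff nS using pk by (metis Suc_le_lessD snd_conv)
    have nM: "n i \<in> M" for i using pk by (cases i) (simp_all add: n0 nS)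
    have nf: "if even i then f \<phi> (n i) else g \<phi> (n i)" for i
    proof (cases i)
      case 0
      then show ?thesis using pk[rule_format, of "(True, 0)"] by (simp add: n0)
    next
      case (Suc j)
      have "if even (Suc j) then f \<phi> (pk (even (Suc j), Suc (n j))) else g \<phi> (pk (even (Suc j), Suc (n j)))"
        using pk[rule_format, of "(even (Suc j), Suc (n j))"] unfolding fst_conv by blast
      then show ?thesis unfolding Suc nS .
    qed
    \<comment> \<open>The point \<open>n i\<close> has exactly \<open>i\<close> predecessors in an
      initial segment containing it, so the parity used in \<open>alt\<close> is that of
      \<open>i\<close>.\<close>
    have card: "card (range n \<inter> {..<k} \<inter> {..<n i}) = i" if "n i < k" for i k
    proof -
      have "range n \<inter> {..<k} \<inter> {..<n i} = n ` {..<i}"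
        using that strict_mono_less[OF mono] by (auto simp: image_iff intro: less_trans[of _ "n i" k])
      then show ?thesis using strict_mono_imp_inj_on[OF mono] by (simp add: card_image inj_on_subset)
    qed
    have "infinite (range n)" using strict_mono_imp_inj_on[OF mono] range_inj_infinite by blast
    moreover have "range n \<subseteq> M" using nM by blast
    ultimately obtain k where k: "\<not> alt (range n \<inter> {..<k})" using M(2) by blast
    have "alt (range n \<inter> {..<k})"
      unfolding alt_def
    proof (rule bexI[OF _ \<phi>(1)], rule ballI)
      fix m assume "m \<in> range n \<inter> {..<k}"
      then obtain i where "m = n i" "n i < k" by blast
      then show "if even (card (range n \<inter> {..<k} \<inter> {..<m})) then f \<phi> m else g \<phi> m"
        using nf[of i] card[of i k] by simp
    qed
    then show thesis using k by blast
  qed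
qed

context banach_space_over
begin

section \<open>Functionals of the dual ball and l1-subsequences\<close>

definition dual_ball :: "('a \<Rightarrow> 'k) set" where
  "dual_ball = {\<phi> \<in> dual_space smul. \<forall>x. norm (\<phi> x) \<le> norm x}"

lemma dual_space_scaled_ball:
  assumes "\<phi> \<in> dual_space smul"
  obtains \<psi> c where "\<psi> \<in> dual_ball" "\<And>x. \<phi> x = c * \<psi> x"
proof -
  have bl: "bounded_linear \<phi>" and sm: "\<And>c x. \<phi> (smul c x) = c * \<phi> x" using assms by (auto simp: dual_space_def)
  obtain K where K: "\<And>x. norm (\<phi> x) \<le> norm x * K" using bounded_linear.bounded[OF bl] by blast
  define d where "d = \<bar>K\<bar> + 1"
  have d: "d > 0" "K \<le> d" unfolding d_def by linarith+
  define \<psi> where "\<psi> x = of_real (inverse d) * \<phi> x" for x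
  have "norm (\<psi> x) \<le> norm x" for x
  proof -
    have "norm (\<phi> x) \<le> norm x * d" using K[of x] mult_left_mono[OF d(2) norm_ge_zero[of x]] by linarith
    then have "inverse d * norm (\<phi> x) \<le> inverse d * (norm x * d)" using d(1) by (intro mult_left_mono) auto
    moreover have "norm (\<psi> x) = inverse d * norm (\<phi> x)"
      unfolding \<psi>_def norm_mult norm_of_real using d(1) by simp
    moreover have "inverse d * (norm x * d) = norm x" using d(1) by simp
    ultimately show ?thesis by linarith
  qed
  moreover have "bounded_linear \<psi>" unfolding \<psi>_def by (rule bounded_linear_compose[OF bounded_linear_mult_right bl])
  ultimately have "\<psi> \<in> dual_ball" unfolding dual_ball_def dual_space_def by (simp add: \<psi>_def sm)
  moreover have "\<phi> x = of_real d * \<psi> x" for x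
    unfolding \<psi>_def using d(1) by (simp flip: mult.assoc of_real_mult)
  ultimately show ?thesis by (rule that)
qed

text \<open>Small discs around \<open>p\<close> and \<open>q\<close> replace the half-lines of the real case (Dor's argument), which
  makes the estimate insensitive to the scalar field.\<close>

lemma l1_lower_bound:
  fixes z :: "nat \<Rightarrow> 'a" and p q :: 'k
  assumes ind: "\<And>n \<sigma>. \<exists>\<phi>\<in>dual_ball. \<forall>i<n. if \<sigma> i then norm (\<phi> (z i) - p) < norm (p - q) / 16 else norm (\<phi> (z i) - q) < norm (p - q) / 16"
  shows "norm (p - q) / 16 * (\<Sum>i<n. norm (a i)) \<le> norm (\<Sum>i<n. smul (a i) (z i))"
proof -
  define \<rho> where "\<rho> = norm (p - q)"
  obtain \<epsilon> where e: "\<forall>i. \<epsilon> i = (1::'k) \<or> \<epsilon> i = - 1" "(\<Sum>i<n. norm (a i)) \<le> 4 * norm (\<Sum>i<n. \<epsilon> i * a i)"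
    using exists_signs[OF finite_lessThan, of a n] by (elim exE conjE) (rule that)
  obtain \<phi> where \<phi>: "\<phi> \<in> dual_ball"
    "\<forall>i<n. if \<epsilon> i = 1 then norm (\<phi> (z i) - p) < \<rho> / 16 else norm (\<phi> (z i) - q) < \<rho> / 16"
    using ind[of n "\<lambda>i. \<epsilon> i = 1"] unfolding \<rho>_def by blast
  obtain \<psi> where \<psi>: "\<psi> \<in> dual_ball"
    "\<forall>i<n. if \<not> \<epsilon> i = 1 then norm (\<psi> (z i) - p) < \<rho> / 16 else norm (\<psi> (z i) - q) < \<rho> / 16"
    using ind[of n "\<lambda>i. \<not> \<epsilon> i = 1"] unfolding \<rho>_def by blast
  \<comment> \<open>Opposite patterns for \<open>\<phi>\<close> and \<open>\<psi>\<close> bring the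
    difference of their values at \<open>z i\<close> close to \<open>\<epsilon> i * (p - q)\<close>;
    two discs of radius \<open>\<rho> / 16\<close> leave an error of at most
    \<open>\<rho> / 8\<close>.\<close>
  define err where "err i = \<phi> (z i) - \<psi> (z i) - \<epsilon> i * (p - q)" for i
  have err: "norm (err i) \<le> \<rho> / 8" if "i < n" for i
  proof (cases "\<epsilon> i = 1")
    case True
    have "err i = (\<phi> (z i) - p) - (\<psi> (z i) - q)" unfolding err_def True by (simp add: algebra_simps)
    then have "norm (err i) \<le> norm (\<phi> (z i) - p) + norm (\<psi> (z i) - q)" by (simp only: norm_triangle_ineq4)
    then show ?thesis using \<phi>(2) \<psi>(2) that True by fastforce
  next
    case False
    then have "\<epsilon> i = - 1" using e(1) by blast
    then have "err i = (\<phi> (z i) - q) - (\<psi> (z i) - p)" unfolding err_def by (simp add: algebra_simps)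
    then have "norm (err i) \<le> norm (\<phi> (z i) - q) + norm (\<psi> (z i) - p)" by (simp only: norm_triangle_ineq4)
    then show ?thesis using \<phi>(2) \<psi>(2) that False by fastforce
  qed
  define w where "w = (\<Sum>i<n. smul (a i) (z i))"
  have ball: "norm (\<theta> w) \<le> norm w" "\<theta> w = (\<Sum>i<n. a i * \<theta> (z i))" if "\<theta> \<in> dual_ball" for \<theta>
  proof -
    show "norm (\<theta> w) \<le> norm w" using that by (simp add: dual_ball_def)
    have "linear \<theta>" "\<And>c x. \<theta> (smul c x) = c * \<theta> x"
      using that by (auto simp: dual_ball_def dual_space_def bounded_linear.linear)
    then show "\<theta> w = (\<Sum>i<n. a i * \<theta> (z i))" unfolding w_def by (simp add: linear_sum)
  qed
  have "\<phi> w - \<psi> w = (\<Sum>i<n. a i * (\<epsilon> i * (p - q) + err i))"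
    unfolding ball(2)[OF \<phi>(1)] ball(2)[OF \<psi>(1)] sum_subtractf[symmetric]
    by (rule sum.cong) (simp_all add: err_def right_diff_distrib)
  also have "\<dots> = (p - q) * (\<Sum>i<n. \<epsilon> i * a i) + (\<Sum>i<n. a i * err i)"
    by (simp add: distrib_left sum.distrib sum_distrib_left mult_ac)
  finally have eq: "(p - q) * (\<Sum>i<n. \<epsilon> i * a i) = (\<phi> w - \<psi> w) - (\<Sum>i<n. a i * err i)" by simp
  have "norm (\<Sum>i<n. a i * err i) \<le> (\<Sum>i<n. norm (a i) * (\<rho> / 8))"
    by (rule sum_norm_le, unfold norm_mult, rule mult_left_mono[OF err norm_ge_zero]) simp
  then have s: "norm (\<Sum>i<n. a i * err i) \<le> (\<Sum>i<n. norm (a i)) * (\<rho> / 8)" by (simp only: sum_distrib_right)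
  \<comment> \<open>The signs contribute \<open>\<rho> / 4\<close> times the sum of moduli, the
    errors take back \<open>\<rho> / 8\<close>, and the two functionals are bounded by
    \<open>2 * norm w\<close> together; halving leaves \<open>\<rho> / 16\<close>.\<close>
  have "\<rho> * ((\<Sum>i<n. norm (a i)) / 4) \<le> \<rho> * norm (\<Sum>i<n. \<epsilon> i * a i)"
    using e(2) by (intro mult_left_mono) (auto simp: \<rho>_def)
  also have "\<dots> = norm ((p - q) * (\<Sum>i<n. \<epsilon> i * a i))" unfolding norm_mult \<rho>_def ..
  also have "\<dots> \<le> norm (\<phi> w - \<psi> w) + norm (\<Sum>i<n. a i * err i)" unfolding eq by (rule norm_triangle_ineq4)
  also have "\<dots> \<le> (norm w + norm w) + (\<Sum>i<n. norm (a i)) * (\<rho> / 8)"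
    using norm_triangle_ineq4[of "\<phi> w" "\<psi> w"] ball(1)[OF \<phi>(1)] ball(1)[OF \<psi>(1)] s by linarith
  finally show ?thesis unfolding w_def[symmetric] \<rho>_def[symmetric] by (simp add: algebra_simps)
qed

text \<open>Suppose that for some pair \<open>p\<close>, \<open>q\<close> and some subsequence, each
  further subsequence admits an oscillating functional of the dual ball. Then independence produces
  l1-behaviour. Otherwise a diagonal sequence over a countable dense set of pairs removes
  oscillation for all of them. A functional diverging along it would have two cluster points, hence
  would oscillate for a pair close to these.\<close>

lemma rosenthal_l1:
  assumes b: "\<And>n. norm (x n) \<le> M"
  obtains (weakly_Cauchy) r :: "nat \<Rightarrow> nat" where "strict_mono r" "\<And>\<phi>. \<phi> \<in> dual_space smul \<Longrightarrow> convergent (\<lambda>n. \<phi> (x (r n)))"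
  | (l1) r :: "nat \<Rightarrow> nat" and \<delta> where "strict_mono r" "\<delta> > 0"
      "\<And>n a. \<delta> * (\<Sum>i<n. norm (a i)) \<le> norm (\<Sum>i<n. smul (a i) (x (r i)))"
proof -
  define osc where "osc \<phi> y p q \<longleftrightarrow> (\<forall>N. (\<exists>n\<ge>N. norm (\<phi> (y n) - p) < norm (p - q) / 16) \<and>
      (\<exists>n\<ge>N. norm (\<phi> (y n) - q) < norm (p - q) / 16))" for \<phi> :: "'a \<Rightarrow> 'k" and y :: "nat \<Rightarrow> 'a" and p q
  show ?thesis
  proof (cases "\<exists>p q s. p \<noteq> q \<and> strict_mono (s :: nat \<Rightarrow> nat) \<and> (\<forall>r :: nat \<Rightarrow> nat. strict_mono r \<longrightarrow> (\<exists>\<phi>\<in>dual_ball. osc \<phi> (\<lambda>n. x (s (r n))) p q))")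
    case True
    then obtain p q s where s: "p \<noteq> q" "strict_mono (s :: nat \<Rightarrow> nat)"
      "\<And>r :: nat \<Rightarrow> nat. strict_mono r \<Longrightarrow> \<exists>\<phi>\<in>dual_ball. osc \<phi> (\<lambda>n. x (s (r n))) p q" by blast
    obtain m :: "nat \<Rightarrow> nat" where m: "strict_mono m"
      "\<And>n \<sigma>. \<exists>\<phi>\<in>dual_ball. \<forall>i<n. if \<sigma> i then norm (\<phi> (x (s (m i))) - p) < norm (p - q) / 16
         else norm (\<phi> (x (s (m i))) - q) < norm (p - q) / 16"
      by (rule independent_subsequence[of dual_ball "\<lambda>\<phi> n. norm (\<phi> (x (s n)) - p) < norm (p - q) / 16"
            "\<lambda>\<phi> n. norm (\<phi> (x (s n)) - q) < norm (p - q) / 16"]) (use s(3) in \<open>auto simp: osc_def\<close>)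
    show ?thesis
    proof (rule l1)
      show "strict_mono (\<lambda>i. s (m i))" using strict_mono_o[OF s(2) m(1)] by (simp add: comp_def)
      show "norm (p - q) / 16 > 0" using s(1) by simp
      show "norm (p - q) / 16 * (\<Sum>i<n. norm (a i)) \<le> norm (\<Sum>i<n. smul (a i) (x (s (m i))))" for n a
        using l1_lower_bound[OF m(2)] .
    qed
  next
    case False
    obtain D :: "'k set" where D: "countable D" "\<And>z e. e > 0 \<Longrightarrow> \<exists>d\<in>D. norm (z - d) < e"
      using countable_dense_scalars by blast
    have Dne: "D \<noteq> {}" using D(2)[of 1 0] by auto
    define en where "en = from_nat_into (D \<times> D)"
    have en: "range en = D \<times> D"
      unfolding en_def using D(1) Dne by (intro range_from_nat_into) auto
    define P where "P k s \<longleftrightarrow> (fst (en k) \<noteq> snd (en k) \<longrightarrow> (\<forall>\<phi>\<in>dual_ball. \<not> osc \<phi> (\<lambda>n. x (s n)) (fst (en k)) (snd (en k))))"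
      for k and s :: "nat \<Rightarrow> nat"
    interpret subseqs P
    proof
      fix k and s :: "nat \<Rightarrow> nat" assume s: "strict_mono s"
      show "\<exists>r'. strict_mono r' \<and> P k (s \<circ> r')"
      proof (cases "fst (en k) = snd (en k)")
        case True
        then show ?thesis by (intro exI[of _ id]) (simp add: P_def strict_mono_def)
      next
        case neq: False
        with False s obtain r :: "nat \<Rightarrow> nat" where "strict_mono r" "\<forall>\<phi>\<in>dual_ball. \<not> osc \<phi> (\<lambda>n. x (s (r n))) (fst (en k)) (snd (en k))"
          by blast
        then show ?thesis by (intro exI[of _ r]) (simp add: P_def)
      qed
    qed
    have her: "P k (s \<circ> r)" if r: "strict_mono r" and P: "P k s" for r s k
    proof -
      have "osc \<phi> (\<lambda>n. x (s n)) p q" if "osc \<phi> (\<lambda>n. x ((s \<circ> r) n)) p q" for \<phi> p q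
        using that seq_suble[OF r] unfolding osc_def comp_def by (meson order_trans)
      then show ?thesis using P unfolding P_def by blast
    qed
    \<comment> \<open>The diagonal sequence is a subsequence of the selected one only from index
      \<open>Suc k\<close> on. Oscillation concerns tails, so the shift is harmless.\<close>
    have Pd: "P k (diagseq \<circ> (+) (Suc k))" for k by (rule diagseq_holds) (rule her)
    have ball: "convergent (\<lambda>n. \<phi> (x (diagseq n)))" if \<phi>: "\<phi> \<in> dual_ball" for \<phi>
    proof (rule ccontr)
      assume nc: "\<not> convergent (\<lambda>n. \<phi> (x (diagseq n)))"
      have bd: "norm (\<phi> (x (diagseq n))) \<le> M" for n using \<phi> b order_trans unfolding dual_ball_def by blast
      obtain l l' where l: "l \<noteq> l'" "\<And>e N. e > 0 \<Longrightarrow> \<exists>n\<ge>N. norm (\<phi> (x (diagseq n)) - l) < e"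
        "\<And>e N. e > 0 \<Longrightarrow> \<exists>n\<ge>N. norm (\<phi> (x (diagseq n)) - l') < e"
        using two_cluster_points[OF bd nc] by blast
      define \<rho> where "\<rho> = norm (l - l')"
      have \<rho>: "\<rho> > 0" using l(1) by (simp add: \<rho>_def)
      \<comment> \<open>Since \<open>p\<close> and \<open>q\<close> move by less than
        \<open>\<rho> / 64\<close>, the disc radius \<open>norm (p - q) / 16\<close> is at least
        \<open>\<rho> / 32\<close>. This leaves room for this displacement plus a distance
        \<open>\<rho> / 64\<close> to the cluster point.\<close>
      obtain p where p: "p \<in> D" "norm (l - p) < \<rho> / 64" using D(2)[of "\<rho> / 64" l] \<rho> by auto
      obtain q where q: "q \<in> D" "norm (l' - q) < \<rho> / 64" using D(2)[of "\<rho> / 64" l'] \<rho> by auto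
      have "\<rho> \<le> norm (l - p) + norm (p - q) + norm (l' - q)"
      proof -
        have "l - l' = (l - p) + (p - q) - (l' - q)" by simp
        then have "\<rho> \<le> norm ((l - p) + (p - q)) + norm (l' - q)" unfolding \<rho>_def by (metis norm_triangle_ineq4)
        then show ?thesis using norm_triangle_ineq[of "l - p" "p - q"] by linarith
      qed
      then have pq: "\<rho> / 32 \<le> norm (p - q) / 16" using p q \<rho> by linarith
      then have neq: "p \<noteq> q" using \<rho> by auto
      obtain k where k: "en k = (p, q)" using en p(1) q(1) by (metis SigmaI imageE)
      have "osc \<phi> (\<lambda>n. x ((diagseq \<circ> (+) (Suc k)) n)) p q"
        unfolding osc_def
      proof (intro allI conjI)
        fix N
        obtain n where n: "n \<ge> N + Suc k" "norm (\<phi> (x (diagseq n)) - l) < \<rho> / 64" using l(2)[of "\<rho> / 64"] \<rho> by auto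
        have "norm (\<phi> (x (diagseq n)) - p) \<le> norm (\<phi> (x (diagseq n)) - l) + norm (l - p)"
          using norm_triangle_ineq[of "\<phi> (x (diagseq n)) - l" "l - p"] by simp
        then have "norm (\<phi> (x (diagseq (Suc k + (n - Suc k)))) - p) < norm (p - q) / 16" using n p pq by simp
        then show "\<exists>n\<ge>N. norm (\<phi> (x ((diagseq \<circ> (+) (Suc k)) n)) - p) < norm (p - q) / 16"
          using n(1) by (intro exI[of _ "n - Suc k"]) auto
      next
        fix N
        obtain n where n: "n \<ge> N + Suc k" "norm (\<phi> (x (diagseq n)) - l') < \<rho> / 64" using l(3)[of "\<rho> / 64"] \<rho> by auto
        have "norm (\<phi> (x (diagseq n)) - q) \<le> norm (\<phi> (x (diagseq n)) - l') + norm (l' - q)"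
          using norm_triangle_ineq[of "\<phi> (x (diagseq n)) - l'" "l' - q"] by simp
        then have "norm (\<phi> (x (diagseq (Suc k + (n - Suc k)))) - q) < norm (p - q) / 16" using n q pq by simp
        then show "\<exists>n\<ge>N. norm (\<phi> (x ((diagseq \<circ> (+) (Suc k)) n)) - q) < norm (p - q) / 16"
          using n(1) by (intro exI[of _ "n - Suc k"]) auto
      qed
      then show False using Pd[of k] neq \<phi> unfolding P_def k by simp
    qed
    show ?thesis
    proof (rule weakly_Cauchy[OF subseq_diagseq])
      fix \<phi> assume "\<phi> \<in> dual_space smul"
      then obtain \<psi> c where \<psi>: "\<psi> \<in> dual_ball" "\<And>x. \<phi> x = c * \<psi> x" by (rule dual_space_scaled_ball) blast
      obtain l where "(\<lambda>n. \<psi> (x (diagseq n))) \<longlonglongrightarrow> l" using ball[OF \<psi>(1)] unfolding convergent_def by blast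
      then have "(\<lambda>n. c * \<psi> (x (diagseq n))) \<longlonglongrightarrow> c * l" by (intro tendsto_mult tendsto_const)
      then show "convergent (\<lambda>n. \<phi> (x (diagseq n)))" unfolding \<psi>(2) by (rule convergentI)
    qed
  qed
qed

end

section \<open>Schreier spreading subsequences\<close>

text \<open>Ramsey's theorem for the colouring of \<open>n\<close>-sets by the integer part of
  \<open>h X / e\<close>; boundedness of \<open>h\<close> makes the colours finite in
  number.\<close>

lemma ramsey_oscillation:
  fixes h :: "nat set \<Rightarrow> real"
  assumes Z: "infinite Z" and e: "e > 0" and h: "\<And>X. X \<subseteq> Z \<Longrightarrow> finite X \<Longrightarrow> card X = n \<Longrightarrow> 0 \<le> h X \<and> h X \<le> M"
  obtains Y where "Y \<subseteq> Z" "infinite Y"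
    "\<And>X X'. X \<subseteq> Y \<Longrightarrow> finite X \<Longrightarrow> card X = n \<Longrightarrow> X' \<subseteq> Y \<Longrightarrow> finite X' \<Longrightarrow> card X' = n \<Longrightarrow> \<bar>h X - h X'\<bar> \<le> e"
proof -
  define col where "col X = nat \<lfloor>h X / e\<rfloor>" for X
  have "\<forall>X. X \<subseteq> Z \<and> finite X \<and> card X = n \<longrightarrow> col X < Suc (nat \<lfloor>M / e\<rfloor>)"
  proof (intro allI impI)
    fix X assume "X \<subseteq> Z \<and> finite X \<and> card X = n"
    then have "h X / e \<le> M / e" using h e by (intro divide_right_mono) auto
    then have "col X \<le> nat \<lfloor>M / e\<rfloor>" unfolding col_def by (intro nat_mono floor_mono)
    then show "col X < Suc (nat \<lfloor>M / e\<rfloor>)" by simp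
  qed
  from Ramsey[OF Z this] obtain Y t where Y: "Y \<subseteq> Z" "infinite Y"
    "\<forall>X. X \<subseteq> Y \<and> finite X \<and> card X = n \<longrightarrow> col X = t" by blast
  have "\<bar>h X - h X'\<bar> \<le> e" if X: "X \<subseteq> Y" "finite X" "card X = n" and X': "X' \<subseteq> Y" "finite X'" "card X' = n" for X X'
  proof -
    have pos: "0 \<le> h X / e" "0 \<le> h X' / e" using h[of X] h[of X'] X X' Y(1) e by auto
    have "col X = col X'" using Y(3) X X' by simp
    then have "\<lfloor>h X / e\<rfloor> = \<lfloor>h X' / e\<rfloor>" using pos by (simp add: col_def nat_eq_iff)
    then have "\<bar>h X / e - h X' / e\<bar> \<le> 1" by linarith
    then have "\<bar>h X - h X'\<bar> / e \<le> 1" using e by (simp add: diff_divide_distrib[symmetric] abs_divide)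
    then show ?thesis using e by (simp add: field_simps)
  qed
  then show ?thesis using that Y by blast
qed

lemma ramsey_oscillation_family:
  fixes h :: "'i \<Rightarrow> nat set \<Rightarrow> real"
  assumes "finite A" "infinite Z" and e: "e > 0" and h: "\<And>a X. a \<in> A \<Longrightarrow> finite X \<Longrightarrow> card X = n \<Longrightarrow> 0 \<le> h a X \<and> h a X \<le> M"
  shows "\<exists>Y\<subseteq>Z. infinite Y \<and> (\<forall>a\<in>A. \<forall>X X'. X \<subseteq> Y \<and> finite X \<and> card X = n \<and> X' \<subseteq> Y \<and> finite X' \<and> card X' = n \<longrightarrow> \<bar>h a X - h a X'\<bar> \<le> e)"
  using assms(1,2) h
proof (induction A arbitrary: Z)
  case empty
  then show ?case by (intro exI[of _ Z]) simp
next
  case (insert b A)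
  then obtain Y where Y: "Y \<subseteq> Z" "infinite Y" "\<forall>a\<in>A. \<forall>X X'. X \<subseteq> Y \<and> finite X \<and> card X = n \<and> X' \<subseteq> Y \<and> finite X' \<and> card X' = n \<longrightarrow> \<bar>h a X - h a X'\<bar> \<le> e"
    by (metis insertI2)
  obtain Y' where Y': "Y' \<subseteq> Y" "infinite Y'"
    "\<And>X X'. X \<subseteq> Y' \<Longrightarrow> finite X \<Longrightarrow> card X = n \<Longrightarrow> X' \<subseteq> Y' \<Longrightarrow> finite X' \<Longrightarrow> card X' = n \<Longrightarrow> \<bar>h b X - h b X'\<bar> \<le> e"
    by (rule ramsey_oscillation[OF Y(2) e, of n "h b" M]) (use insert.prems in auto)
  have "\<bar>h a X - h a X'\<bar> \<le> e" if "a \<in> insert b A" "X \<subseteq> Y' \<and> finite X \<and> card X = n \<and> X' \<subseteq> Y' \<and> finite X' \<and> card X' = n" for a X X'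
  proof (cases "a = b")
    case True
    then show ?thesis using Y'(3)[of X X'] that by simp
  next
    case False
    then have "a \<in> A" "X \<subseteq> Y" "X' \<subseteq> Y" using that Y'(1) by auto
    then show ?thesis using Y(3) that(2) by simp
  qed
  then show ?case using Y(1) Y'(1,2) by (intro exI[of _ Y']) auto
qed

lemma sorted_list_of_strict_mono_image:
  assumes f: "strict_mono_on {1..n} (f :: nat \<Rightarrow> nat)" and i: "i \<in> {1..n}"
  shows "sorted_list_of_set (f ` {1..n}) ! (i - 1) = f i"
proof -
  have "sorted_wrt (<) (map f [1..<Suc n])"
    using f by (auto simp: sorted_wrt_map sorted_wrt_iff_nth_less strict_mono_on_def simp del: upt_Suc)
  moreover have "set (map f [1..<Suc n]) = f ` {1..n}"
    by (simp only: set_map set_upt atLeastLessThanSuc_atLeastAtMost)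
  ultimately have "sorted_list_of_set (f ` {1..n}) = map f [1..<Suc n]"
    by (metis sorted_list_of_set.idem_if_sorted_distinct strict_sorted_iff)
  moreover have "1 \<le> i" "i \<le> n" using i by auto
  then have "i - 1 < length [1..<Suc n]" "1 + (i - 1) = i" "1 + (i - 1) < Suc n" unfolding length_upt by linarith+
  ultimately show ?thesis by (simp only: nth_map nth_upt)
qed

lemma strict_mono_on_comp: "strict_mono r \<Longrightarrow> strict_mono_on I f \<Longrightarrow> strict_mono_on I (\<lambda>i. r (f i))"
  for r :: "nat \<Rightarrow> nat" and f :: "nat \<Rightarrow> nat"
  by (auto simp: strict_mono_on_def strict_mono_def)

context banach_space_over
begin

text \<open>The error is additive, scaled by a bound on the coefficients, because this is the form
  that a finite net of coefficients can provide. It becomes a multiplicative constant later, through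
  the basis inequality.\<close>

definition spreads_on :: "nat \<Rightarrow> (nat \<Rightarrow> 'a) \<Rightarrow> bool" where
  "spreads_on n x \<longleftrightarrow> (\<forall>f g a A. strict_mono_on {1..n} f \<and> strict_mono_on {1..n} g \<and> (\<forall>i\<in>{1..n}. norm (a i) \<le> A) \<longrightarrow>
     \<bar>norm (\<Sum>i\<in>{1..n}. smul (a i) (x (f i))) - norm (\<Sum>i\<in>{1..n}. smul (a i) (x (g i)))\<bar> \<le> A)"

lemma spreads_on_subseq:
  assumes x: "spreads_on n x" and r: "strict_mono r"
  shows "spreads_on n (x \<circ> r)"
  unfolding spreads_on_def
proof (intro allI impI)
  fix f g :: "nat \<Rightarrow> nat" and a :: "nat \<Rightarrow> 'k" and A :: real
  assume "strict_mono_on {1..n} f \<and> strict_mono_on {1..n} g \<and> (\<forall>i\<in>{1..n}. norm (a i) \<le> A)"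
  then show "\<bar>norm (\<Sum>i\<in>{1..n}. smul (a i) ((x \<circ> r) (f i))) - norm (\<Sum>i\<in>{1..n}. smul (a i) ((x \<circ> r) (g i)))\<bar> \<le> A"
    using x[unfolded spreads_on_def, rule_format, of "\<lambda>i. r (f i)" "\<lambda>i. r (g i)" a A] strict_mono_on_comp[OF r]
    by simp
qed

text \<open>By homogeneity the coefficients may be taken in the unit ball. Replacing them by points
  of a finite net costs 1/4 on each side, and Ramsey's theorem for the finitely many coefficient
  vectors over the net leaves an oscillation of 1/2, in total 1.\<close>

lemma spreads_on_subsequence_exists:
  assumes x: "\<And>n. norm (x n) \<le> M" and n: "n > 0"
  obtains r :: "nat \<Rightarrow> nat" where "strict_mono r" "spreads_on n (x \<circ> r)"
proof -
  have M0: "M \<ge> 0" using x[of 0] norm_ge_zero[of "x 0"] by linarith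
  \<comment> \<open>The mesh \<open>d\<close> derived from \<open>P\<close> makes \<open>n\<close>
    errors of size \<open>d * M\<close> sum to at most 1/4; the added ones keep \<open>P\<close>
    positive even for \<open>M = 0\<close>.\<close>
  define P where "P = (real n + 1) * (M + 1)"
  define d where "d = 1 / (4 * P)"
  have P: "P > 0" using M0 unfolding P_def by (intro mult_pos_pos) auto
  then have d: "d > 0" unfolding d_def by simp
  have dn: "real n * (d * M) \<le> 1 / 4"
  proof -
    have "real n * M \<le> P" unfolding P_def using M0 by (intro mult_mono) auto
    then have "d * (real n * M) \<le> d * P" using d by (intro mult_left_mono) auto
    also have "\<dots> = 1 / 4" unfolding d_def using P by simp
    finally show ?thesis by (simp add: algebra_simps)
  qed
  obtain D :: "'k set" where D: "D \<subseteq> cball 0 1" "finite D" "cball 0 1 \<subseteq> (\<Union>b\<in>D. ball b d)"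
    by (rule compactE_image[OF compact_cball_scalars[of 1], of "cball 0 1" "\<lambda>b. ball b d"]) (use d in auto)
  define A where "A = PiE {1..n} (\<lambda>_. D)"
  define h where "h a X = norm (\<Sum>i\<in>{1..n}. smul (a i) (x (sorted_list_of_set X ! (i - 1))))" for a X
  have "finite A" unfolding A_def using D(2) by (intro finite_PiE) auto
  moreover have "0 \<le> h a X \<and> h a X \<le> (\<Sum>i\<in>{1..n}. 1 * M)" if "a \<in> A" for a X
  proof -
    have "norm (a i) \<le> 1" if "i \<in> {1..n}" for i using \<open>a \<in> A\<close> that D(1) unfolding A_def by (force simp: PiE_iff)
    then show ?thesis unfolding h_def using x
      by (intro conjI norm_ge_zero sum_norm_le) (auto simp: norm_scale intro!: mult_mono[of _ 1 _ M, simplified])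
  qed
  ultimately obtain Y where Y: "infinite Y" "\<forall>a\<in>A. \<forall>X X'. X \<subseteq> Y \<and> finite X \<and> card X = n \<and> X' \<subseteq> Y \<and> finite X' \<and> card X' = n \<longrightarrow> \<bar>h a X - h a X'\<bar> \<le> 1/2"
    using ramsey_oscillation_family[of A UNIV "1/2" n h "\<Sum>i\<in>{1..n}. 1 * M"] by auto
  define r where "r = enumerate Y"
  have r: "strict_mono r" unfolding r_def using Y(1) by (rule strict_mono_enumerate)
  have "spreads_on n (x \<circ> r)"
    unfolding spreads_on_def
  proof (intro allI impI)
    fix f g :: "nat \<Rightarrow> nat" and a :: "nat \<Rightarrow> 'k" and B :: real
    assume as: "strict_mono_on {1..n} f \<and> strict_mono_on {1..n} g \<and> (\<forall>i\<in>{1..n}. norm (a i) \<le> B)"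
    let ?S = "\<lambda>c f. \<Sum>i\<in>{1..n}. smul (c i) ((x \<circ> r) (f i))"
    show "\<bar>norm (?S a f) - norm (?S a g)\<bar> \<le> B"
    proof (cases "\<forall>i\<in>{1..n}. a i = 0")
      case True
      then have "?S a f = 0" "?S a g = 0" by simp_all
      moreover have "1 \<in> {1..n}" using n by simp
      then have "norm (a 1) \<le> B" using as by blast
      then have "0 \<le> B" using norm_ge_zero order_trans by blast
      ultimately show ?thesis by simp
    next
      case False
      then obtain i0 where i0: "i0 \<in> {1..n}" "a i0 \<noteq> 0" by blast
      then have B: "B > 0" using as by (meson less_le_trans zero_less_norm_iff)
      define c where "c i = of_real (inverse B) * a i" for i
      have "norm (c i) \<le> 1" if "i \<in> {1..n}" for i
      proof -
        have "norm (a i) \<le> B" using as that by blast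
        then have "inverse B * norm (a i) \<le> inverse B * B" using B by (intro mult_left_mono) auto
        then show ?thesis unfolding c_def norm_mult norm_of_real using B by simp
      qed
      then have "\<forall>i. \<exists>b. i \<in> {1..n} \<longrightarrow> b \<in> D \<and> norm (c i - b) \<le> d"
        using D(3) by (fastforce simp: subset_iff dist_norm norm_minus_commute)
      from choice[OF this] obtain b0 where b0: "\<forall>i. i \<in> {1..n} \<longrightarrow> b0 i \<in> D \<and> norm (c i - b0 i) \<le> d" ..
      define b where "b = restrict b0 {1..n}"
      have bA: "b \<in> A" unfolding b_def A_def using b0 by auto
      have near: "\<bar>norm (?S c f) - norm (?S b f)\<bar> \<le> 1/4" for f :: "nat \<Rightarrow> nat"
      proof -
        have "\<bar>norm (?S c f) - norm (?S b f)\<bar> \<le> norm (?S c f - ?S b f)" by (rule norm_triangle_ineq3)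
        also have "?S c f - ?S b f = (\<Sum>i\<in>{1..n}. smul (c i - b i) ((x \<circ> r) (f i)))"
          by (simp add: scale_left_diff_distrib sum_subtractf)
        also have "norm \<dots> \<le> (\<Sum>i\<in>{1..n}. d * M)"
          using b0 x d by (intro sum_norm_le) (auto simp: norm_scale b_def intro!: mult_mono)
        also have "\<dots> \<le> 1/4" using dn by simp
        finally show ?thesis .
      qed
      have hS: "norm (?S b f) = h b ((\<lambda>i. r (f i)) ` {1..n})" if "strict_mono_on {1..n} f" for f :: "nat \<Rightarrow> nat"
        unfolding h_def using sorted_list_of_strict_mono_image[OF strict_mono_on_comp[OF r that]] by simp
      have XX: "(\<lambda>i. r (f i)) ` {1..n} \<subseteq> Y \<and> finite ((\<lambda>i. r (f i)) ` {1..n}) \<and> card ((\<lambda>i. r (f i)) ` {1..n}) = n"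
        if "strict_mono_on {1..n} f" for f :: "nat \<Rightarrow> nat"
      proof -
        have "inj_on (\<lambda>i. r (f i)) {1..n}"
          using strict_mono_on_comp[OF r that] by (rule strict_mono_on_imp_inj_on)
        then show ?thesis using Y(1) by (auto simp: card_image r_def enumerate_in_set)
      qed
      have "\<bar>norm (?S b f) - norm (?S b g)\<bar> \<le> 1/2"
        using hS XX as Y(2) bA by simp
      then have le1: "\<bar>norm (?S c f) - norm (?S c g)\<bar> \<le> 1" using near[of f] near[of g] by linarith
      have scale: "norm (?S c f) = inverse B * norm (?S a f)" for f
      proof -
        have "?S c f = inverse B *\<^sub>R ?S a f" unfolding c_def smul_real by (rule scaleR_sum_right[symmetric])
        then show ?thesis using B by simp
      qed
      have "inverse B * \<bar>norm (?S a f) - norm (?S a g)\<bar> = \<bar>inverse B * norm (?S a f) - inverse B * norm (?S a g)\<bar>"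
        using B by (simp add: abs_mult flip: right_diff_distrib)
      then have "inverse B * \<bar>norm (?S a f) - norm (?S a g)\<bar> \<le> 1" using le1 unfolding scale by simp
      then show ?thesis using B by (simp add: field_simps)
    qed
  qed
  then show ?thesis using that r by blast
qed

text \<open>A member of \<open>schreier1\<close> with \<open>n\<close> elements starts at
  \<open>n\<close> or later, which is exactly where the spreading estimate for length
  \<open>n\<close> is available. Its additive error is the largest coefficient, and the coefficient
  bound absorbs it at the cost of \<open>2 * K / m\<close>.\<close>

lemma schreier_spreading_of_spreads:
  assumes sp: "\<And>n. spreads_on (Suc n) (y \<circ> (+) (Suc n))"
    and y: "basis_bound K y" and K: "K \<ge> 0" and low: "m > 0" "\<And>n. m \<le> norm (y n)"
    and r: "strict_mono r"
  shows "schreier_spreading smul (y \<circ> r)"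
proof -
  define C where "C = 1 + 2 * K / m"
  have C: "C \<ge> 1" unfolding C_def using K low(1) by simp
  have le: "norm (\<Sum>i\<in>{1..n}. smul (a i) (y (r (f i)))) \<le> C * norm (\<Sum>i\<in>{1..n}. smul (a i) (y (r (g i))))"
    if f: "strict_mono_on {1..n} f" "f ` {1..n} \<in> schreier1" and g: "strict_mono_on {1..n} g" "g ` {1..n} \<in> schreier1"
    for n and f g :: "nat \<Rightarrow> nat" and a
  proof (cases n)
    case (Suc n')
    have ge: "n \<le> r (f i)" if "strict_mono_on {1..n} f" "f ` {1..n} \<in> schreier1" "i \<in> {1..n}" for f :: "nat \<Rightarrow> nat" and i
    proof -
      have "card (f ` {1..n}) = n" using strict_mono_on_imp_inj_on[OF that(1)] by (simp add: card_image)
      then have "n \<le> Min (f ` {1..n})" using that(2) Suc unfolding schreier1_def by auto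
      also have "\<dots> \<le> f i" using that(3) by (intro Min_le) auto
      also have "\<dots> \<le> r (f i)" using r by (rule seq_suble)
      finally show ?thesis .
    qed
    define A where "A = Max ((\<lambda>i. norm (a i)) ` {1..n})"
    have fin: "finite ((\<lambda>i. norm (a i)) ` {1..n})" "(\<lambda>i. norm (a i)) ` {1..n} \<noteq> {}" using Suc by auto
    have A: "\<forall>i\<in>{1..n}. norm (a i) \<le> A" unfolding A_def using fin by auto
    obtain i0 where i0: "i0 \<in> {1..n}" "norm (a i0) = A" using Max_in[OF fin] unfolding A_def by auto
    have sh: "strict_mono_on {1..n} (\<lambda>i. r (f i) - n) \<and> (\<forall>i\<in>{1..n}. y (r (f i)) = (y \<circ> (+) n) (r (f i) - n))"
      if "strict_mono_on {1..n} f" "f ` {1..n} \<in> schreier1" for f :: "nat \<Rightarrow> nat"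
      using ge[OF that] strict_mono_on_comp[OF r that(1)]
      by (auto simp: strict_mono_on_def intro!: diff_less_mono)
    have h: "\<bar>norm (\<Sum>i\<in>{1..n}. smul (a i) ((y \<circ> (+) n) (r (f i) - n))) - norm (\<Sum>i\<in>{1..n}. smul (a i) ((y \<circ> (+) n) (r (g i) - n)))\<bar> \<le> A"
      using sp[of n', folded Suc, unfolded spreads_on_def, rule_format, of "\<lambda>i. r (f i) - n" "\<lambda>i. r (g i) - n" a A]
        sh[OF f] sh[OF g] A by blast
    have e1: "(\<Sum>i\<in>{1..n}. smul (a i) ((y \<circ> (+) n) (r (f i) - n))) = (\<Sum>i\<in>{1..n}. smul (a i) (y (r (f i))))"
      by (rule sum.cong) (use sh[OF f] in auto)
    have e2: "(\<Sum>i\<in>{1..n}. smul (a i) ((y \<circ> (+) n) (r (g i) - n))) = (\<Sum>i\<in>{1..n}. smul (a i) (y (r (g i))))"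
      by (rule sum.cong) (use sh[OF g] in auto)
    have 1: "norm (\<Sum>i\<in>{1..n}. smul (a i) (y (r (f i)))) \<le> norm (\<Sum>i\<in>{1..n}. smul (a i) (y (r (g i)))) + A"
      using h unfolding e1 e2 by linarith
    let ?q = "\<lambda>i. r (g i)"
    have inj: "inj_on ?q {1..n}" using strict_mono_on_comp[OF r g(1)] by (rule strict_mono_on_imp_inj_on)
    have "norm ((\<lambda>l. a (inv_into {1..n} ?q l)) (?q i0)) \<le> 2 * K / m *
        norm (\<Sum>l\<in>?q ` {1..n}. smul (a (inv_into {1..n} ?q l)) (y l))"
      using i0(1) by (intro basis_bound_coefficient_finite[OF y K low]) auto
    also have "(\<Sum>l\<in>?q ` {1..n}. smul (a (inv_into {1..n} ?q l)) (y l)) = (\<Sum>i\<in>{1..n}. smul (a i) (y (?q i)))"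
      unfolding sum.reindex[OF inj] comp_def by (rule sum.cong[OF refl]) (simp only: inv_into_f_f[OF inj])
    finally have "A \<le> 2 * K / m * norm (\<Sum>i\<in>{1..n}. smul (a i) (y (r (g i))))"
      using i0 inv_into_f_f[OF inj i0(1)] by simp
    then show ?thesis using 1 unfolding C_def by (simp add: algebra_simps)
  qed simp
  show ?thesis
    unfolding schreier_spreading_def
  proof (rule exI[of _ C], intro conjI C allI impI)
    fix n :: nat and f g :: "nat \<Rightarrow> nat" and a
    assume "strict_mono_on {1..n} f \<and> f ` {1..n} \<in> schreier1 \<and> strict_mono_on {1..n} g \<and> g ` {1..n} \<in> schreier1"
    then have fg: "strict_mono_on {1..n} f" "f ` {1..n} \<in> schreier1" "strict_mono_on {1..n} g" "g ` {1..n} \<in> schreier1" by auto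
    show "approx C (norm (\<Sum>i\<in>{1..n}. smul (a i) ((y \<circ> r) (f i)))) (norm (\<Sum>i\<in>{1..n}. smul (a i) ((y \<circ> r) (g i))))"
      using le[OF fg, of a] le[OF fg(3,4,1,2), of a] C unfolding approx_def by (simp add: field_simps)
  qed
qed

text \<open>Diagonalization over the length \<open>n\<close>: the diagonal sequence satisfies the
  estimate for length \<open>n\<close> only on a tail, and \<open>schreier1\<close> looks at nothing
  earlier. The conclusion covers all further subsequences so that several sequences can be thinned
  out in turn.\<close>

lemma schreier_spreading_subsequence:
  assumes M: "\<And>n. norm (x n) \<le> M"
    and x: "basis_bound K x" and K: "K \<ge> 0" and low: "m > 0" "\<And>n. m \<le> norm (x n)"
  obtains s :: "nat \<Rightarrow> nat" where "strict_mono s" "\<And>r :: nat \<Rightarrow> nat. strict_mono r \<Longrightarrow> schreier_spreading smul (x \<circ> s \<circ> r)"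
proof -
  interpret subseqs "\<lambda>n s. spreads_on (Suc n) (x \<circ> s)"
  proof
    fix n and s :: "nat \<Rightarrow> nat" assume "strict_mono s"
    obtain r :: "nat \<Rightarrow> nat" where "strict_mono r" "spreads_on (Suc n) (x \<circ> s \<circ> r)"
      by (rule spreads_on_subsequence_exists[of "x \<circ> s" M "Suc n"]) (use M in auto)
    then show "\<exists>r'. strict_mono r' \<and> spreads_on (Suc n) (x \<circ> (s \<circ> r'))" by (auto simp: comp_assoc)
  qed
  have "spreads_on (Suc n) (x \<circ> (diagseq \<circ> (+) (Suc n)))" for n
    by (rule diagseq_holds) (metis comp_assoc spreads_on_subseq)
  then have sp: "spreads_on (Suc n) (x \<circ> diagseq \<circ> (+) (Suc n))" for n by (simp add: comp_assoc)
  have "schreier_spreading smul (x \<circ> diagseq \<circ> r)" if "strict_mono r" for r :: "nat \<Rightarrow> nat"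
    by (rule schreier_spreading_of_spreads[OF sp basis_bound_subseq[OF x subseq_diagseq] K low(1) _ that]) (simp add: low(2))
  then show ?thesis using that subseq_diagseq by blast
qed

end

section \<open>Lomonosov's theorem\<close>

lemma bounded_family_convergent_subseq:
  fixes \<beta> :: "nat \<Rightarrow> 'i \<Rightarrow> real"
  assumes "finite A" "\<And>k i. i \<in> A \<Longrightarrow> \<bar>\<beta> k i\<bar> \<le> 1"
  shows "\<exists>r l. strict_mono (r :: nat \<Rightarrow> nat) \<and> (\<forall>i\<in>A. (\<lambda>k. \<beta> (r k) i) \<longlonglongrightarrow> l i)"
  using assms
proof (induction A)
  case empty
  show ?case by (intro exI[of _ id]) (simp add: strict_mono_def)
next
  case (insert i A)
  then obtain r l where r: "strict_mono (r :: nat \<Rightarrow> nat)" "\<forall>i\<in>A. (\<lambda>k. \<beta> (r k) i) \<longlonglongrightarrow> l i" by auto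
  have "norm (\<beta> (r k) i) \<le> 1" for k using insert.prems by simp
  then obtain b s where s: "strict_mono (s :: nat \<Rightarrow> nat)" "(\<lambda>k. \<beta> (r (s k)) i) \<longlonglongrightarrow> b"
    by (rule bounded_scalars_convergent_subseq)
  have "(\<lambda>k. \<beta> (r (s k)) k') \<longlonglongrightarrow> (l(i := b)) k'" if "k' \<in> insert i A" for k'
    using LIMSEQ_subseq_LIMSEQ[OF _ s(1), of "\<lambda>k. \<beta> (r k) k'" "l k'"] r(2) s(2) that by (auto simp: comp_def)
  then show ?case using strict_mono_o[OF r(1) s(1)] unfolding comp_def
    by (intro exI[of _ "\<lambda>k. r (s k)"] exI[of _ "l(i := b)"]) auto
qed

text \<open>A Schauder projection in coefficient form. Averaging the fixed points
  \<open>c i = T i (q i)\<close> with weights depending on \<open>K x\<close> gives a map into a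
  polytope, to which Brouwer's theorem applies through the coefficients. A weight is nonzero only if
  \<open>K x\<close> is \<open>\<epsilon>\<close>-close to \<open>q i\<close>, so replacing
  \<open>T i (q i)\<close> by \<open>T i (K x)\<close> afterwards costs at most
  \<open>R * \<epsilon>\<close>.\<close>

lemma approximate_fixed_combination:
  fixes K :: "'a::real_normed_vector \<Rightarrow> 'a"
  assumes K: "continuous_on UNIV K"
    and Q: "compact Q" "K ` cball x0 1 \<subseteq> Q" "Q \<noteq> {}"
    and A: "finite \<A>" "\<And>q. q \<in> Q \<Longrightarrow> \<exists>A\<in>\<A>. norm (A q - x0) \<le> 1"
    and lin: "\<And>A. A \<in> \<A> \<Longrightarrow> linear A" and R: "\<And>A v. A \<in> \<A> \<Longrightarrow> norm (A v) \<le> R * norm v" "R \<ge> 0"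
    and e: "\<epsilon> > 0"
  shows "\<exists>x \<beta>. x \<in> cball x0 1 \<and> (\<forall>A\<in>\<A>. \<bar>\<beta> A\<bar> \<le> (1::real)) \<and>
    norm (x - (\<Sum>A\<in>\<A>. \<beta> A *\<^sub>R A (K x))) \<le> R * \<epsilon>"
proof -
  obtain J where J: "J \<subseteq> Q" "finite J" "Q \<subseteq> (\<Union>q\<in>J. ball q \<epsilon>)"
    by (rule compactE_image[OF Q(1), of Q "\<lambda>q. ball q \<epsilon>"]) (use e in auto)
  define n where "n = card J"
  obtain q where q: "bij_betw q {0..<n} J" using ex_bij_betw_nat_finite[OF J(2)] unfolding n_def by blast
  have qQ: "q i \<in> Q" if "i < n" for i using q J(1) that unfolding bij_betw_def by auto
  have "\<forall>i. \<exists>A. i < n \<longrightarrow> A \<in> \<A> \<and> norm (A (q i) - x0) \<le> 1" using A(2)[OF qQ] by blast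
  from choice[OF this] obtain T where T: "\<forall>i. i < n \<longrightarrow> T i \<in> \<A> \<and> norm (T i (q i) - x0) \<le> 1" ..
  define c where "c i = T i (q i)" for i
  \<comment> \<open>Tent functions supported in the balls of the cover; divided by their sum
    \<open>W\<close> they form a partition of unity on \<open>Q\<close>.\<close>
  define h where "h i y = max 0 (\<epsilon> - norm (y - q i))" for i y
  define W where "W y = (\<Sum>i<n. h i y)" for y
  have h0: "h i y \<ge> 0" for i y by (simp add: h_def)
  have W: "W y > 0" if y: "y \<in> Q" for y
  proof -
    obtain p where "p \<in> J" "y \<in> ball p \<epsilon>" using J(3) y by blast
    then obtain i where i: "i < n" "dist (q i) y < \<epsilon>" using q unfolding bij_betw_def by auto
    then have "h i y > 0" by (simp add: h_def dist_norm norm_minus_commute)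
    then show ?thesis unfolding W_def using i(1) h0 by (intro sum_pos2[of _ i]) auto
  qed
  \<comment> \<open>the normalization extends the convex combinations from the simplex to the whole cube\<close>
  define X where "X l = x0 + (1 / max 1 (\<Sum>i<n. l i)) *\<^sub>R (\<Sum>i<n. l i *\<^sub>R (c i - x0))" for l :: "nat \<Rightarrow> real"
  have XB: "X l \<in> cball x0 1" if "l \<in> cube n" for l
  proof -
    have l: "0 \<le> l i" if "i < n" for i using \<open>l \<in> cube n\<close> that by (simp add: cube_def)
    have "norm (\<Sum>i<n. l i *\<^sub>R (c i - x0)) \<le> (\<Sum>i<n. l i)"
      using T l by (intro sum_norm_le) (auto simp: c_def intro: mult_left_le)
    then have "norm (\<Sum>i<n. l i *\<^sub>R (c i - x0)) \<le> max 1 (\<Sum>i<n. l i)" by simp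
    moreover have "max 1 (\<Sum>i<n. l i) > 0" by simp
    ultimately have "norm ((1 / max 1 (\<Sum>i<n. l i)) *\<^sub>R (\<Sum>i<n. l i *\<^sub>R (c i - x0))) \<le> 1"
      unfolding norm_scaleR by (simp add: divide_le_eq)
    then show ?thesis unfolding X_def by (simp add: dist_norm)
  qed
  define g where "g l i = (if i < n then h i (K (X l)) / W (K (X l)) else 0)" for l i
  have KX: "K (X l) \<in> Q" if "l \<in> cube n" for l using XB[OF that] Q(2) by blast
  have contX: "continuous_on (cube n) X"
    unfolding X_def by (intro continuous_intros continuous_on_product_coordinates[THEN continuous_on_subset]) auto
  have contK: "continuous_on (cube n) (\<lambda>l. K (X l))"
    by (rule continuous_on_compose2[OF K contX]) simp
  have conth: "continuous_on (cube n) (\<lambda>l. h i (K (X l)))" for i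
    unfolding h_def by (intro continuous_intros contK)
  have "continuous_on (cube n) g"
  proof (rule continuous_on_coordinatewise_then_product)
    fix i
    show "continuous_on (cube n) (\<lambda>l. g l i)"
    proof (cases "i < n")
      case True
      have "continuous_on (cube n) (\<lambda>l. h i (K (X l)) / W (K (X l)))"
        unfolding W_def by (intro continuous_intros conth ballI) (use W KX in \<open>force simp: W_def\<close>)
      then show ?thesis using True by (simp add: g_def)
    qed (simp add: g_def)
  qed
  moreover have "g ` cube n \<subseteq> cube n"
  proof
    fix l' assume "l' \<in> g ` cube n"
    then obtain l where l: "l \<in> cube n" "l' = g l" by blast
    have "h i (K (X l)) \<le> W (K (X l))" if "i < n" for i
      unfolding W_def using that h0 by (intro member_le_sum) auto
    then show "l' \<in> cube n" unfolding l(2) cube_def g_def using W[OF KX[OF l(1)]] h0 by (auto simp: divide_le_eq)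
  qed
  ultimately obtain l where l: "l \<in> cube n" "g l = l" by (rule brouwer_cube_nat)
  define x where "x = X l"
  have li: "l i = h i (K x) / W (K x)" if "i < n" for i
    using l(2) that unfolding x_def by (metis g_def)
  have Wx: "W (K x) > 0" using W KX l(1) by (simp add: x_def)
  have sum1: "(\<Sum>i<n. l i) = 1"
  proof -
    have "(\<Sum>i<n. l i) = (\<Sum>i<n. h i (K x)) / W (K x)" by (simp add: li sum_divide_distrib)
    then show ?thesis using Wx by (simp add: W_def)
  qed
  have l0: "l i \<ge> 0" if "i < n" for i using l(1) that by (simp add: cube_def)
  have x: "x = (\<Sum>i<n. l i *\<^sub>R c i)"
  proof -
    have "x = x0 + (\<Sum>i<n. l i *\<^sub>R (c i - x0))" unfolding x_def X_def sum1 by simp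
    also have "(\<Sum>i<n. l i *\<^sub>R (c i - x0)) = (\<Sum>i<n. l i *\<^sub>R c i) - (\<Sum>i<n. l i) *\<^sub>R x0"
      by (simp add: scaleR_diff_right sum_subtractf scaleR_sum_left)
    finally show ?thesis by (simp add: sum1)
  qed
  \<comment> \<open>Several centres may use the same operator, so their weights are collected.
    Indexing by \<open>\<A>\<close> instead of by centres makes the coefficients comparable for
    different \<open>\<epsilon>\<close>, as a passage to the limit requires.\<close>
  define \<beta> where "\<beta> A = (\<Sum>i | i < n \<and> T i = A. l i)" for A
  have beta: "\<bar>\<beta> A\<bar> \<le> 1" for A
  proof -
    have "\<beta> A \<ge> 0" unfolding \<beta>_def by (intro sum_nonneg) (simp add: l0)
    moreover have "\<beta> A \<le> (\<Sum>i<n. l i)" unfolding \<beta>_def by (intro sum_mono2) (auto simp: l0)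
    ultimately show ?thesis using sum1 by simp
  qed
  have "(\<Sum>A\<in>\<A>. \<beta> A *\<^sub>R A (K x)) = (\<Sum>A\<in>\<A>. \<Sum>i | i \<in> {..<n} \<and> T i = A. l i *\<^sub>R T i (K x))"
    unfolding \<beta>_def scaleR_sum_left by (intro sum.cong) auto
  also have "\<dots> = (\<Sum>i<n. l i *\<^sub>R T i (K x))"
    using T A(1) by (intro sum.group) auto
  finally have "x - (\<Sum>A\<in>\<A>. \<beta> A *\<^sub>R A (K x)) = (\<Sum>i<n. l i *\<^sub>R c i) - (\<Sum>i<n. l i *\<^sub>R T i (K x))"
    using x by (simp only:)
  also have "\<dots> = (\<Sum>i<n. l i *\<^sub>R T i (q i - K x))"
    unfolding sum_subtractf[symmetric]
  proof (rule sum.cong[OF refl])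
    fix i assume "i \<in> {..<n}"
    then have "linear (T i)" using T lin by simp
    then show "l i *\<^sub>R c i - l i *\<^sub>R T i (K x) = l i *\<^sub>R T i (q i - K x)"
      by (simp add: c_def linear_diff scaleR_diff_right)
  qed
  also have "norm \<dots> \<le> (\<Sum>i<n. l i * (R * \<epsilon>))"
  proof (rule sum_norm_le)
    fix i assume "i \<in> {..<n}"
    then have i: "i < n" by simp
    show "norm (l i *\<^sub>R T i (q i - K x)) \<le> l i * (R * \<epsilon>)"
    proof (cases "l i = 0")
      case False
      then have "h i (K x) \<noteq> 0" using li[OF i] by auto
      then have "norm (q i - K x) \<le> \<epsilon>" by (auto simp: h_def norm_minus_commute max_def split: if_splits)
      then have "R * norm (q i - K x) \<le> R * \<epsilon>" using R(2) by (rule mult_left_mono)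
      moreover have "norm (T i (q i - K x)) \<le> R * norm (q i - K x)" using T i R(1) by blast
      ultimately show ?thesis unfolding norm_scaleR using l0[OF i] by (auto intro!: mult_mono)
    qed simp
  qed
  also have "\<dots> = R * \<epsilon>" using sum1 by (simp flip: sum_distrib_right)
  finally show ?thesis using beta XB[OF l(1)] unfolding x_def[symmetric] by blast
qed

lemma bounded_linear_funpow: "bounded_linear S \<Longrightarrow> bounded_linear (S ^^ n)" for S :: "'a::real_normed_vector \<Rightarrow> 'a"
  by (induction n) (simp_all add: bounded_linear_ident id_def comp_def bounded_linear_compose)

lemma subspace_fixed_points: "linear Z \<Longrightarrow> subspace {v. Z v = v}"
  by (auto simp: subspace_def linear_0 linear_add linear_scale)

context banach_space_over
begin

section \<open>The commutant and Lomonosov's fixed vector\<close>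

definition commutant :: "('a \<Rightarrow> 'a) \<Rightarrow> ('a \<Rightarrow> 'a) set" where
  "commutant S = {T \<in> bounded_operators smul. T \<circ> S = S \<circ> T}"

lemma commutant_iff: "T \<in> commutant S \<longleftrightarrow>
    bounded_linear T \<and> (\<forall>c x. T (smul c x) = smul c (T x)) \<and> (\<forall>x. T (S x) = S (T x))"
  by (auto simp: commutant_def bounded_operators_def fun_eq_iff)

lemma commutant_funpow:
  assumes "T \<in> commutant S" shows "T ((S ^^ n) x) = (S ^^ n) (T x)"
  using assms by (induction n) (auto simp: commutant_iff)

lemma commutant_sum:
  assumes "finite F" "\<And>i. i \<in> F \<Longrightarrow> A i \<in> commutant S" "S \<in> bounded_operators smul"
  shows "(\<lambda>x. \<Sum>i\<in>F. \<beta> i *\<^sub>R A i x) \<in> commutant S"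
proof -
  have S: "linear S" using assms(3) by (simp add: bounded_operators_def bounded_linear.linear)
  have "bounded_linear (\<lambda>x. \<Sum>i\<in>F. \<beta> i *\<^sub>R A i x)"
    using assms(2) by (intro bounded_linear_sum bounded_linear_compose[OF bounded_linear_scaleR_right]) (auto simp: commutant_iff)
  moreover have "(\<Sum>i\<in>F. \<beta> i *\<^sub>R A i (smul c x)) = smul c (\<Sum>i\<in>F. \<beta> i *\<^sub>R A i x)" for c x
    using assms(2) by (simp add: commutant_iff scale_sum_right smul_scaleR)
  moreover have "(\<Sum>i\<in>F. \<beta> i *\<^sub>R A i (S x)) = S (\<Sum>i\<in>F. \<beta> i *\<^sub>R A i x)" for x
    using assms(2) by (simp add: commutant_iff linear_sum[OF S] linear_scale[OF S])
  ultimately show ?thesis by (simp add: commutant_iff)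
qed

text \<open>The kernel of \<open>P\<close> is closed and invariant under the commutant, so one
  nonzero vector in it forces it to be the whole space. This serves twice: with \<open>P = S\<close>
  for injectivity, and with a polynomial in \<open>S\<close>.\<close>

lemma kernel_hyperinvariant:
  assumes P: "bounded_linear P" "\<And>c x. P (smul c x) = smul c (P x)"
    and comm: "\<And>T x. T \<in> commutant S \<Longrightarrow> T (P x) = P (T x)"
    and x: "x \<noteq> 0" "P x = 0" and no: "\<And>M. \<not> nontrivial_hyperinvariant smul S M"
  shows "P y = 0"
proof -
  interpret P: bounded_linear P by (rule P(1))
  let ?M = "{x. P x = 0}"
  have "subspace ?M" unfolding subspace_def by (simp add: P.zero P.add P(2))
  moreover have "closed ?M"
    by (intro closed_Collect_eq continuous_intros linear_continuous_on P(1))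
  moreover have "?M \<noteq> {0}" using x by blast
  moreover have "T ` ?M \<subseteq> ?M" if "T \<in> bounded_operators smul" "T \<circ> S = S \<circ> T" for T
  proof -
    have T: "T \<in> commutant S" using that by (simp add: commutant_def)
    then have "T 0 = 0" by (auto simp: commutant_iff dest: linear_0[OF bounded_linear.linear])
    then show ?thesis using comm[OF T] by (metis (mono_tags, lifting) image_subsetI mem_Collect_eq)
  qed
  ultimately have "?M = UNIV" using no[of ?M] unfolding nontrivial_hyperinvariant_def by blast
  then show ?thesis by blast
qed

text \<open>The commutant is an algebra containing the identity, so the closure of the orbit of
  \<open>y\<close> is a closed invariant subspace containing \<open>y\<close>, hence the whole
  space.\<close>

lemma orbit_dense:
  assumes S: "S \<in> bounded_operators smul" and y: "y \<noteq> 0"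
    and no: "\<And>M. \<not> nontrivial_hyperinvariant smul S M" and e: "e > 0"
  obtains A where "A \<in> commutant S" "norm (A y - z) < e"
proof -
  interpret smul: bounded_bilinear smul by (rule bilinear_smul)
  let ?O = "(\<lambda>A. A y) ` commutant S"
  have O_add: "u + v \<in> ?O" if uv: "u \<in> ?O" "v \<in> ?O" for u v
  proof -
    obtain A A' where A: "A \<in> commutant S" "A' \<in> commutant S" "u = A y" "v = A' y" using uv by blast
    have lin: "linear S" using S by (simp add: bounded_operators_def bounded_linear.linear)
    have "(\<lambda>x. A x + A' x) \<in> commutant S"
      using A(1,2) by (auto simp: commutant_iff scale_right_distrib linear_add[OF lin] intro: bounded_linear_add)
    then show ?thesis using A(3,4) by force
  qed
  have O_scale: "smul c u \<in> ?O" if u: "u \<in> ?O" for c u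
  proof -
    obtain A where A: "A \<in> commutant S" "u = A y" using u by blast
    have "(\<lambda>x. smul c (A x)) \<in> commutant S"
      using A(1) S by (auto simp: commutant_iff bounded_operators_def mult.commute
          intro: bounded_linear_compose[OF smul.bounded_linear_right])
    then show ?thesis using A(2) by force
  qed
  have id: "(\<lambda>x. x) \<in> commutant S" by (simp add: commutant_iff bounded_linear_ident)
  have yO: "y \<in> ?O" using id by force
  have O_inv: "T u \<in> ?O" if Tu: "T \<in> commutant S" "u \<in> ?O" for T u
  proof -
    obtain A where A: "A \<in> commutant S" "u = A y" using Tu by blast
    have "(\<lambda>x. T (A x)) \<in> commutant S"
      using A(1) Tu(1) by (auto simp: commutant_iff intro: bounded_linear_compose)
    then show ?thesis using A(2) by force
  qed
  have "subspace (closure ?O)"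
    unfolding subspace_def
  proof (intro conjI ballI allI)
    have "0 \<in> ?O" using O_scale[OF yO, of 0] by (simp only: scale_zero_left)
    then show "0 \<in> closure ?O" by (rule subsetD[OF closure_subset])
  next
    fix u v assume "u \<in> closure ?O" "v \<in> closure ?O"
    then have ex: "(\<exists>f. (\<forall>n. f n \<in> ?O) \<and> f \<longlonglongrightarrow> u)" "(\<exists>g. (\<forall>n. g n \<in> ?O) \<and> g \<longlonglongrightarrow> v)"
      unfolding closure_sequential .
    from ex(1) obtain f where f: "\<forall>n. f n \<in> ?O" "f \<longlonglongrightarrow> u" by (elim exE conjE) (rule that)
    from ex(2) obtain g where g: "\<forall>n. g n \<in> ?O" "g \<longlonglongrightarrow> v" by (elim exE conjE) (rule that)
    have "f n + g n \<in> ?O" for n using f(1) g(1) by (intro O_add) simp_all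
    then show "u + v \<in> closure ?O" unfolding closure_sequential
      using tendsto_add[OF f(2) g(2)] by (intro exI[of _ "\<lambda>n. f n + g n"]) simp
  next
    fix c u assume "u \<in> closure ?O"
    then have "\<exists>f. (\<forall>n. f n \<in> ?O) \<and> f \<longlonglongrightarrow> u" unfolding closure_sequential .
    then obtain f where f: "\<forall>n. f n \<in> ?O" "f \<longlonglongrightarrow> u" by (elim exE conjE) (rule that)
    have "smul c (f n) \<in> ?O" for n using f(1) by (intro O_scale) simp
    then show "smul c u \<in> closure ?O" unfolding closure_sequential
      using smul.tendsto[OF tendsto_const f(2)] by (intro exI[of _ "\<lambda>n. smul c (f n)"]) simp
  qed
  moreover have "y \<in> closure ?O" by (rule subsetD[OF closure_subset yO])
  then have "closure ?O \<noteq> {0}" using y by blast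
  moreover have "T ` closure ?O \<subseteq> closure ?O" if "T \<in> bounded_operators smul" "T \<circ> S = S \<circ> T" for T
  proof (rule image_closure_subset)
    have T: "T \<in> commutant S" using that by (simp add: commutant_def)
    then show "continuous_on (closure ?O) T" by (intro linear_continuous_on) (simp add: commutant_iff)
    show "T ` ?O \<subseteq> closure ?O" by (rule subset_trans[OF _ closure_subset]) (use O_inv[OF T] in blast)
  qed simp
  ultimately have "closure ?O = UNIV" using no[of "closure ?O"] unfolding nontrivial_hyperinvariant_def by blast
  then have "z \<in> closure ?O" by blast
  then obtain u where "u \<in> ?O" "dist u z < e" using e unfolding closure_approachable by blast
  then show ?thesis using that by (auto simp: dist_norm)
qed

lemma compact_identity_finite_dimensional:
  assumes C: "compact (C :: 'a set)" "cball 0 1 \<subseteq> C" and inf: "infinite_dimensional smul (UNIV :: 'a set)"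
  shows False
proof -
  obtain B :: "'a set" where B: "finite B" "UNIV \<subseteq> Real_Vector_Spaces.span B"
    by (rule riesz_finite_dimensional[of UNIV C]) (use C in auto)
  have "Real_Vector_Spaces.span B \<subseteq> span B"
  proof (rule real_vector.span_minimal)
    show "B \<subseteq> span B" by (rule span_superset)
    show "Real_Vector_Spaces.subspace (span B)"
      unfolding Real_Vector_Spaces.subspace_def by (metis scale_of_real span_add span_scale span_zero)
  qed
  then show False using inf B unfolding infinite_dimensional_def by blast
qed

text \<open>The compact set \<open>Q\<close>, the closure of the image of a ball around
  \<open>x0\<close>, avoids 0, so each of its points is sent back into the ball by some operator of
  the commutant, and finitely many operators suffice. Approximate fixed points of their combinations
  have, along a subsequence, convergent images under \<open>K\<close> and convergent coefficients.
  This makes the points themselves converge, to \<open>T y\<close> with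
  \<open>y = K (T y)\<close>.\<close>

lemma fixed_vector_of_compact_power:
  assumes S: "S \<in> bounded_operators smul" and K: "K = S ^^ n"
    and comp: "compact (closure (K ` cball 0 1))" and w: "K w \<noteq> 0"
    and no: "\<And>M. \<not> nontrivial_hyperinvariant smul S M"
  obtains T x where "T \<in> commutant S" "x \<noteq> 0" "T (K x) = x"
proof -
  have blK: "bounded_linear K" using S unfolding K bounded_operators_def by (simp add: bounded_linear_funpow)
  interpret K: bounded_linear K by (rule blK)
  obtain L where L: "\<And>v. norm (K v) \<le> norm v * L" using K.bounded by blast
  \<comment> \<open>On the unit ball around \<open>x0\<close> the values of \<open>K\<close> move by
    at most \<open>\<bar>L\<bar>\<close>. The scaling makes \<open>norm (K x0)\<close> exceed this
    by 1, so the image of the ball keeps distance 1 from the origin.\<close>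
  define x0 where "x0 = ((\<bar>L\<bar> + 1) / norm (K w)) *\<^sub>R w"
  have Kx0: "norm (K x0) = \<bar>L\<bar> + 1" using w by (simp add: x0_def K.scaleR)
  have KB: "norm (K v) \<ge> 1" if "v \<in> cball x0 1" for v
  proof -
    have "norm (K (x0 - v)) \<le> \<bar>L\<bar>"
    proof -
      have "norm (K (x0 - v)) \<le> norm (x0 - v) * \<bar>L\<bar>"
        using L[of "x0 - v"] by (meson abs_ge_self mult_left_mono norm_ge_zero order_trans)
      also have "\<dots> \<le> 1 * \<bar>L\<bar>" using that by (intro mult_right_mono) (auto simp: dist_norm)
      finally show ?thesis by simp
    qed
    moreover have "norm (K x0) \<le> norm (K v) + norm (K (x0 - v))"
      using norm_triangle_ineq[of "K v" "K (x0 - v)"] by (simp add: K.diff)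
    ultimately show ?thesis using Kx0 by linarith
  qed
  define Q where "Q = closure (K ` cball x0 1)"
  have "K ` cball x0 1 \<subseteq> (\<lambda>v. K x0 + v) ` closure (K ` cball 0 1)"
  proof
    fix z assume "z \<in> K ` cball x0 1"
    then obtain v where v: "z = K v" "norm (x0 - v) \<le> 1" by (auto simp: dist_norm)
    have "K (v - x0) \<in> closure (K ` cball 0 1)"
      by (rule subsetD[OF closure_subset], rule imageI) (use v(2) in \<open>simp add: norm_minus_commute\<close>)
    moreover have "z = K x0 + K (v - x0)" by (simp add: v K.diff)
    ultimately show "z \<in> (\<lambda>v. K x0 + v) ` closure (K ` cball 0 1)" by blast
  qed
  moreover have c1: "compact ((\<lambda>v. K x0 + v) ` closure (K ` cball 0 1))"
    by (intro compact_continuous_image comp continuous_intros)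
  ultimately have "Q \<subseteq> (\<lambda>v. K x0 + v) ` closure (K ` cball 0 1)"
    unfolding Q_def using compact_imp_closed closure_minimal by blast
  then have "(\<lambda>v. K x0 + v) ` closure (K ` cball 0 1) \<inter> Q = Q" by blast
  then have Qc: "compact Q"
    using compact_Int_closed[OF c1 closed_closure[of "K ` cball x0 1"]] by (simp add: Q_def)
  have KQ: "K ` cball x0 1 \<subseteq> Q" unfolding Q_def by (rule closure_subset)
  have Qn: "norm y \<ge> 1" if "y \<in> Q" for y
  proof -
    have "Q \<subseteq> {y. norm y \<ge> 1}"
      unfolding Q_def using KB by (intro closure_minimal closed_Collect_le continuous_intros) auto
    then show ?thesis using that by blast
  qed
  have bl: "bounded_linear A" if "A \<in> commutant S" for A using that by (simp add: commutant_iff)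
  have "Q \<subseteq> (\<Union>A\<in>commutant S. {y. norm (A y - x0) < 1})"
  proof
    fix y assume "y \<in> Q"
    then have "y \<noteq> 0" using Qn[of y] by auto
    then obtain A where "A \<in> commutant S" "norm (A y - x0) < 1" by (rule orbit_dense[OF S _ no, of y 1 x0]) auto
    then show "y \<in> (\<Union>A\<in>commutant S. {y. norm (A y - x0) < 1})" by blast
  qed
  moreover have "open {y. norm (A y - x0) < 1}" if "A \<in> commutant S" for A
    by (intro open_Collect_less continuous_intros linear_continuous_on bl that)
  ultimately obtain \<A> where A: "\<A> \<subseteq> commutant S" "finite \<A>" "Q \<subseteq> (\<Union>A\<in>\<A>. {y. norm (A y - x0) < 1})"
    using compactE_image[OF Qc, of "commutant S" "\<lambda>A. {y. norm (A y - x0) < 1}"] by metis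
  have "\<forall>A. \<exists>k. A \<in> \<A> \<longrightarrow> (\<forall>v. norm (A v) \<le> norm v * k)"
    using A(1) bl bounded_linear.bounded by blast
  from choice[OF this] obtain k where k: "\<forall>A. A \<in> \<A> \<longrightarrow> (\<forall>v. norm (A v) \<le> norm v * k A)" ..
  define R where "R = (\<Sum>A\<in>\<A>. \<bar>k A\<bar>)"
  have R0: "R \<ge> 0" unfolding R_def by (simp add: sum_nonneg)
  have R: "norm (A v) \<le> R * norm v" if "A \<in> \<A>" for A v
  proof -
    have "\<bar>k A\<bar> \<le> R" unfolding R_def using that A(2) by (intro member_le_sum) auto
    then have "k A \<le> R" by linarith
    then have "norm v * k A \<le> norm v * R" by (intro mult_left_mono) auto
    then show ?thesis using k that by (metis mult.commute order_trans)
  qed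
  have "\<exists>p. fst p \<in> cball x0 1 \<and> (\<forall>A\<in>\<A>. \<bar>snd p A\<bar> \<le> (1::real)) \<and>
      norm (fst p - (\<Sum>A\<in>\<A>. snd p A *\<^sub>R A (K (fst p)))) \<le> R * (1 / real (Suc k))" for k
  proof -
    have "\<exists>x \<beta>. x \<in> cball x0 1 \<and> (\<forall>A\<in>\<A>. \<bar>\<beta> A\<bar> \<le> (1::real)) \<and>
      norm (x - (\<Sum>A\<in>\<A>. \<beta> A *\<^sub>R A (K x))) \<le> R * (1 / real (Suc k))"
    proof (rule approximate_fixed_combination[where Q = Q])
      show "continuous_on UNIV K" by (rule linear_continuous_on[OF blK])
      show "Q \<noteq> {}" using KQ by fastforce
      show "\<exists>A\<in>\<A>. norm (A q - x0) \<le> 1" if q: "q \<in> Q" for q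
      proof -
        have "q \<in> (\<Union>A\<in>\<A>. {y. norm (A y - x0) < 1})" using A(3) q by (rule subsetD)
        then obtain A where "A \<in> \<A>" "norm (A q - x0) < 1" by auto
        then show ?thesis by (intro bexI[of _ A]) simp_all
      qed
      show "linear A" if "A \<in> \<A>" for A using A(1) that bl bounded_linear.linear by blast
      show "norm (A v) \<le> R * norm v" if "A \<in> \<A>" for A v using R that .
    qed (use Qc KQ A(2) R0 in auto)
    then show ?thesis by auto
  qed
  then have "\<forall>k. \<exists>p. fst p \<in> cball x0 1 \<and> (\<forall>A\<in>\<A>. \<bar>snd p A\<bar> \<le> (1::real)) \<and>
      norm (fst p - (\<Sum>A\<in>\<A>. snd p A *\<^sub>R A (K (fst p)))) \<le> R * (1 / real (Suc k))" ..
  from choice[OF this] obtain p where p: "\<forall>k. fst (p k) \<in> cball x0 1 \<and> (\<forall>A\<in>\<A>. \<bar>snd (p k) A\<bar> \<le> (1::real)) \<and>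
      norm (fst (p k) - (\<Sum>A\<in>\<A>. snd (p k) A *\<^sub>R A (K (fst (p k))))) \<le> R * (1 / real (Suc k))" ..
  define x where "x k = fst (p k)" for k
  define \<beta> where "\<beta> k = snd (p k)" for k
  have "\<forall>k. K (x k) \<in> Q" using p KQ unfolding x_def by blast
  then have "\<exists>y\<in>Q. \<exists>r. strict_mono r \<and> ((\<lambda>k. K (x k)) \<circ> r) \<longlonglongrightarrow> y" using Qc unfolding compact_def by simp
  then obtain y r where r: "strict_mono (r :: nat \<Rightarrow> nat)" "(\<lambda>k. K (x (r k))) \<longlonglongrightarrow> y" unfolding comp_def by blast
  have "\<exists>s l. strict_mono (s :: nat \<Rightarrow> nat) \<and> (\<forall>A\<in>\<A>. (\<lambda>k. \<beta> (r (s k)) A) \<longlonglongrightarrow> l A)"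
    by (rule bounded_family_convergent_subseq[OF A(2)]) (use p in \<open>simp add: \<beta>_def\<close>)
  then obtain s l where s: "strict_mono (s :: nat \<Rightarrow> nat)" "\<And>A. A \<in> \<A> \<Longrightarrow> (\<lambda>k. \<beta> (r (s k)) A) \<longlonglongrightarrow> l A" by blast
  define t where "t k = r (s k)" for k
  have t: "strict_mono t" unfolding t_def using strict_mono_o[OF r(1) s(1)] by (simp add: comp_def)
  have Kt: "(\<lambda>k. K (x (t k))) \<longlonglongrightarrow> y" unfolding t_def using LIMSEQ_subseq_LIMSEQ[OF r(2) s(1)] by (simp add: comp_def)
  define T where "T v = (\<Sum>A\<in>\<A>. l A *\<^sub>R A v)" for v
  have T: "T \<in> commutant S" unfolding T_def[abs_def] using A(1,2) S by (intro commutant_sum) auto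
  have lim: "(\<lambda>k. \<Sum>A\<in>\<A>. \<beta> (t k) A *\<^sub>R A (K (x (t k)))) \<longlonglongrightarrow> T y"
    unfolding T_def
  proof (intro tendsto_sum tendsto_scaleR)
    show "(\<lambda>k. \<beta> (t k) A) \<longlonglongrightarrow> l A" if "A \<in> \<A>" for A using s(2)[OF that] by (simp add: t_def)
    show "(\<lambda>k. A (K (x (t k)))) \<longlonglongrightarrow> A y" if "A \<in> \<A>" for A
      using bounded_linear.tendsto[OF bl Kt] A(1) that by blast
  qed
  have "(\<lambda>k. R * (1 / real (Suc k))) \<longlonglongrightarrow> R * 0"
    by (intro tendsto_mult tendsto_const LIMSEQ_Suc[OF lim_const_over_n])
  then have "(\<lambda>k. R * (1 / real (Suc (t k)))) \<longlonglongrightarrow> 0"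
    using LIMSEQ_subseq_LIMSEQ[OF _ t, of "\<lambda>k. R * (1 / real (Suc k))"] by (simp add: comp_def)
  then have "(\<lambda>k. x (t k) - (\<Sum>A\<in>\<A>. \<beta> (t k) A *\<^sub>R A (K (x (t k))))) \<longlonglongrightarrow> 0"
    by (rule Lim_null_comparison[rotated]) (use p in \<open>simp add: x_def \<beta>_def\<close>)
  from tendsto_add[OF this lim] have xt: "(\<lambda>k. x (t k)) \<longlonglongrightarrow> T y" by simp
  have "y = K (T y)" using LIMSEQ_unique[OF Kt K.tendsto[OF xt]] .
  moreover have "T y \<noteq> 0"
  proof
    assume "T y = 0"
    have "T y \<in> cball x0 1" using closed_sequentially[OF closed_cball _ xt] p by (simp add: x_def)
    then show False using KB[of "T y"] \<open>T y = 0\<close> by (simp add: K.zero)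
  qed
  ultimately show ?thesis using that[OF T, of "T y"] by simp
qed

theorem hyperinvariant_of_compact_power:
  assumes S: "S \<in> bounded_operators smul" and S0: "S \<noteq> (\<lambda>_. 0)"
    and comp: "compact (closure ((S ^^ Suc n) ` cball 0 1))"
    and inf: "infinite_dimensional smul (UNIV :: 'a set)"
  shows "\<exists>M. nontrivial_hyperinvariant smul S M"
proof (rule ccontr)
  assume "\<not> ?thesis"
  then have no: "\<And>M. \<not> nontrivial_hyperinvariant smul S M" by blast
  have blS: "bounded_linear S" and smulS: "\<And>c x. S (smul c x) = smul c (S x)"
    using S by (auto simp: bounded_operators_def)
  interpret S: bounded_linear S by (rule blS)
  have pow_lin: "bounded_linear (S ^^ i)" for i using blS by (rule bounded_linear_funpow)
  have pow_smul: "(S ^^ i) (smul c x) = smul c ((S ^^ i) x)" for i c x by (induction i) (simp_all add: smulS)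
  have injS: "x = 0" if "S x = 0" for x
    using kernel_hyperinvariant[of S S x] blS smulS that no S0 by (auto simp: commutant_iff)
  have inj_pow: "x = 0" if "(S ^^ i) x = 0" for i x using that by (induction i) (auto dest: injS)
  obtain w :: 'a where "w \<noteq> 0"
    using inf unfolding infinite_dimensional_def by (metis (full_types) finite.emptyI span_zero subsetI)
  then have w: "(S ^^ Suc n) w \<noteq> 0" using inj_pow by blast
  obtain T x where T: "T \<in> commutant S" "x \<noteq> 0" "T ((S ^^ Suc n) x) = x"
    by (rule fixed_vector_of_compact_power[OF S refl comp w no])
  have blT: "bounded_linear T" using T(1) by (simp add: commutant_iff)
  let ?Y = "{v. T ((S ^^ Suc n) v) = v}"
  have Ysub: "Real_Vector_Spaces.subspace ?Y"
    by (rule subspace_fixed_points[OF bounded_linear.linear[OF bounded_linear_compose[OF blT pow_lin]]])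
  have "compact (T ` closure ((S ^^ Suc n) ` cball 0 1))"
    by (intro compact_continuous_image comp linear_continuous_on blT)
  moreover have "?Y \<inter> cball 0 1 \<subseteq> T ` closure ((S ^^ Suc n) ` cball 0 1)"
  proof
    fix v assume v: "v \<in> ?Y \<inter> cball 0 1"
    have "(S ^^ Suc n) v \<in> closure ((S ^^ Suc n) ` cball 0 1)"
      by (rule subsetD[OF closure_subset imageI[OF IntD2[OF v]]])
    then show "v \<in> T ` closure ((S ^^ Suc n) ` cball 0 1)"
      by (rule image_eqI[of v T "(S ^^ Suc n) v", OF IntD1[OF v, unfolded mem_Collect_eq, symmetric]])
  qed
  ultimately obtain B where B: "finite B" "?Y \<subseteq> Real_Vector_Spaces.span B"
    by (rule riesz_finite_dimensional[OF Ysub])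
  have TK_S: "T ((S ^^ Suc n) (S u)) = S (T ((S ^^ Suc n) u))" for u
  proof -
    have "(S ^^ Suc n) (S u) = S ((S ^^ Suc n) u)" by (rule funpow_swap1[symmetric])
    moreover have "T (S v) = S (T v)" for v using T(1) unfolding commutant_iff by blast
    ultimately show ?thesis by (simp only:)
  qed
  have orbit: "(S ^^ i) x \<in> ?Y" for i
  proof (induction i)
    case 0
    have "(S ^^ 0) x = x" by simp
    then show ?case using T(3) by (simp only: mem_Collect_eq)
  next
    case (Suc i)
    have "(S ^^ Suc i) x = S ((S ^^ i) x)" by simp
    then show ?case using Suc by (simp only: TK_S mem_Collect_eq)
  qed
  have "(S ^^ i) x \<in> Real_Vector_Spaces.span B" for i using orbit B(2) by blast
  then obtain r d where r: "(\<Sum>i\<le>d. r i *\<^sub>R (S ^^ i) x) = 0" "\<exists>i\<le>d. r i \<noteq> 0"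
    using real_vector.linear_dependence_of_sequence[OF B(1), of "\<lambda>i. (S ^^ i) x"] by meson
  \<comment> \<open>The lowest power is divided out: \<open>S ^^ k\<close> is injective, so the
    relation at \<open>x\<close> reduces to \<open>P x = 0\<close> for a polynomial with constant
    term \<open>r k\<close>, which is nonzero.\<close>
  define k where "k = (LEAST i. r i \<noteq> 0)"
  have rk: "r k \<noteq> 0" unfolding k_def using r(2) by (metis (mono_tags) LeastI)
  have rk0: "r i = 0" if "i < k" for i using that not_less_Least unfolding k_def by blast
  have kd: "k \<le> d" using r(2) rk0 by (meson le_trans not_le)
  define P where "P v = (\<Sum>i\<le>d - k. r (k + i) *\<^sub>R (S ^^ i) v)" for v
  have "(S ^^ k) (P x) = (\<Sum>i\<le>d - k. r (k + i) *\<^sub>R (S ^^ (k + i)) x)"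
    unfolding P_def by (simp add: linear_sum[OF bounded_linear.linear[OF pow_lin]]
        linear_scale[OF bounded_linear.linear[OF pow_lin]] funpow_add)
  also have "\<dots> = (\<Sum>i\<in>{k..d}. r i *\<^sub>R (S ^^ i) x)"
    using kd by (intro sum.reindex_bij_witness[of _ "\<lambda>i. i - k" "\<lambda>i. k + i"]) auto
  also have "\<dots> = (\<Sum>i\<le>d. r i *\<^sub>R (S ^^ i) x)" by (rule sum.mono_neutral_left) (auto simp: rk0)
  finally have Px: "P x = 0" using r(1) inj_pow by simp
  have P0: "P v = 0" for v
  proof (rule kernel_hyperinvariant[where P = P and S = S and x = x])
    show "bounded_linear P" unfolding P_def
      by (intro bounded_linear_sum bounded_linear_compose[OF bounded_linear_scaleR_right] pow_lin)
    show "P (smul c u) = smul c (P u)" for c u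
      unfolding P_def by (simp add: pow_smul scale_sum_right smul_scaleR)
    show "A (P u) = P (A u)" if A: "A \<in> commutant S" for A u
    proof -
      have "linear A" using A by (simp add: commutant_iff bounded_linear.linear)
      then show ?thesis unfolding P_def by (simp add: linear_sum linear_scale commutant_funpow[OF A])
    qed
  qed (fact T(2) Px no)+
  \<comment> \<open>Solving \<open>P = 0\<close> for its constant term writes the identity as
    \<open>V \<circ> S\<close>, with \<open>V\<close> again a polynomial in
    \<open>S\<close>.\<close>
  define V where "V v = (\<Sum>i<d - k. (- r (k + Suc i) / r k) *\<^sub>R (S ^^ i) v)" for v
  have blV: "bounded_linear V" unfolding V_def
    by (intro bounded_linear_sum bounded_linear_compose[OF bounded_linear_scaleR_right] pow_lin)
  have VS: "V (S v) = v" for v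
  proof -
    have "P v = r k *\<^sub>R v + (\<Sum>i<d - k. r (k + Suc i) *\<^sub>R (S ^^ Suc i) v)"
      unfolding P_def by (subst sum.atMost_shift) simp
    also have "(\<Sum>i<d - k. r (k + Suc i) *\<^sub>R (S ^^ Suc i) v) = - (r k *\<^sub>R V (S v))"
      unfolding V_def scaleR_sum_right sum_negf[symmetric] using rk by (intro sum.cong) (simp_all add: funpow_swap1)
    finally have "r k *\<^sub>R (v - V (S v)) = 0" using P0[of v] by (simp add: scaleR_diff_right)
    then show ?thesis using rk by simp
  qed
  have VpowS: "(V ^^ i) ((S ^^ i) v) = v" for i v
    by (induction i arbitrary: v) (simp_all add: VS funpow_swap1)
  have "compact ((V ^^ Suc n) ` closure ((S ^^ Suc n) ` cball 0 1))"
    by (intro compact_continuous_image comp linear_continuous_on bounded_linear_funpow blV)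
  moreover have "cball 0 1 \<subseteq> (V ^^ Suc n) ` closure ((S ^^ Suc n) ` cball 0 1)"
  proof
    fix v :: 'a assume v: "v \<in> cball 0 1"
    have "(S ^^ Suc n) v \<in> closure ((S ^^ Suc n) ` cball 0 1)"
      by (rule subsetD[OF closure_subset imageI[OF v]])
    then show "v \<in> (V ^^ Suc n) ` closure ((S ^^ Suc n) ` cball 0 1)"
      by (rule image_eqI[of v "V ^^ Suc n" "(S ^^ Suc n) v", OF VpowS[symmetric]])
  qed
  ultimately show False by (rule compact_identity_finite_dimensional) (rule inf)
qed

end

section \<open>Compact powers of strictly singular operators\<close>

text \<open>Without total boundedness, points can be added forever. The radius \<open>e / 2\<close>
  leaves room for closed balls: a finite union of them is closed, so if it covered \<open>A\<close>
  it would cover the closure, and so would the balls of radius \<open>e\<close>.\<close>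

lemma separated_sequence:
  fixes A :: "'a::complete_space set"
  assumes "\<not> compact (closure A)"
  obtains x :: "nat \<Rightarrow> 'a" and \<delta> where "\<delta> > 0" "\<And>n. x n \<in> A" "\<And>m n. m < n \<Longrightarrow> \<delta> \<le> dist (x m) (x n)"
proof -
  have "complete (closure A)" by (simp add: complete_eq_closed)
  then obtain e where e: "e > 0" "\<And>k. finite k \<Longrightarrow> \<not> closure A \<subseteq> (\<Union>x\<in>k. ball x e)"
    using assms unfolding compact_eq_totally_bounded by blast
  have step: "\<exists>a\<in>A. \<forall>x\<in>k. e / 2 \<le> dist x a" if k: "finite k" for k
  proof (rule ccontr)
    assume "\<not> ?thesis"
    then have "A \<subseteq> (\<Union>x\<in>k. cball x (e / 2))" by (force simp: not_le)
    moreover have "closed (\<Union>x\<in>k. cball x (e / 2))" using k by (intro closed_UN) auto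
    ultimately have "closure A \<subseteq> (\<Union>x\<in>k. cball x (e / 2))" by (rule closure_minimal)
    also have "\<dots> \<subseteq> (\<Union>x\<in>k. ball x e)" using e(1) by force
    finally show False using e(2)[OF k] by blast
  qed
  have "\<forall>k. \<exists>a. finite k \<longrightarrow> a \<in> A \<and> (\<forall>x\<in>k. e / 2 \<le> dist x a)" using step by blast
  from choice[OF this] obtain f where f: "\<forall>k. finite k \<longrightarrow> f k \<in> A \<and> (\<forall>x\<in>k. e / 2 \<le> dist x (f k))" ..
  define S where "S = rec_nat {} (\<lambda>n k. insert (f k) k)"
  have S: "S 0 = {}" "\<And>n. S (Suc n) = insert (f (S n)) (S n)" by (simp_all add: S_def)
  have fin: "finite (S n)" for n by (induction n) (simp_all add: S)
  have mem: "f (S m) \<in> S n" if "m < n" for m n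
    using that by (induction n) (auto simp: S less_Suc_eq)
  show ?thesis
  proof (rule that[of "e / 2" "\<lambda>n. f (S n)"])
    show "e / 2 > 0" using e(1) by simp
    show "f (S n) \<in> A" for n using f fin by blast
    show "e / 2 \<le> dist (f (S m)) (f (S n))" if "m < n" for m n using f fin mem[OF that] by blast
  qed
qed

context banach_space_over
begin

lemma bounded_operators_funpow:
  assumes "S \<in> bounded_operators smul" shows "S ^^ i \<in> bounded_operators smul"
proof -
  have "(S ^^ i) (smul c x) = smul c ((S ^^ i) x)" for c x
    using assms by (induction i) (simp_all add: bounded_operators_def)
  then show ?thesis using assms by (simp add: bounded_operators_def bounded_linear_funpow)
qed

lemma operator_sum:
  assumes "S \<in> bounded_operators smul"
  shows "S (\<Sum>i\<in>F. smul (a i) (x i)) = (\<Sum>i\<in>F. smul (a i) (S (x i)))"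
  using assms by (simp add: bounded_operators_def linear_sum bounded_linear.linear)

lemma operator_bound:
  assumes "S \<in> bounded_operators smul"
  obtains L where "L \<ge> 1" "\<And>v. norm (S v) \<le> L * norm v"
proof -
  obtain K where K: "\<And>x. norm (S x) \<le> norm x * K"
    using assms bounded_linear.bounded unfolding bounded_operators_def by blast
  have "norm (S v) \<le> (\<bar>K\<bar> + 1) * norm v" for v
  proof -
    have "norm v * K \<le> norm v * (\<bar>K\<bar> + 1)" by (intro mult_left_mono) auto
    then show ?thesis unfolding mult.commute[of "\<bar>K\<bar> + 1"] by (rule order_trans[OF K])
  qed
  then show ?thesis using that[of "\<bar>K\<bar> + 1"] by simp
qed

lemma weakly_null_operator:
  assumes "weakly_null smul x" "T \<in> bounded_operators smul"
  shows "weakly_null smul (\<lambda>n. T (x n))"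
  unfolding weakly_null_def
proof
  fix \<phi> assume \<phi>: "\<phi> \<in> dual_space smul"
  have "bounded_linear (\<lambda>x. \<phi> (T x))"
    using \<phi> assms(2) by (intro bounded_linear_compose[of \<phi> T]) (simp_all add: dual_space_def bounded_operators_def)
  then have "(\<lambda>x. \<phi> (T x)) \<in> dual_space smul"
    using \<phi> assms(2) by (simp add: dual_space_def bounded_operators_def)
  then show "(\<lambda>n. \<phi> (T (x n))) \<longlonglongrightarrow> 0" using assms(1) unfolding weakly_null_def by fastforce
qed

lemma weakly_null_subseq:
  assumes "weakly_null smul x" "strict_mono r"
  shows "weakly_null smul (\<lambda>n. x (r n))"
  using assms LIMSEQ_subseq_LIMSEQ unfolding weakly_null_def comp_def by blast

text \<open>The inequality is a closed condition, so it passes from combinations to the closed spans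
  in the definition of strict singularity, where the choice \<open>\<epsilon> = 1 / (2 * C)\<close>
  contradicts it. All later contradictions take this form.\<close>

lemma not_bounded_below_on_family:
  assumes S: "S \<in> family_strictly_singular smul \<F>" and fin: "\<And>F. F \<in> \<F> \<Longrightarrow> finite F"
    and x: "basic_sequence smul x" and C: "C > 0"
    and low: "\<And>F a. F \<in> \<F> \<Longrightarrow> norm (\<Sum>i\<in>F. smul (a i) (x i)) \<le> C * norm (S (\<Sum>i\<in>F. smul (a i) (x i)))"
  shows False
proof -
  have bl: "bounded_linear S" using S by (simp add: family_strictly_singular_def bounded_operators_def)
  define \<epsilon> where "\<epsilon> = 1 / (2 * C)"
  have "\<epsilon> > 0" using C by (simp add: \<epsilon>_def)
  then obtain F z where F: "F \<in> \<F>" "z \<in> closure (span (x ` F)) - {0}" "norm (S z) \<le> \<epsilon> * norm z"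
    using S x unfolding family_strictly_singular_def by blast
  have "span (x ` F) \<subseteq> {w. norm w \<le> C * norm (S w)}"
  proof
    fix w assume w: "w \<in> span (x ` F)"
    have "\<exists>a. w = (\<Sum>i\<in>F. smul (a i) (x i))"
      using w
    proof (induction rule: span_induct_alt)
      case base
      show ?case by (intro exI[of _ "\<lambda>_. 0"]) simp
    next
      case (step c v w)
      then obtain i a where i: "i \<in> F" "v = x i" and a: "w = (\<Sum>i\<in>F. smul (a i) (x i))" by blast
      have "(\<Sum>l\<in>F. smul (if l = i then c + a l else a l) (x l)) =
          (\<Sum>l\<in>F. (if l = i then smul c (x l) else 0) + smul (a l) (x l))"
        by (rule sum.cong) (simp_all add: scale_left_distrib)
      also have "\<dots> = smul c v + w"
        using fin[OF F(1)] i a by (simp add: sum.distrib)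
      finally show ?case by (intro exI[of _ "\<lambda>l. if l = i then c + a l else a l"]) simp
    qed
    then show "w \<in> {w. norm w \<le> C * norm (S w)}" using low[OF F(1)] by blast
  qed
  moreover have "closed {w. norm w \<le> C * norm (S w)}"
    by (intro closed_Collect_le continuous_intros linear_continuous_on bl)
  ultimately have "closure (span (x ` F)) \<subseteq> {w. norm w \<le> C * norm (S w)}" by (rule closure_minimal)
  then have "norm z \<le> C * norm (S z)" using F(2) by blast
  also have "\<dots> \<le> C * (\<epsilon> * norm z)" using F(3) C by (intro mult_left_mono) auto
  also have "\<dots> = norm z / 2" using C by (simp add: \<epsilon>_def)
  finally show False using F(2) by simp
qed

text \<open>In the l1-case of Rosenthal's theorem for the images, boundedness of \<open>S\<close>
  lifts the lower l1-estimate to the vectors themselves, which are then basic. Their upper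
  l1-estimate comes for free, so \<open>S\<close> is bounded below on all their
  combinations.\<close>

lemma weakly_Cauchy_image:
  assumes S: "S \<in> family_strictly_singular smul \<F>" and fin: "\<And>F. F \<in> \<F> \<Longrightarrow> finite F"
    and b: "\<And>n. norm (x n) \<le> M"
  obtains r :: "nat \<Rightarrow> nat" where "strict_mono r" "\<And>\<phi>. \<phi> \<in> dual_space smul \<Longrightarrow> convergent (\<lambda>n. \<phi> (S (x (r n))))"
proof -
  have S': "S \<in> bounded_operators smul" using S by (simp add: family_strictly_singular_def)
  obtain L where L: "L \<ge> 1" "\<And>v. norm (S v) \<le> L * norm v" using operator_bound[OF S'] by blast
  have M: "norm (S (x n)) \<le> L * M" for n
    using L(2)[of "x n"] mult_left_mono[OF b[of n], of L] L(1) by linarith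
  show ?thesis
  proof (cases rule: rosenthal_l1[of "\<lambda>n. S (x n)", OF M])
    case (1 r)
    then show ?thesis using that by blast
  next
    case (2 r \<delta>)
    define y where "y n = x (r n)" for n
    have Slow: "\<delta> * (\<Sum>i<n. norm (a i)) \<le> norm (S (\<Sum>i<n. smul (a i) (y i)))" for n a
      using 2(3) by (simp add: operator_sum[OF S'] y_def)
    have low: "\<delta> / L * (\<Sum>i<n. norm (a i)) \<le> norm (\<Sum>i<n. smul (a i) (y i))" for n a
      using order_trans[OF Slow[of a n] L(2)] L(1) by (simp add: field_simps)
    have dL: "\<delta> / L > 0" using 2(2) L(1) by simp
    have yM: "norm (y n) \<le> M" for n using b by (simp add: y_def)
    have M0: "M \<ge> 0" using b[of 0] norm_ge_zero order_trans by blast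
    have ylow: "\<delta> / L \<le> norm (y n)" for n
    proof -
      have "(\<Sum>i<Suc n. norm (if i = n then 1 else (0::'k))) = 1" by simp
      moreover have "(\<Sum>i<Suc n. smul (if i = n then 1 else 0) (y i)) = y n" by simp
      ultimately show ?thesis using low[of "\<lambda>i. if i = n then 1 else 0" "Suc n"] by (simp only: mult_1_right)
    qed
    have "basis_bound (M / (\<delta> / L)) y" by (rule l1_basis_bound[OF yM dL low])
    then have basic: "basic_sequence smul y"
      by (rule basis_bound_basic_sequence[OF _ divide_nonneg_pos[OF M0 dL] dL ylow])
    \<comment> \<open>\<open>M + 1\<close> in place of \<open>M\<close> gives a positive constant
      from \<open>M \<ge> 0\<close> alone.\<close>
    have "norm (\<Sum>i\<in>F. smul (a i) (y i)) \<le> (M + 1) / \<delta> * norm (S (\<Sum>i\<in>F. smul (a i) (y i)))" if F: "F \<in> \<F>" for F a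
    proof -
      obtain n where n: "F \<subseteq> {..<n}" using fin[OF F] finite_nat_bounded by blast
      define c where "c i = (if i \<in> F then a i else 0)" for i
      have eq: "(\<Sum>i<n. smul (c i) (y i)) = (\<Sum>i\<in>F. smul (a i) (y i))"
        using n by (intro sum.mono_neutral_cong_right) (auto simp: c_def)
      have "norm (\<Sum>i<n. smul (c i) (y i)) \<le> (\<Sum>i<n. norm (c i) * (M + 1))"
        using yM by (intro sum_norm_le) (auto simp: norm_scale intro!: mult_left_mono order_trans[OF yM])
      also have "\<dots> = (M + 1) / \<delta> * (\<delta> * (\<Sum>i<n. norm (c i)))"
        using 2(2) by (simp add: sum_distrib_right[symmetric])
      also have "\<dots> \<le> (M + 1) / \<delta> * norm (S (\<Sum>i<n. smul (c i) (y i)))"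
        using Slow M0 2(2) by (intro mult_left_mono) auto
      finally show ?thesis unfolding eq .
    qed
    moreover have "(M + 1) / \<delta> > 0" using M0 2(2) by (simp add: add_nonneg_pos)
    ultimately show ?thesis using not_bounded_below_on_family[OF S fin basic, of "(M + 1) / \<delta>"] by blast
  qed
qed

text \<open>Consecutive differences of a weakly Cauchy sequence are weakly null. One power of
  \<open>S\<close> is spent on weak Cauchyness, and the remaining \<open>S ^^ n\<close> maps the
  differences to differences of a separated sequence, which stay large.\<close>

lemma weakly_null_noncompact:
  assumes S: "S \<in> family_strictly_singular smul \<F>" and fin: "\<And>F. F \<in> \<F> \<Longrightarrow> finite F"
    and nc: "\<not> compact (closure ((S ^^ Suc n) ` cball 0 1))"
  obtains z \<delta> M where "weakly_null smul z" "\<delta> > 0" "\<And>k. norm (z k) \<le> M" "\<And>k. \<delta> \<le> norm ((S ^^ n) (z k))"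
proof -
  have S': "S \<in> bounded_operators smul" using S by (simp add: family_strictly_singular_def)
  have bln: "bounded_linear (S ^^ n)" using bounded_operators_funpow[OF S'] by (simp add: bounded_operators_def)
  interpret Sn: bounded_linear "S ^^ n" by (rule bln)
  obtain L where L: "L \<ge> 1" "\<And>v. norm (S v) \<le> L * norm v" using operator_bound[OF S'] by blast
  obtain w :: "nat \<Rightarrow> 'a" and \<delta> where w: "\<delta> > 0" "\<And>k. w k \<in> (S ^^ Suc n) ` cball 0 1" "\<And>i k. i < k \<Longrightarrow> \<delta> \<le> dist (w i) (w k)"
    by (rule separated_sequence[OF nc]) blast
  have "\<exists>v. w k = (S ^^ Suc n) v \<and> norm v \<le> 1" for k
    using w(2)[of k] by (rule imageE) (intro exI conjI, assumption, simp)
  then have "\<forall>k. \<exists>v. w k = (S ^^ Suc n) v \<and> norm v \<le> 1" ..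
  from choice[OF this] obtain x where x: "\<forall>k. w k = (S ^^ Suc n) (x k) \<and> norm (x k) \<le> 1" ..
  then have xb: "\<And>k. norm (x k) \<le> 1" and xw: "\<And>k. w k = (S ^^ Suc n) (x k)" by blast+
  obtain r :: "nat \<Rightarrow> nat" where r: "strict_mono r" "\<And>\<phi>. \<phi> \<in> dual_space smul \<Longrightarrow> convergent (\<lambda>k. \<phi> (S (x (r k))))"
    by (rule weakly_Cauchy_image[OF S fin xb, rotated]) (rule that)
  define z where "z k = S (x (r (Suc k))) - S (x (r k))" for k
  show ?thesis
  proof (rule that[of z \<delta> "2 * L"])
    show "weakly_null smul z" unfolding weakly_null_def
    proof
      fix \<phi> assume \<phi>: "\<phi> \<in> dual_space smul"
      then have lin: "linear \<phi>" by (simp add: dual_space_def bounded_linear.linear)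
      obtain l where l: "(\<lambda>k. \<phi> (S (x (r k)))) \<longlonglongrightarrow> l" using r(2)[OF \<phi>] unfolding convergent_def by blast
      have "(\<lambda>k. \<phi> (S (x (r (Suc k)))) - \<phi> (S (x (r k)))) \<longlonglongrightarrow> l - l"
        by (intro tendsto_diff l LIMSEQ_Suc[OF l])
      then show "(\<lambda>k. \<phi> (z k)) \<longlonglongrightarrow> 0" by (simp add: z_def linear_diff[OF lin])
    qed
    show "\<delta> > 0" by (rule w(1))
    have nS: "norm (S (x k)) \<le> L" for k
      using L(2)[of "x k"] mult_left_mono[OF xb[of k], of L] L(1) by linarith
    show "norm (z k) \<le> 2 * L" for k
      unfolding z_def using norm_triangle_ineq4[of "S (x (r (Suc k)))" "S (x (r k))"] nS[of "r (Suc k)"] nS[of "r k"] by linarith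
    show "\<delta> \<le> norm ((S ^^ n) (z k))" for k
    proof -
      have "(S ^^ n) (z k) = w (r (Suc k)) - w (r k)"
        unfolding z_def Sn.diff xw funpow_Suc_right comp_def ..
      moreover have "\<delta> \<le> dist (w (r k)) (w (r (Suc k)))" using w(3) r(1) by (simp add: strict_mono_def)
      ultimately show ?thesis by (simp add: dist_norm norm_minus_commute)
    qed
  qed
qed

text \<open>For one sequence, Mazur's selection is followed by the selection for Schreier spreading.
  Membership for all further subsequences is what allows the sequences to be refined one after the
  other.\<close>

lemma SP1w_common_subsequence:
  fixes x :: "nat \<Rightarrow> nat \<Rightarrow> 'a" and n :: nat
  assumes wn: "\<And>i. i \<le> n \<Longrightarrow> weakly_null smul (x i)" and m: "m > 0"
    and low: "\<And>i k. i \<le> n \<Longrightarrow> m \<le> norm (x i k)" and up: "\<And>i k. i \<le> n \<Longrightarrow> norm (x i k) \<le> M"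
  shows "\<exists>r. strict_mono (r :: nat \<Rightarrow> nat) \<and> (\<forall>i\<le>n. \<forall>s :: nat \<Rightarrow> nat. strict_mono s \<longrightarrow> (\<lambda>k. x i (r (s k))) \<in> SP1w smul)"
proof -
  have single: "\<exists>t. strict_mono (t :: nat \<Rightarrow> nat) \<and> (\<forall>s :: nat \<Rightarrow> nat. strict_mono s \<longrightarrow> (\<lambda>k. y (t (s k))) \<in> SP1w smul)"
    if y: "weakly_null smul y" "\<And>k. m \<le> norm (y k)" "\<And>k. norm (y k) \<le> M" for y
  proof -
    obtain p where p: "strict_mono p" "basis_bound 2 (y \<circ> p)"
      by (rule mazur_basic_subsequence[OF y(1) m y(2)])
    obtain q where q: "strict_mono q" "\<And>s :: nat \<Rightarrow> nat. strict_mono s \<Longrightarrow> schreier_spreading smul (y \<circ> p \<circ> q \<circ> s)"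
      by (rule schreier_spreading_subsequence[of "y \<circ> p" M 2 m]) (use p m y in auto)
    have t: "strict_mono (p \<circ> q)" using p(1) q(1) by (rule strict_mono_o)
    have "(\<lambda>k. y ((p \<circ> q) (s k))) \<in> SP1w smul" if s: "strict_mono s" for s :: "nat \<Rightarrow> nat"
    proof -
      have "basis_bound 2 ((y \<circ> p) \<circ> (q \<circ> s))" by (rule basis_bound_subseq[OF p(2) strict_mono_o[OF q(1) s]])
      then have "basic_sequence smul ((y \<circ> p) \<circ> (q \<circ> s))"
        by (rule basis_bound_basic_sequence[where m = m]) (use m y(2) in auto)
      moreover have "seminormalized (\<lambda>k. y ((p \<circ> q) (s k)))" unfolding seminormalized_def
        using m y(2,3) by blast
      moreover have "weakly_null smul (\<lambda>k. y ((p \<circ> q) (s k)))"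
        using weakly_null_subseq[OF y(1) strict_mono_o[OF t s]] by (simp add: comp_def)
      ultimately show ?thesis using q(2)[OF s] unfolding SP1w_def by (simp add: comp_def)
    qed
    then show ?thesis using t by blast
  qed
  show ?thesis
    using wn low up
  proof (induction n)
    case 0
    show ?case using single[of "x 0"] 0 by auto
  next
    case (Suc n)
    then obtain r where r: "strict_mono (r :: nat \<Rightarrow> nat)"
      "\<forall>i\<le>n. \<forall>s :: nat \<Rightarrow> nat. strict_mono s \<longrightarrow> (\<lambda>k. x i (r (s k))) \<in> SP1w smul" by auto
    obtain t where t: "strict_mono (t :: nat \<Rightarrow> nat)"
      "\<forall>s :: nat \<Rightarrow> nat. strict_mono s \<longrightarrow> (\<lambda>k. x (Suc n) (r (t (s k)))) \<in> SP1w smul"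
      using single[of "\<lambda>k. x (Suc n) (r k)"] weakly_null_subseq[OF _ r(1)] Suc.prems by auto
    have "(\<lambda>k. x i (r (t (s k)))) \<in> SP1w smul" if "i \<le> Suc n" "strict_mono s" for i and s :: "nat \<Rightarrow> nat"
    proof (cases "i = Suc n")
      case False
      then have "i \<le> n" using that(1) by simp
      moreover have "strict_mono (\<lambda>k. t (s k))" using strict_mono_o[OF t(1) that(2)] by (simp add: comp_def)
      ultimately show ?thesis using r(2) by simp
    qed (use t(2) that in simp)
    then show ?case using strict_mono_o[OF r(1) t(1)] by (intro exI[of _ "\<lambda>k. r (t k)"]) (simp add: comp_def)
  qed
qed

lemma compact_power:
  assumes S: "S \<in> family_strictly_singular smul \<F>" and fin: "\<And>F. F \<in> \<F> \<Longrightarrow> finite F"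
    and quot: "finite (SP1w smul // equivalent_along smul \<F>)"
  shows "\<exists>n. compact (closure ((S ^^ Suc n) ` cball 0 1))"
proof (rule ccontr)
  assume nc: "\<nexists>n. compact (closure ((S ^^ Suc n) ` cball 0 1))"
  have S': "S \<in> bounded_operators smul" using S by (simp add: family_strictly_singular_def)
  \<comment> \<open>With \<open>n\<close> classes, the exponents 0 to \<open>n\<close> give one
    sequence too many.\<close>
  define n where "n = card (SP1w smul // equivalent_along smul \<F>)"
  have "\<not> compact (closure ((S ^^ Suc n) ` cball 0 1))" using nc by blast
  then obtain z \<delta> M where z: "weakly_null smul z" "\<delta> > 0" "\<And>k. norm (z k) \<le> M" "\<And>k. \<delta> \<le> norm ((S ^^ n) (z k))"
    using weakly_null_noncompact[OF S fin] by metis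
  obtain L where L: "L \<ge> 1" "\<And>v. norm (S v) \<le> L * norm v" using operator_bound[OF S'] by blast
  have pow: "norm ((S ^^ i) v) \<le> L ^ i * norm v" for i v
  proof (induction i)
    case (Suc i)
    have "norm (S ((S ^^ i) v)) \<le> L * (L ^ i * norm v)"
      using L(2)[of "(S ^^ i) v"] mult_left_mono[OF Suc, of L] L(1) by linarith
    then show ?case by (simp add: mult.assoc)
  qed simp
  \<comment> \<open>\<open>(S ^^ n) (z k)\<close> factors through \<open>(S ^^ i) (z k)\<close>, so
    the lower bound at the top power descends to every smaller one, uniformly because
    \<open>L \<ge> 1\<close>.\<close>
  have low: "\<delta> / L ^ n \<le> norm ((S ^^ i) (z k))" if i: "i \<le> n" for i k
  proof -
    have "\<delta> \<le> norm ((S ^^ (n - i)) ((S ^^ i) (z k)))"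
      using z(4)[of k] i by (metis comp_apply funpow_add le_add_diff_inverse2)
    also have "\<dots> \<le> L ^ (n - i) * norm ((S ^^ i) (z k))" by (rule pow)
    also have "\<dots> \<le> L ^ n * norm ((S ^^ i) (z k))" using L(1) by (intro mult_right_mono power_increasing) auto
    finally show ?thesis using L(1) by (simp add: field_simps)
  qed
  have up: "norm ((S ^^ i) (z k)) \<le> L ^ n * M" if i: "i \<le> n" for i k
  proof -
    have "norm ((S ^^ i) (z k)) \<le> L ^ i * norm (z k)" by (rule pow)
    also have "\<dots> \<le> L ^ n * M" using L(1) i z(3) by (intro mult_mono power_increasing) auto
    finally show ?thesis .
  qed
  have "\<exists>r. strict_mono (r :: nat \<Rightarrow> nat) \<and> (\<forall>i\<le>n. \<forall>s :: nat \<Rightarrow> nat. strict_mono s \<longrightarrow> (\<lambda>k. (S ^^ i) (z (r (s k)))) \<in> SP1w smul)"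
    by (rule SP1w_common_subsequence[where m = "\<delta> / L ^ n" and M = "L ^ n * M" and x = "\<lambda>i k. (S ^^ i) (z k)"])
      (use z(1,2) L(1) low up weakly_null_operator bounded_operators_funpow[OF S'] in auto)
  then obtain r where r: "strict_mono (r :: nat \<Rightarrow> nat)"
    "\<forall>i\<le>n. \<forall>s :: nat \<Rightarrow> nat. strict_mono s \<longrightarrow> (\<lambda>k. (S ^^ i) (z (r (s k)))) \<in> SP1w smul" by blast
  define y where "y i k = (S ^^ i) (z (r k))" for i k
  have y: "y i \<in> SP1w smul" if "i \<le> n" for i
    using r(2)[rule_format, OF that, of "\<lambda>k. k"] by (simp add: y_def[abs_def] strict_mono_def)
  define cl where "cl i = equivalent_along smul \<F> `` {y i}" for i
  have "cl ` {..n} \<subseteq> SP1w smul // equivalent_along smul \<F>" using y by (auto simp: cl_def quotientI)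
  then have "card (cl ` {..n}) < card {..n}" using card_mono[OF quot] by (simp add: n_def less_Suc_eq_le)
  then have "\<not> inj_on cl {..n}" using pigeonhole by blast
  then obtain i k where ik: "i \<le> n" "k \<le> n" "i < k" "cl i = cl k"
    unfolding inj_on_def by (metis atMost_iff linorder_neqE_nat)
  have "(y i, y k) \<in> equivalent_along smul \<F>"
    using ik(4) y[OF ik(1)] y[OF ik(2)] eq_equiv_class_iff[OF equiv_equivalent_along] unfolding cl_def by blast
  then obtain K where K: "K \<ge> 1" "\<And>F a. F \<in> \<F> \<Longrightarrow> approx K (norm (\<Sum>j\<in>F. smul (a j) (y i j))) (norm (\<Sum>j\<in>F. smul (a j) (y k j)))"
    unfolding equivalent_along_def by blast
  have "norm (\<Sum>j\<in>F. smul (a j) (y i j)) \<le> K * L ^ (k - i - 1) * norm (S (\<Sum>j\<in>F. smul (a j) (y i j)))" if F: "F \<in> \<F>" for F a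
  proof -
    let ?w = "\<Sum>j\<in>F. smul (a j) (y i j)"
    \<comment> \<open>The sequence \<open>y k\<close> arises from \<open>y i\<close> by applying
      \<open>S\<close> first and the remaining \<open>k - i - 1\<close> factors afterwards. The
      bound for the power therefore becomes one for \<open>S\<close> itself.\<close>
    have k: "k = (k - i - 1) + Suc i" using ik(3) by simp
    have "y k j = (S ^^ (k - i - 1)) (S (y i j))" for j
      unfolding y_def by (subst k, subst funpow_add) simp
    then have eq: "(\<Sum>j\<in>F. smul (a j) (y k j)) = (S ^^ (k - i - 1)) (S ?w)"
      by (simp add: operator_sum[OF S'] operator_sum[OF bounded_operators_funpow[OF S']])
    have "norm ?w \<le> K * norm (\<Sum>j\<in>F. smul (a j) (y k j))"
      using K(2)[OF F, of a] K(1) unfolding approx_def by (simp add: field_simps)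
    also have "\<dots> \<le> K * (L ^ (k - i - 1) * norm (S ?w))"
      unfolding eq using K(1) pow by (intro mult_left_mono) auto
    finally show ?thesis by (simp only: mult.assoc)
  qed
  moreover have "basic_sequence smul (y i)" using y[OF ik(1)] by (simp add: SP1w_def)
  moreover have "K * L ^ (k - i - 1) > 0" using K(1) L(1) by simp
  ultimately show False using not_bounded_below_on_family[OF S fin, of "y i" "K * L ^ (k - i - 1)"] by blast
qed

theorem hyperinvariant_of_finite_quotient:
  assumes inf: "infinite_dimensional smul (UNIV :: 'a set)"
    and fin: "\<And>F. F \<in> \<F> \<Longrightarrow> finite F"
    and quot: "finite (SP1w smul // equivalent_along smul \<F>)"
    and S: "S \<in> family_strictly_singular smul \<F> - {\<lambda>_. 0}"
  shows "\<exists>M. nontrivial_hyperinvariant smul S M"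
proof -
  obtain n where "compact (closure ((S ^^ Suc n) ` cball 0 1))" using compact_power[OF _ fin quot] S by blast
  then show ?thesis using S inf
    by (intro hyperinvariant_of_compact_power) (auto simp: family_strictly_singular_def)
qed

section \<open>Part (ii) as the case of all finite index sets\<close>

lemma equivalent_seq_along:
  "equivalent_seq smul = equivalent_along smul {F. finite F \<and> F \<subseteq> {1..}}"
proof -
  have "(\<forall>a :: nat \<Rightarrow> 'k. finite {n. a n \<noteq> 0} \<longrightarrow>
      approx K (norm (\<Sum>n\<in>{n. 1 \<le> n \<and> a n \<noteq> 0}. smul (a n) (x n))) (norm (\<Sum>n\<in>{n. 1 \<le> n \<and> a n \<noteq> 0}. smul (a n) (y n)))) \<longleftrightarrow>
    (\<forall>F\<in>{F. finite F \<and> F \<subseteq> {1..}}. \<forall>a. approx K (norm (\<Sum>i\<in>F. smul (a i) (x i))) (norm (\<Sum>i\<in>F. smul (a i) (y i))))"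
    (is "?L \<longleftrightarrow> ?R") for K and x y :: "nat \<Rightarrow> 'a"
  proof
    assume L: ?L
    show ?R
    proof (intro ballI allI)
      fix F :: "nat set" and a :: "nat \<Rightarrow> 'k" assume "F \<in> {F. finite F \<and> F \<subseteq> {1..}}"
      then have F: "finite F" "F \<subseteq> {1..}" by auto
      define b where "b i = (if i \<in> F then a i else 0)" for i
      have sub: "{n. 1 \<le> n \<and> b n \<noteq> 0} \<subseteq> F" by (auto simp: b_def)
      have eq: "(\<Sum>n\<in>{n. 1 \<le> n \<and> b n \<noteq> 0}. smul (b n) (v n)) = (\<Sum>i\<in>F. smul (a i) (v i))" for v
        using F sub by (intro sum.mono_neutral_cong_left) (auto simp: b_def)
      have "finite {n. b n \<noteq> 0}" using F(1) by (rule finite_subset[rotated]) (auto simp: b_def)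
      then show "approx K (norm (\<Sum>i\<in>F. smul (a i) (x i))) (norm (\<Sum>i\<in>F. smul (a i) (y i)))"
        using L[rule_format, of b] unfolding eq by blast
    qed
  next
    assume R: ?R
    show ?L
    proof (intro allI impI)
      fix a :: "nat \<Rightarrow> 'k" assume "finite {n. a n \<noteq> 0}"
      then have "{n. 1 \<le> n \<and> a n \<noteq> 0} \<in> {F. finite F \<and> F \<subseteq> {1..}}" by (auto intro: finite_subset[rotated])
      then show "approx K (norm (\<Sum>n\<in>{n. 1 \<le> n \<and> a n \<noteq> 0}. smul (a n) (x n))) (norm (\<Sum>n\<in>{n. 1 \<le> n \<and> a n \<noteq> 0}. smul (a n) (y n)))"
        by (rule R[rule_format])
    qed
  qed
  then show ?thesis unfolding equivalent_seq_def equivalent_along_def by simp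
qed

text \<open>If the family condition fails for \<open>x\<close> and \<open>\<epsilon>\<close>, then
  \<open>T\<close> is bounded below by \<open>\<epsilon>\<close> on the linear span of the sequence,
  since each vector there lies in the span of finitely many terms. Strict singularity quantifies
  over all subspaces, closed or not, so this span already gives the contradiction.\<close>

lemma strictly_singular_family:
  "strictly_singular smul \<subseteq> family_strictly_singular smul {F. finite F \<and> F \<subseteq> {1..}}"
proof
  fix T assume T: "T \<in> strictly_singular smul"
  then have bo: "T \<in> bounded_operators smul" by (simp add: strictly_singular_def)
  then have bl: "bounded_linear T" by (simp add: bounded_operators_def)
  interpret T: bounded_linear T by (rule bl)
  have "\<exists>F\<in>{F. finite F \<and> F \<subseteq> {1..}}. \<exists>z\<in>closure (span (x ` F)) - {0}. norm (T z) \<le> \<epsilon> * norm z"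
    if e: "\<epsilon> > 0" and x: "basic_sequence smul x" for \<epsilon> x
  proof (rule ccontr)
    assume no: "\<not> ?thesis"
    define Y where "Y = span (x ` {1..})"
    have low: "\<epsilon> * norm z \<le> norm (T z)" if z: "z \<in> Y" for z
    proof (cases "z = 0")
      case False
      obtain U c where U: "finite U" "U \<subseteq> x ` {1..}" "z = (\<Sum>v\<in>U. smul (c v) v)"
        using z unfolding Y_def span_explicit by blast
      have zU: "z \<in> span U" unfolding U(3) by (auto intro: span_sum span_scale span_base)
      obtain F where F: "finite F" "F \<subseteq> {1..}" "U = x ` F" using finite_subset_image[OF U(1,2)] by blast
      have "z \<in> closure (span (x ` F))" using subsetD[OF closure_subset zU] F(3) by simp
      then have "z \<in> closure (span (x ` F)) - {0}" using False by simp
      moreover have "F \<in> {F. finite F \<and> F \<subseteq> {1..}}" using F(1,2) by simp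
      ultimately have "\<not> norm (T z) \<le> \<epsilon> * norm z" using no by meson
      then show ?thesis by simp
    qed simp
    have inj: "inj_on T Y"
    proof (rule inj_onI)
      fix u v assume uv: "u \<in> Y" "v \<in> Y" "T u = T v"
      then have "\<epsilon> * norm (u - v) \<le> 0" using low[of "u - v"] by (simp add: Y_def span_diff T.diff)
      then show "u = v" using e by (simp add: mult_le_0_iff)
    qed
    have "homeomorphism Y (T ` Y) T (inv_into Y T)"
      unfolding homeomorphism_def
    proof (intro conjI ballI)
      show "continuous_on Y T" by (rule linear_continuous_on[OF bl])
      show "inv_into Y T ` T ` Y = Y" using inj by (simp add: inv_into_image_cancel)
      show "inv_into Y T (T u) = u" if "u \<in> Y" for u using inj that by (rule inv_into_f_f)
      show "T (inv_into Y T v) = v" if "v \<in> T ` Y" for v using that by (rule f_inv_into_f)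
      show "continuous_on (T ` Y) (inv_into Y T)"
        unfolding continuous_on_iff
      proof (intro ballI allI impI)
        fix v and d :: real assume v: "v \<in> T ` Y" and d: "d > 0"
        have "dist (inv_into Y T v') (inv_into Y T v) < d" if v': "v' \<in> T ` Y" "dist v' v < \<epsilon> * d" for v'
        proof -
          have "\<epsilon> * norm (inv_into Y T v' - inv_into Y T v) \<le> norm (T (inv_into Y T v' - inv_into Y T v))"
            using inv_into_into[OF v] inv_into_into[OF v'(1)] by (intro low) (simp add: Y_def span_diff)
          also have "\<dots> = dist v' v" by (simp add: T.diff f_inv_into_f[OF v] f_inv_into_f[OF v'(1)] dist_norm)
          also have "\<dots> < \<epsilon> * d" by (rule v'(2))
          finally show ?thesis using e by (simp add: dist_norm)
        qed
        then show "\<exists>\<delta>>0. \<forall>v'\<in>T ` Y. dist v' v < \<delta> \<longrightarrow> dist (inv_into Y T v') (inv_into Y T v) < d"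
          using e d by (intro exI[of _ "\<epsilon> * d"]) simp
      qed
    qed simp
    moreover have "subspace Y" unfolding Y_def by (rule subspace_span)
    moreover have "infinite_dimensional smul Y" unfolding Y_def by (rule basic_sequence_independent[OF x])
    ultimately show False using T unfolding strictly_singular_def by blast
  qed
  then show "T \<in> family_strictly_singular smul {F. finite F \<and> F \<subseteq> {1..}}"
    using bo by (simp add: family_strictly_singular_def)
qed

end

lemma schreier_finite: "F \<in> schreier L \<eta> \<Longrightarrow> finite F"
proof (induction L \<eta> arbitrary: F rule: schreier.induct)
  case (1 L \<eta>)
  show ?case
  proof (cases "ord_zero \<eta>")
    case True
    then show ?thesis using "1.prems" by (auto simp: schreier_zero schreier0_def)
  next
    case nz: False
    show ?thesis
    proof (cases "\<exists>\<zeta>. ord_succ \<zeta> \<eta>")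
      case True
      then have "F \<in> family_comp schreier1 (schreier L (THE \<zeta>. ord_succ \<zeta> \<eta>))"
        using "1.prems" nz by (subst (asm) schreier.simps) simp
      then show ?thesis using "1.IH"(1)[OF nz True] unfolding family_comp_def by auto
    next
      case False
      then obtain n where "1 \<le> n" "L \<eta> n < \<eta>" "F \<in> schreier L (L \<eta> n)"
        using "1.prems" nz by (subst (asm) schreier.simps) auto
      then show ?thesis using "1.IH"(2)[OF nz False] by blast
    qed
  qed
qed

theorem proposition5p3:
  fixes smul :: "'k::real_or_complex \<Rightarrow> 'a::banach \<Rightarrow> 'a"
    and L :: "'o::wellorder \<Rightarrow> nat \<Rightarrow> 'o"
    and \<xi> :: 'o
  assumes "banach_space_over smul"
    and "infinite_dimensional smul (UNIV :: 'a set)"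
    and "ladder_system L"
    and "\<not> ord_zero \<xi>" and "countable {..<\<xi>}"
  shows "(finite (SP1w smul // equivalent_along smul (schreier L \<xi>)) \<longrightarrow>
           (\<forall>S \<in> family_strictly_singular smul (schreier L \<xi>) - {\<lambda>_. 0}.
              \<exists>M. nontrivial_hyperinvariant smul S M)) \<and>
         (finite (SP1w smul // equivalent_seq smul) \<longrightarrow>
           (\<forall>S \<in> strictly_singular smul - {\<lambda>_. 0}.
              \<exists>M. nontrivial_hyperinvariant smul S M))"
proof -
  interpret banach_space_over smul by (rule assms(1))
  show ?thesis
  proof (intro conjI impI ballI)
    fix S assume "finite (SP1w smul // equivalent_along smul (schreier L \<xi>))"
      "S \<in> family_strictly_singular smul (schreier L \<xi>) - {\<lambda>_. 0}"
    then show "\<exists>M. nontrivial_hyperinvariant smul S M"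
      using hyperinvariant_of_finite_quotient[OF assms(2), of "schreier L \<xi>"] schreier_finite by blast
  next
    fix S assume "finite (SP1w smul // equivalent_seq smul)" and S: "S \<in> strictly_singular smul - {\<lambda>_. 0}"
    then have "finite (SP1w smul // equivalent_along smul {F. finite F \<and> F \<subseteq> {1..}})"
      by (simp only: equivalent_seq_along)
    then show "\<exists>M. nontrivial_hyperinvariant smul S M"
      using hyperinvariant_of_finite_quotient[OF assms(2), of "{F. finite F \<and> F \<subseteq> {1..}}"]
        S strictly_singular_family by blast
  qed
qed

end
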